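(* Let $\overline{\mathbf U}=(\overline U_1,\overline U_2)$ be a real sequence pair with $\overline{\mathbf U}=\boldsymbol\Pi^{\le N_0}\overline{\mathbf U}$ such that $\overline{\mathbf u}:=\boldsymbol\gamma^\dagger(\overline{\mathbf U})$ satisfies $\overline{\mathbf u}(\pm d)=0$ (so $\overline{\mathbf u}\in\mathcal H_e$). Let $\overline\Psi,\overline\Phi,\overline\Phi_{\mathrm{inv}},\mathscr g(\overline{\mathbf U}),B^N,\mathbb A,L,\mathbb F$ be as in the context, and assume $\|e_0-\overline\Phi*\overline\Phi_{\mathrm{inv}}\|_1<1$. Define $$\mathcal Y_{0,1}:=\sqrt{\left\|B^N\left(L\overline{\mathbf U}+\begin{bmatrix}\mathscr g(\overline{\mathbf U})\\0\end{bmatrix}\right)\right\|_2^2+\left\|(\boldsymbol\Pi^{\le N_0}-\boldsymbol\Pi^{\le N})L\overline{\mathbf U}+\begin{bmatrix}(\Pi^{\le 4N_0}-\Pi^{\le N})(\overline\Psi*\overline\Phi_{\mathrm{inv}})\\0\end{bmatrix}\right\|_2^2},$$ $$\mathcal Y_{0,2}:=\max(1,\|B^N\|_2)\,\|\overline\Psi\|_2\,\frac{\|\overline\Phi_{\mathrm{inv}}*(e_0-\overline\Phi*\overline\Phi_{\mathrm{inv}})\|_1}{1-\|e_0-\overline\Phi*\overline\Phi_{\mathrm{inv}}\|_1},\qquad \mathcal Y_0:=|\Omega_0|^{1/2}(\mathcal Y_{0,1}+\mathcal Y_{0,2}).$$ Then $\|\mathbb A\,\mathbb F(\overline{\mathbf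 u})\|_{\mathcal H}\le\mathcal Y_0$.
   Context: Parameters. $\nu,\nu_1,\dots,\nu_5>0$ with $\nu_2>1/4$; $\lambda_1$ is a real root of $\nu_3\nu_2\lambda_1^3-((\nu_4\nu_2-1)\nu_3-\nu_1)\lambda_1^2+((\nu_5\nu_1-(\nu_4-1))\nu_3-\nu_4\nu_1)\lambda_1-\nu_4\nu_3=0$, and $\lambda_2=\frac{(1+\lambda_1+\nu_2\lambda_1^2)(\nu_4-\lambda_1)}{\nu_1\lambda_1}$, $\lambda_3=\nu_1\nu+(\lambda_1-\nu_4)\nu_2$, $\lambda_4=\nu_1\lambda_2+(1+2\nu_2\lambda_1)(\lambda_1-\nu_4)+\nu_1\lambda_1\nu$, $\lambda_5=\nu_3\nu-1$, $\lambda_6=-\frac{\lambda_1\lambda_4+\lambda_4+\lambda_1^2\lambda_4\nu_2}{(1+\lambda_1+\nu_2\lambda_1^2)^2}$, $\lambda_7=\frac{\nu_1\lambda_1}{1+\lambda_1+\nu_2\lambda_1^2}$. Equation on $\mathbb R$. For $\mathbf u=(u_1,u_2):\mathbb R\to\mathbb R^2$, $\mathbb F(\mathbf u)=\mathbb L\mathbf u+\mathbb G(\mathbf u)$ with $\mathbb L=\begin{bmatrix}\nu\Delta+(\lambda_6-1)I&\lambda_7 I\\ \lambda_5 I&\Delta-\nu_3 I\end{bmatrix}$, $\mathbb G(\mathbf u)=(\mathbb g(\mathbf u),0)$, $\mathbb g(\mathbf u)=-\frac{\lambda_3u_1^2+\lambda_4u_1-\nu_1u_1u_2-\nu_1\lambda_1u_2}{1+u_1+\lambda_1+\nu_2(u_1+\lambda_1)^2}-\lambda_6u_1-\lambda_7u_2$.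 The symbol of $\mathbb L$ is $l(\xi)=\begin{bmatrix}-\nu|2\pi\xi|^2+\lambda_6-1&\lambda_7\\ \lambda_5&-|2\pi\xi|^2-\nu_3\end{bmatrix}$. Standing assumption: there is $\sigma_0>0$ with $|\det l(\xi)|\ge\sigma_0$ for all $\xi\in\mathbb R$. $\mathcal H=\{\mathbf u\in L^2(\mathbb R)^2:\|\mathbf u\|_{\mathcal H}:=\|\mathbb L\mathbf u\|_2<\infty\}$; $\mathcal H_e$ and $L^2_e$ are the subspaces of even functions in $\mathcal H$ and $L^2(\mathbb R)^2$. $\mathbb L:\mathcal H_e\to L^2_e$ is an isometric isomorphism. Sequence spaces. $\Omega_0=(-d,d)$, $1\le d<\infty$, $|\Omega_0|=2d$, $\tilde n=n/(2d)$, $\mathbb N_0=\{0,1,2,\dots\}$, $\alpha_0=1$, $\alpha_n=2$ for $n\ge1$. $\|U\|_p=(\sum_{n\in\mathbb N_0}\alpha_n|u_n|^p)^{1/p}$ on $\ell^p(\mathbb N_0)$; $\ell^2_e=\ell^2(\mathbb N_0)^2$ with $\|\mathbf U\|_2=(\|U_1\|_2^2+\|U_2\|_2^2)^{1/2}$; $\|\cdot\|_2$ of an operator is the induced operator norm. $(U*V)_n=\sum_{k\in\mathbb Z}u_{|n-k|}v_{|k|}$; $e_0=(1,0,0,\dots)$. $(\gamma(u))_n=\frac1{|\Omega_0|}\int_{\Omega_0}u(x)e^{-2\pi i\tilde nx}dx$, $\gamma^\dagger(U)(x)=\mathbb 1_{\Omega_0}(x)\sum_{n\in\mathbb N_0}\alpha_nu_n\cos(2\pi\tilde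 nx)$; $\boldsymbol\gamma,\boldsymbol\gamma^\dagger$ act componentwise on pairs. $\Pi^{\le M}$ keeps the entries with index $n\le M$ and sets the others to $0$; $\Pi^{>M}=I-\Pi^{\le M}$; $\boldsymbol\Pi^{\le M},\boldsymbol\Pi^{>M}$ act componentwise. $L$ acts on pairs by $(L\mathbf U)_n=l(\tilde n)\mathbf U_n$. Nonlinearity. $N,N_0\in\mathbb N$ fixed. $\overline\Psi=\lambda_3\overline U_1*\overline U_1+\lambda_4\overline U_1-\nu_1\overline U_1*\overline U_2-\nu_1\lambda_1\overline U_2$, $\overline\Phi=(1+\lambda_1)e_0+\overline U_1+\nu_2(\overline U_1+\lambda_1e_0)*(\overline U_1+\lambda_1e_0)$. $\overline\Phi_{\mathrm{inv}}$ is a fixed real sequence with $\overline\Phi_{\mathrm{inv}}=\Pi^{\le 2N_0}\overline\Phi_{\mathrm{inv}}$ (a numerical approximation of the convolution inverse of $\overline\Phi$). $\mathscr g(\overline{\mathbf U})=-\overline\Psi*\overline\Phi_{\mathrm{inv}}-\lambda_6\overline U_1-\lambda_7\overline U_2$. Approximate inverse. $B^N=\begin{bmatrix}B^N_{11}&B^N_{12}\\0&\Pi^{\le N}\end{bmatrix}$, where $B^N_{1j}=\Pi^{\le N}B^N_{1j}\Pi^{\le N}$ are fixed (numerically chosen) finite matrices, and $B=\boldsymbol\Pi^{>N}+B^N$. $\mathbb B:L^2_e\to L^2_e$ is $\mathbb B\mathbf u=\mathbb 1_{\mathbb R\setminus\Omega_0}\mathbf u+\boldsymbol\gamma^\dagger(B\,\boldsymbol\gamma(\mathbf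 u))$, and $\mathbb A=\mathbb L^{-1}\mathbb B:L^2_e\to\mathcal H_e$.
   Formalization: The displayed Y_{0,1} bound is claimed only for N_0 ≤ N, since it can fail when N < N_0; for all N, N_0 the bound is proved with Ψ*Φ_inv in the second block of Y_{0,1} replaced by g(U), which gives the same value when N_0 ≤ N. The condition u(±d)=0 is read as one-sided limits from inside. *)

theory Defs
  imports "HOL-Analysis.Analysis"
begin

subsection \<open>Parameters\<close>

record params =
  nu :: real
  nu1 :: real
  nu2 :: real
  nu3 :: real
  nu4 :: real
  nu5 :: real
  lam1 :: real

definition lam1_root :: "params \<Rightarrow> bool" where
  "lam1_root p \<longleftrightarrow>
     nu3 p * nu2 p * lam1 p ^ 3
     - ((nu4 p * nu2 p - 1) * nu3 p - nu1 p) * lam1 p ^ 2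
     + ((nu5 p * nu1 p - (nu4 p - 1)) * nu3 p - nu4 p * nu1 p) * lam1 p
     - nu4 p * nu3 p = 0"

definition lam2 :: "params \<Rightarrow> real" where
  "lam2 p = (1 + lam1 p + nu2 p * lam1 p ^ 2) * (nu4 p - lam1 p) / (nu1 p * lam1 p)"

definition lam3 :: "params \<Rightarrow> real" where
  "lam3 p = nu1 p * nu p + (lam1 p - nu4 p) * nu2 p"

definition lam4 :: "params \<Rightarrow> real" where
  "lam4 p = nu1 p * lam2 p + (1 + 2 * nu2 p * lam1 p) * (lam1 p - nu4 p)
            + nu1 p * lam1 p * nu p"

definition lam5 :: "params \<Rightarrow> real" where
  "lam5 p = nu3 p * nu p - 1"

definition lam6 :: "params \<Rightarrow> real" where
  "lam6 p = - ((lam1 p * lam4 p + lam4 p + lam1 p ^ 2 * lam4 p * nu2 p)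
               / (1 + lam1 p + nu2 p * lam1 p ^ 2) ^ 2)"

definition lam7 :: "params \<Rightarrow> real" where
  "lam7 p = nu1 p * lam1 p / (1 + lam1 p + nu2 p * lam1 p ^ 2)"

definition symb :: "params \<Rightarrow> real \<Rightarrow> real^2^2" where
  "symb p \<xi> = vector [vector [- nu p * \<bar>2 * pi * \<xi>\<bar>\<^sup>2 + lam6 p - 1, lam7 p],
                      vector [lam5 p, - \<bar>2 * pi * \<xi>\<bar>\<^sup>2 - nu3 p]]"


subsection \<open>The equation on the real line\<close>

text \<open>Elements of \<open>L\<^sup>2(\<real>)\<^sup>2\<close> are represented by functions; equality, evenness and
  the value of an operator are therefore meant almost everywhere.\<close>

definition L2 :: "(real \<Rightarrow> real^2) set" where
  "L2 = {u. u \<in> borel_measurable lborel \<and> integrable lborel (\<lambda>x. (norm (u x))\<^sup>2)}"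

definition norm_L2 :: "(real \<Rightarrow> real^2) \<Rightarrow> real" where
  "norm_L2 u = sqrt (LINT x|lborel. (norm (u x))\<^sup>2)"

definition ae_even :: "(real \<Rightarrow> real^2) \<Rightarrow> bool" where
  "ae_even u \<longleftrightarrow> (AE x in lborel. u (- x) = u x)"

definition L2_e :: "(real \<Rightarrow> real^2) set" where
  "L2_e = {u \<in> L2. ae_even u}"

definition test_fun :: "(real \<Rightarrow> real) \<Rightarrow> bool" where
  "test_fun \<phi> \<longleftrightarrow> (\<forall>k x. (deriv ^^ k) \<phi> differentiable (at x))
                  \<and> (\<exists>R. \<forall>x. \<bar>x\<bar> > R \<longrightarrow> \<phi> x = 0)"

text \<open>\<open>weak_LL p u w\<close>: \<open>w\<close> is the distribution obtained by applying the matrix differential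
  operator \<open>[[\<nu>\<Delta> + (\<lambda>\<^sub>6 - 1)I, \<lambda>\<^sub>7 I], [\<lambda>\<^sub>5 I, \<Delta> - \<nu>\<^sub>3 I]]\<close> to \<open>u\<close>.\<close>

definition weak_LL :: "params \<Rightarrow> (real \<Rightarrow> real^2) \<Rightarrow> (real \<Rightarrow> real^2) \<Rightarrow> bool" where
  "weak_LL p u w \<longleftrightarrow> (\<forall>\<phi>. test_fun \<phi> \<longrightarrow>
     (LINT x|lborel. w x $ 1 * \<phi> x) =
       (LINT x|lborel. nu p * u x $ 1 * deriv (deriv \<phi>) x
                       + ((lam6 p - 1) * u x $ 1 + lam7 p * u x $ 2) * \<phi> x) \<and>
     (LINT x|lborel. w x $ 2 * \<phi> x) =
       (LINT x|lborel. u x $ 2 * deriv (deriv \<phi>) x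
                       + (lam5 p * u x $ 1 - nu3 p * u x $ 2) * \<phi> x))"

definition H :: "params \<Rightarrow> (real \<Rightarrow> real^2) set" where
  "H p = {u \<in> L2. \<exists>w \<in> L2. weak_LL p u w}"

definition H_e :: "params \<Rightarrow> (real \<Rightarrow> real^2) set" where
  "H_e p = {u \<in> H p. ae_even u}"

definition LL :: "params \<Rightarrow> (real \<Rightarrow> real^2) \<Rightarrow> (real \<Rightarrow> real^2)" where
  "LL p u = (SOME w. w \<in> L2 \<and> weak_LL p u w)"

definition norm_H :: "params \<Rightarrow> (real \<Rightarrow> real^2) \<Rightarrow> real" where
  "norm_H p u = norm_L2 (LL p u)"

definition LL_inv :: "params \<Rightarrow> (real \<Rightarrow> real^2) \<Rightarrow> (real \<Rightarrow> real^2)" where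
  "LL_inv p w = (SOME u. u \<in> H_e p \<and> (AE x in lborel. LL p u x = w x))"

definition g_fun :: "params \<Rightarrow> real \<Rightarrow> real \<Rightarrow> real" where
  "g_fun p a b =
     - ((lam3 p * a\<^sup>2 + lam4 p * a - nu1 p * a * b - nu1 p * lam1 p * b)
        / (1 + a + lam1 p + nu2 p * (a + lam1 p)\<^sup>2))
     - lam6 p * a - lam7 p * b"

definition GG :: "params \<Rightarrow> (real \<Rightarrow> real^2) \<Rightarrow> (real \<Rightarrow> real^2)" where
  "GG p u = (\<lambda>x. vector [g_fun p (u x $ 1) (u x $ 2), 0])"

definition FF :: "params \<Rightarrow> (real \<Rightarrow> real^2) \<Rightarrow> (real \<Rightarrow> real^2)" where
  "FF p u = (\<lambda>x. LL p u x + GG p u x)"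


subsection \<open>Sequence spaces\<close>

text \<open>A pair of sequences is represented as \<open>nat \<Rightarrow> real^2\<close>.\<close>

definition alpha :: "nat \<Rightarrow> real" where
  "alpha n = (if n = 0 then 1 else 2)"

definition freq :: "real \<Rightarrow> nat \<Rightarrow> real" where
  "freq d n = real n / (2 * d)"

definition ell :: "real \<Rightarrow> (nat \<Rightarrow> real) set" where
  "ell q = {U. summable (\<lambda>n. alpha n * \<bar>U n\<bar> powr q)}"

definition seq_norm :: "real \<Rightarrow> (nat \<Rightarrow> real) \<Rightarrow> real" where
  "seq_norm q U = (\<Sum>n. alpha n * \<bar>U n\<bar> powr q) powr (1 / q)"

definition comp :: "2 \<Rightarrow> (nat \<Rightarrow> real^2) \<Rightarrow> (nat \<Rightarrow> real)" where
  "comp i U = (\<lambda>n. U n $ i)"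

definition pair :: "(nat \<Rightarrow> real) \<Rightarrow> (nat \<Rightarrow> real) \<Rightarrow> (nat \<Rightarrow> real^2)" where
  "pair V W = (\<lambda>n. vector [V n, W n])"

definition ell2_e :: "(nat \<Rightarrow> real^2) set" where
  "ell2_e = {U. comp 1 U \<in> ell 2 \<and> comp 2 U \<in> ell 2}"

definition pair_norm2 :: "(nat \<Rightarrow> real^2) \<Rightarrow> real" where
  "pair_norm2 U = sqrt ((seq_norm 2 (comp 1 U))\<^sup>2 + (seq_norm 2 (comp 2 U))\<^sup>2)"

definition op_norm2 :: "((nat \<Rightarrow> real^2) \<Rightarrow> (nat \<Rightarrow> real^2)) \<Rightarrow> real" where
  "op_norm2 T = (SUP U \<in> {U \<in> ell2_e. pair_norm2 U \<le> 1}. pair_norm2 (T U))"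

definition conv :: "(nat \<Rightarrow> real) \<Rightarrow> (nat \<Rightarrow> real) \<Rightarrow> (nat \<Rightarrow> real)" (infixl "\<star>" 70) where
  "U \<star> V = (\<lambda>n. \<Sum>\<^sub>\<infinity>k::int. U (nat \<bar>int n - k\<bar>) * V (nat \<bar>k\<bar>))"

definition e0 :: "nat \<Rightarrow> real" where
  "e0 n = (if n = 0 then 1 else 0)"

definition Pi_le :: "nat \<Rightarrow> (nat \<Rightarrow> 'a::ab_group_add) \<Rightarrow> (nat \<Rightarrow> 'a)" where
  "Pi_le M U = (\<lambda>n. if n \<le> M then U n else 0)"

definition Pi_gt :: "nat \<Rightarrow> (nat \<Rightarrow> 'a::ab_group_add) \<Rightarrow> (nat \<Rightarrow> 'a)" where
  "Pi_gt M U = (\<lambda>n. U n - Pi_le M U n)"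

text \<open>The Fourier coefficients of an even real function are real, so taking the real part
  changes nothing on even functions; it only makes \<open>gamma\<close> real valued.\<close>

definition gamma :: "real \<Rightarrow> (real \<Rightarrow> real) \<Rightarrow> (nat \<Rightarrow> real)" where
  "gamma d u = (\<lambda>n. Re ((LINT x:{-d<..<d}|lborel.
       complex_of_real (u x) * exp (- (2 * complex_of_real pi * \<i> * complex_of_real (freq d n * x))))
     / complex_of_real (2 * d)))"

text \<open>For a sequence in \<open>\<ell>\<^sup>2\<close> the cosine series converges almost everywhere (Carleson), so its
  pointwise sum represents the sum in \<open>L\<^sup>2\<close>.\<close>

definition gamma_dag :: "real \<Rightarrow> (nat \<Rightarrow> real) \<Rightarrow> (real \<Rightarrow> real)" where
  "gamma_dag d U = (\<lambda>x. indicator {-d<..<d} x * (\<Sum>n. alpha n * U n * cos (2 * pi * freq d n * x)))"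

definition Gamma2 :: "real \<Rightarrow> (real \<Rightarrow> real^2) \<Rightarrow> (nat \<Rightarrow> real^2)" where
  "Gamma2 d u = pair (gamma d (\<lambda>x. u x $ 1)) (gamma d (\<lambda>x. u x $ 2))"

definition Gamma2_dag :: "real \<Rightarrow> (nat \<Rightarrow> real^2) \<Rightarrow> (real \<Rightarrow> real^2)" where
  "Gamma2_dag d U = (\<lambda>x. vector [gamma_dag d (comp 1 U) x, gamma_dag d (comp 2 U) x])"

definition Lseq :: "params \<Rightarrow> real \<Rightarrow> (nat \<Rightarrow> real^2) \<Rightarrow> (nat \<Rightarrow> real^2)" where
  "Lseq p d U = (\<lambda>n. symb p (freq d n) *v U n)"


subsection \<open>The nonlinearity on sequences\<close>

definition Psi :: "params \<Rightarrow> (nat \<Rightarrow> real^2) \<Rightarrow> (nat \<Rightarrow> real)" where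
  "Psi p U = (\<lambda>n. lam3 p * (comp 1 U \<star> comp 1 U) n + lam4 p * U n $ 1
                  - nu1 p * (comp 1 U \<star> comp 2 U) n - nu1 p * lam1 p * U n $ 2)"

definition Phi :: "params \<Rightarrow> (nat \<Rightarrow> real^2) \<Rightarrow> (nat \<Rightarrow> real)" where
  "Phi p U = (\<lambda>n. (1 + lam1 p) * e0 n + U n $ 1
       + nu2 p * ((\<lambda>k. U k $ 1 + lam1 p * e0 k) \<star> (\<lambda>k. U k $ 1 + lam1 p * e0 k)) n)"

definition gseq :: "params \<Rightarrow> (nat \<Rightarrow> real) \<Rightarrow> (nat \<Rightarrow> real^2) \<Rightarrow> (nat \<Rightarrow> real)" where
  "gseq p Phi_inv U = (\<lambda>n. - (Psi p U \<star> Phi_inv) n - lam6 p * U n $ 1 - lam7 p * U n $ 2)"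

definition residual :: "params \<Rightarrow> (nat \<Rightarrow> real) \<Rightarrow> (nat \<Rightarrow> real^2) \<Rightarrow> (nat \<Rightarrow> real)" where
  "residual p Phi_inv U = (\<lambda>n. e0 n - (Phi p U \<star> Phi_inv) n)"


subsection \<open>The approximate inverse\<close>

text \<open>Only the entries of \<open>b\<close> with indices at most \<open>N\<close> are used: the operator is
  \<open>\<Pi>\<^bsup>\<le>N\<^esup> b \<Pi>\<^bsup>\<le>N\<^esup>\<close>.\<close>

definition fin_mat :: "nat \<Rightarrow> (nat \<Rightarrow> nat \<Rightarrow> real) \<Rightarrow> (nat \<Rightarrow> real) \<Rightarrow> (nat \<Rightarrow> real)" where
  "fin_mat N b V = Pi_le N (\<lambda>n. \<Sum>k\<le>N. b n k * V k)"

definition BN :: "nat \<Rightarrow> (nat \<Rightarrow> nat \<Rightarrow> real) \<Rightarrow> (nat \<Rightarrow> nat \<Rightarrow> real)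
                  \<Rightarrow> (nat \<Rightarrow> real^2) \<Rightarrow> (nat \<Rightarrow> real^2)" where
  "BN N b11 b12 U = pair (\<lambda>n. fin_mat N b11 (comp 1 U) n + fin_mat N b12 (comp 2 U) n)
                         (Pi_le N (comp 2 U))"

definition Bseq :: "nat \<Rightarrow> (nat \<Rightarrow> nat \<Rightarrow> real) \<Rightarrow> (nat \<Rightarrow> nat \<Rightarrow> real)
                    \<Rightarrow> (nat \<Rightarrow> real^2) \<Rightarrow> (nat \<Rightarrow> real^2)" where
  "Bseq N b11 b12 U = (\<lambda>n. Pi_gt N U n + BN N b11 b12 U n)"

definition BB :: "real \<Rightarrow> nat \<Rightarrow> (nat \<Rightarrow> nat \<Rightarrow> real) \<Rightarrow> (nat \<Rightarrow> nat \<Rightarrow> real)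
                  \<Rightarrow> (real \<Rightarrow> real^2) \<Rightarrow> (real \<Rightarrow> real^2)" where
  "BB d N b11 b12 u = (\<lambda>x. indicator (- {-d<..<d}) x *\<^sub>R u x
                            + Gamma2_dag d (Bseq N b11 b12 (Gamma2 d u)) x)"

definition AA :: "params \<Rightarrow> real \<Rightarrow> nat \<Rightarrow> (nat \<Rightarrow> nat \<Rightarrow> real) \<Rightarrow> (nat \<Rightarrow> nat \<Rightarrow> real)
                  \<Rightarrow> (real \<Rightarrow> real^2) \<Rightarrow> (real \<Rightarrow> real^2)" where
  "AA p d N b11 b12 u = LL_inv p (BB d N b11 b12 u)"


subsection \<open>The bounds\<close>

definition Y01_with :: "params \<Rightarrow> real \<Rightarrow> nat \<Rightarrow> nat \<Rightarrow> (nat \<Rightarrow> nat \<Rightarrow> real) \<Rightarrow> (nat \<Rightarrow> nat \<Rightarrow> real)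
     \<Rightarrow> (nat \<Rightarrow> real) \<Rightarrow> (nat \<Rightarrow> real^2) \<Rightarrow> (nat \<Rightarrow> real) \<Rightarrow> real" where
  "Y01_with p d N N0 b11 b12 Phi_inv U V =
     sqrt ((pair_norm2 (BN N b11 b12
              (\<lambda>n. Lseq p d U n + pair (gseq p Phi_inv U) (\<lambda>_. 0) n)))\<^sup>2
         + (pair_norm2 (\<lambda>n. Pi_le N0 (Lseq p d U) n - Pi_le N (Lseq p d U) n
              + pair (\<lambda>m. Pi_le (4 * N0) V m - Pi_le N V m) (\<lambda>_. 0) n))\<^sup>2)"

text \<open>\<open>Y01\<close> is the formula usually displayed, whose tail contains \<open>\<Psi> * \<Phi>\<^sub>i\<^sub>n\<^sub>v\<close>. It gives a valid
  bound when \<open>N0 \<le> N\<close>. For \<open>N < N0\<close> it does not: the tail of \<open>LU + (g(U), 0)\<close> then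
  contains \<open>-\<Psi> * \<Phi>\<^sub>i\<^sub>n\<^sub>v - \<lambda>\<^sub>6U\<^sub>1 - \<lambda>\<^sub>7U\<^sub>2\<close>, whose sign and linear terms matter because it is added to
  a nonzero tail of \<open>LU\<close>. \<open>Y01_tail_g\<close> uses \<open>g(U)\<close> there and is equal to \<open>Y01\<close>
  when \<open>N0 \<le> N\<close>.\<close>

definition Y01 :: "params \<Rightarrow> real \<Rightarrow> nat \<Rightarrow> nat \<Rightarrow> (nat \<Rightarrow> nat \<Rightarrow> real) \<Rightarrow> (nat \<Rightarrow> nat \<Rightarrow> real)
     \<Rightarrow> (nat \<Rightarrow> real) \<Rightarrow> (nat \<Rightarrow> real^2) \<Rightarrow> real" where
  "Y01 p d N N0 b11 b12 Phi_inv U =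
     Y01_with p d N N0 b11 b12 Phi_inv U (Psi p U \<star> Phi_inv)"

definition Y01_tail_g :: "params \<Rightarrow> real \<Rightarrow> nat \<Rightarrow> nat \<Rightarrow> (nat \<Rightarrow> nat \<Rightarrow> real)
     \<Rightarrow> (nat \<Rightarrow> nat \<Rightarrow> real) \<Rightarrow> (nat \<Rightarrow> real) \<Rightarrow> (nat \<Rightarrow> real^2) \<Rightarrow> real" where
  "Y01_tail_g p d N N0 b11 b12 Phi_inv U =
     Y01_with p d N N0 b11 b12 Phi_inv U (gseq p Phi_inv U)"

definition Y02 :: "params \<Rightarrow> nat \<Rightarrow> (nat \<Rightarrow> nat \<Rightarrow> real) \<Rightarrow> (nat \<Rightarrow> nat \<Rightarrow> real)
     \<Rightarrow> (nat \<Rightarrow> real) \<Rightarrow> (nat \<Rightarrow> real^2) \<Rightarrow> real" where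
  "Y02 p N b11 b12 Phi_inv U =
     max 1 (op_norm2 (BN N b11 b12)) * seq_norm 2 (Psi p U)
     * (seq_norm 1 (Phi_inv \<star> residual p Phi_inv U) / (1 - seq_norm 1 (residual p Phi_inv U)))"

end

theory Submission
  imports Defs
begin

text \<open>Write \<open>C(V)(\<theta>) = \<Sum>\<^sub>n \<alpha>\<^sub>n V\<^sub>n cos (n \<theta>)\<close> for a sequence \<open>V\<close> in \<open>\<ell>\<^sup>1\<close>, so that on \<open>(-d, d)\<close> the function
\<open>\<gamma>\<^sup>\<dagger>(V)\<close> is \<open>C(V)(\<pi> x / d)\<close>. The map \<open>C\<close> turns the convolution \<open>\<star>\<close> into the pointwise product
(\<open>cosine_series_conv\<close>), so the numerator and the denominator of the rational part of the
nonlinearity at \<open>u\<close> are \<open>C(\<Psi>)\<close> and \<open>C(\<Phi>)\<close>. With \<open>q\<close> the approximate inverse of \<open>\<Phi>\<close> and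
\<open>r = e\<^sub>0 - \<Phi> \<star> q\<close>, the assumption \<open>\<parallel>r\<parallel>\<^sub>1 < 1\<close> lets the Neumann series \<open>\<Sum>\<^sub>k r\<^sup>k\<close> converge in
\<open>\<ell>\<^sup>1\<close> (\<open>neumann_series\<close>). Its sum \<open>S\<close> satisfies \<open>C(S) = 1 / (1 - C(r)) = 1 / (C(\<Phi>) C(q))\<close>, hence
\<open>\<Psi> \<star> q \<star> S\<close> is an \<open>\<ell>\<^sup>1\<close> sequence whose cosine series is exactly \<open>C(\<Psi>) / C(\<Phi>)\<close>
(\<open>quotient_cosine_series\<close>).

Therefore the residual \<open>\<F>(u)\<close>, and not just an approximation of it, is \<open>\<gamma>\<^sup>\<dagger>(F)\<close> for an \<open>\<ell>\<^sup>1\<close> sequence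
\<open>F\<close> (\<open>FF_cosine_series\<close>), its Fourier coefficients are \<open>F\<close>, and the operator \<open>BB\<close> sends it
to \<open>\<gamma>\<^sup>\<dagger>(B F)\<close>. By Parseval the norm in question is \<open>sqrt (2 d) \<parallel>B F\<parallel>\<^sub>2\<close> (\<open>norm_AA_eq\<close>). Now split
\<open>F = F\<^sub>0 + E\<close>, where \<open>F\<^sub>0 = L U + (g(U), 0)\<close> is finite and \<open>E\<close> comes from replacing \<open>1 / C(\<Phi>)\<close> by \<open>C(q)\<close>.
The operator \<open>B\<close> acts separately on the indices up to \<open>N\<close> and on the rest, so \<open>\<parallel>B F\<^sub>0\<parallel>\<^sub>2\<close> is the
finite expression of the first bound (\<open>Y01_tail_g_eq\<close>) and
\<open>\<parallel>B E\<parallel>\<^sub>2 \<le> max 1 \<parallel>B\<^sup>N\<parallel> \<parallel>E\<parallel>\<^sub>2\<close> (\<open>Bseq_bounded\<close>). The only nonzero component of \<open>E\<close> has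
the cosine series \<open>- C(\<Psi>) C(q \<star> r) / (1 - C(r))\<close>, so pointwise
\<open>\<bar>C(E)\<bar> \<le> \<bar>C(\<Psi>)\<bar> \<parallel>q \<star> r\<parallel>\<^sub>1 / (1 - \<parallel>r\<parallel>\<^sub>1)\<close>, and Parseval turns this into the second bound.

Two facts about the differential operator \<open>\<L>\<close>, understood in the sense of distributions, are needed.
Its value is determined almost everywhere, because smooth bump functions approximate indicators of
intervals (\<open>weak_LL_unique\<close>). It can be inverted on bounded integrable even data
(\<open>LL_solvable\<close>): the determinant of the symbol is a quadratic polynomial in \<open>\<bar>2 \<pi> \<xi>\<bar>\<^sup>2\<close> without roots
on the half line, so with \<open>\<Delta>\<close> in place of \<open>- \<bar>2 \<pi> \<xi>\<bar>\<^sup>2\<close> it factors into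
\<open>\<nu> (\<Delta> - \<mu>\<^sub>1\<^sup>2) (\<Delta> - \<mu>\<^sub>2\<^sup>2)\<close> with \<open>Re \<mu>\<^sub>i > 0\<close>; each factor is
inverted by convolution with \<open>- exp (- \<mu> \<bar>x\<bar>) / (2 \<mu>)\<close>, and Cramer's rule does the rest.\<close>

section \<open>Smooth bump functions\<close>

text \<open>Smoothness is obtained by exhibiting a ring of functions that is closed under differentiation;
by \<open>ring_closure_smooth\<close> it is enough to differentiate the generators.\<close>

inductive_set ring_closure :: "(real \<Rightarrow> real) set \<Rightarrow> (real \<Rightarrow> real) set"
  for G :: "(real \<Rightarrow> real) set" where
  const: "(\<lambda>_. c) \<in> ring_closure G"
| gen: "g \<in> G \<Longrightarrow> g \<in> ring_closure G"
| add: "f \<in> ring_closure G \<Longrightarrow> g \<in> ring_closure G \<Longrightarrow> (\<lambda>x. f x + g x) \<in> ring_closure G"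
| mult: "f \<in> ring_closure G \<Longrightarrow> g \<in> ring_closure G \<Longrightarrow> (\<lambda>x. f x * g x) \<in> ring_closure G"

lemma ring_closure_deriv:
  assumes gen: "\<And>g. g \<in> G \<Longrightarrow> \<exists>g'\<in>ring_closure G. \<forall>x. (g has_real_derivative g' x) (at x)"
    and f: "f \<in> ring_closure G"
  shows "\<exists>f'\<in>ring_closure G. \<forall>x. (f has_real_derivative f' x) (at x)"
  using f
proof induction
  case (const c)
  show ?case
    by (rule bexI[of _ "\<lambda>_. 0"]) (auto intro: ring_closure.const)
next
  case (gen g)
  then show ?case using assms(1) by blast
next
  case (add f g)
  then obtain f' g' where "f' \<in> ring_closure G" "g' \<in> ring_closure G"
    "\<forall>x. (f has_real_derivative f' x) (at x)" "\<forall>x. (g has_real_derivative g' x) (at x)"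
    by blast
  then show ?case
    by (intro bexI[of _ "\<lambda>x. f' x + g' x"]) (auto intro!: derivative_intros ring_closure.add)
next
  case (mult f g)
  then obtain f' g' where *: "f' \<in> ring_closure G" "g' \<in> ring_closure G"
    "\<forall>x. (f has_real_derivative f' x) (at x)" "\<forall>x. (g has_real_derivative g' x) (at x)"
    by blast
  then show ?case
    by (intro bexI[of _ "\<lambda>x. f x * g' x + f' x * g x"])
       (auto intro!: DERIV_mult' ring_closure.add ring_closure.mult mult.hyps)
qed

lemma ring_closure_smooth:
  assumes gen: "\<And>g. g \<in> G \<Longrightarrow> \<exists>g'\<in>ring_closure G. \<forall>x. (g has_real_derivative g' x) (at x)"
    and f: "f \<in> ring_closure G"
  shows "(deriv ^^ k) f differentiable (at x)"
proof -
  have "(deriv ^^ k) f \<in> ring_closure G" for k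
  proof (induction k)
    case 0
    then show ?case using f by simp
  next
    case (Suc k)
    obtain f' where f': "f' \<in> ring_closure G"
      "\<forall>x. ((deriv ^^ k) f has_real_derivative f' x) (at x)"
      using ring_closure_deriv[OF gen Suc] by blast
    then have "deriv ((deriv ^^ k) f) = f'"
      by (auto intro: DERIV_imp_deriv)
    then show ?case using f' by simp
  qed
  then show ?thesis
    using ring_closure_deriv[OF gen] real_differentiable_def by blast
qed

text \<open>For \<open>q = 1\<close> this is the classical smooth function \<open>exp (-1/y)\<close> with a flat zero at the origin;
the polynomial factor makes the family closed under differentiation.\<close>

definition flat :: "real poly \<Rightarrow> real \<Rightarrow> real" where
  "flat q y = (if y > 0 then poly q (1 / y) * exp (- (1 / y)) else 0)"

lemma poly_times_exp_minus_tendsto_0: "((\<lambda>t. poly q t * exp (- t)) \<longlongrightarrow> (0::real)) at_top"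
proof -
  have "((\<lambda>t. \<Sum>i\<le>degree q. coeff q i * (t ^ i / exp t)) \<longlongrightarrow> (\<Sum>i\<le>degree q. coeff q i * 0)) at_top"
    by (intro tendsto_intros tendsto_power_div_exp_0)
  then show ?thesis
    by (simp add: poly_altdef sum_distrib_right exp_minus divide_inverse mult.assoc)
qed

lemma flat_tendsto_0: "(flat q \<longlongrightarrow> 0) (at 0)"
proof (rule filterlim_split_at)
  show "(flat q \<longlongrightarrow> 0) (at_left 0)"
    by (rule Lim_transform_eventually[OF tendsto_const])
       (auto simp: flat_def eventually_at_filter)
  have "((\<lambda>y. poly q (inverse y) * exp (- (inverse y))) \<longlongrightarrow> 0) (at_right 0)"
    by (rule filterlim_compose[OF poly_times_exp_minus_tendsto_0 filterlim_inverse_at_top_right])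
  then show "(flat q \<longlongrightarrow> 0) (at_right 0)"
    by (rule Lim_transform_eventually)
       (auto simp: flat_def eventually_at_filter inverse_eq_divide)
qed

text \<open>At the origin the difference quotient of \<open>flat q\<close> is again a function of the family, namely the
one belonging to \<open>t q(t)\<close>, so it tends to zero; this is why the three cases agree.\<close>

lemma DERIV_flat: "(flat q has_real_derivative flat ([:0, 0, 1:] * (q - pderiv q)) y) (at y)"
proof -
  consider "y > 0" | "y < 0" | "y = 0" by linarith
  then show ?thesis
  proof cases
    case 1
    have "((\<lambda>y. poly q (1 / y) * exp (- (1 / y))) has_real_derivative
             flat ([:0, 0, 1:] * (q - pderiv q)) y) (at y)"
      using 1 by (auto intro!: derivative_eq_intros poly_DERIV[THEN DERIV_chain2]
          simp: flat_def field_simps power2_eq_square)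
    moreover have "\<forall>\<^sub>F z in nhds y. flat q z = poly q (1 / z) * exp (- (1 / z))"
      using eventually_nhds_in_open[of "{0<..}" y] 1
      by (auto elim!: eventually_mono simp: flat_def)
    ultimately show ?thesis
      by (subst DERIV_cong_ev[OF refl _ refl]) auto
  next
    case 2
    have "\<forall>\<^sub>F z in nhds y. flat q z = 0"
      using eventually_nhds_in_open[of "{..<0}" y] 2
      by (auto elim!: eventually_mono simp: flat_def)
    then show ?thesis
      using 2 by (subst DERIV_cong_ev[OF refl _ refl]) (auto simp: flat_def)
  next
    case 3
    have "(flat q h - flat q 0) / (h - 0) = flat ([:0, 1:] * q) h" for h
      by (auto simp: flat_def)
    then have "((\<lambda>h. (flat q h - flat q 0) / (h - 0)) \<longlongrightarrow> 0) (at 0)"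
      using flat_tendsto_0[of "[:0, 1:] * q"] by simp
    then show ?thesis
      using 3 by (simp add: has_field_derivative_iff flat_def)
  qed
qed

lemma DERIV_shift_argument: "(\<And>x. (f has_real_derivative f' x) (at x)) \<Longrightarrow>
   ((\<lambda>x. f (x - a)) has_real_derivative f' (x - a)) (at x)" for f :: "real \<Rightarrow> real"
  using DERIV_shift[of f "f' (x - a)" x "-a"] by simp

text \<open>The product of the two flat functions is positive exactly on \<open>(a, b)\<close>, so that \<open>1 - exp (- n \<cdot>)\<close>
increases to the indicator of \<open>(a, b)\<close> as \<open>n\<close> grows.\<close>

definition bump :: "real \<Rightarrow> real \<Rightarrow> nat \<Rightarrow> real \<Rightarrow> real" where
  "bump a b n x = 1 - exp (- real n * (flat 1 (x - a) * flat 1 (b - x)))"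

text \<open>The ring generated by the translated and reflected flat functions, together with the exponential
in \<open>bump\<close>, is closed under differentiation: the derivative of the exponential is the exponential
times products of flat functions.\<close>

lemma test_fun_bump: "test_fun (bump a b n)"
proof -
  define E where "E = (\<lambda>x. exp (- real n * (flat 1 (x - a) * flat 1 (b - x))))"
  define G where "G = insert E (range (\<lambda>q x. flat q (x - a)) \<union> range (\<lambda>q x. flat q (b - x)))"
  have l: "\<exists>g'\<in>ring_closure G. \<forall>x. ((\<lambda>x. flat q (x - a)) has_real_derivative g' x) (at x)" for q
    by (intro bexI[of _ "\<lambda>x. flat ([:0, 0, 1:] * (q - pderiv q)) (x - a)"] allI
        DERIV_shift_argument DERIV_flat ring_closure.gen) (auto simp: G_def)
  have r: "\<exists>g'\<in>ring_closure G. \<forall>x. ((\<lambda>x. flat q (b - x)) has_real_derivative g' x) (at x)" for q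
  proof (intro bexI[of _ "\<lambda>x. (- 1) * flat ([:0, 0, 1:] * (q - pderiv q)) (b - x)"] allI)
    show "((\<lambda>x. flat q (b - x)) has_real_derivative
            (- 1) * flat ([:0, 0, 1:] * (q - pderiv q)) (b - x)) (at x)" for x
    proof -
      have "((\<lambda>x. b - x) has_real_derivative (- 1)) (at x)"
        by (auto intro!: derivative_eq_intros)
      from DERIV_chain2[OF DERIV_flat this, of q] show ?thesis by (simp only: mult.commute)
    qed
    show "(\<lambda>x. (- 1) * flat ([:0, 0, 1:] * (q - pderiv q)) (b - x)) \<in> ring_closure G"
      by (intro ring_closure.mult ring_closure.const ring_closure.gen) (auto simp: G_def)
  qed
  have gen: "\<exists>g'\<in>ring_closure G. \<forall>x. (g has_real_derivative g' x) (at x)" if "g \<in> G" for g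
  proof (cases "g = E")
    case False
    then show ?thesis using that l r by (auto simp: G_def)
  next
    case True
    obtain g1 where g1: "g1 \<in> ring_closure G" "\<forall>x. ((\<lambda>x. flat 1 (x - a)) has_real_derivative g1 x) (at x)"
      using l by blast
    obtain g2 where g2: "g2 \<in> ring_closure G" "\<forall>x. ((\<lambda>x. flat 1 (b - x)) has_real_derivative g2 x) (at x)"
      using r by blast
    show ?thesis
    proof (intro bexI[of _ "\<lambda>x. E x * (- real n * (flat 1 (x - a) * g2 x + g1 x * flat 1 (b - x)))"] allI)
      show "(g has_real_derivative E x * (- real n * (flat 1 (x - a) * g2 x + g1 x * flat 1 (b - x)))) (at x)" for x
        unfolding True E_def
        by (intro DERIV_fun_exp DERIV_cmult DERIV_mult' g1(2)[rule_format] g2(2)[rule_format])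
      show "(\<lambda>x. E x * (- real n * (flat 1 (x - a) * g2 x + g1 x * flat 1 (b - x)))) \<in> ring_closure G"
        by (intro ring_closure.mult ring_closure.add ring_closure.const g1 g2)
           (auto intro!: ring_closure.gen simp: G_def)
    qed
  qed
  have "(\<lambda>x. 1 + (- 1) * E x) \<in> ring_closure G"
    by (intro ring_closure.add ring_closure.mult ring_closure.const ring_closure.gen) (simp add: G_def)
  then have "bump a b n \<in> ring_closure G"
    by (simp add: bump_def[abs_def] E_def)
  then have "\<forall>k x. (deriv ^^ k) (bump a b n) differentiable (at x)"
    using ring_closure_smooth[OF gen] by blast
  moreover have "bump a b n x = 0" if "\<bar>x\<bar> > max \<bar>a\<bar> \<bar>b\<bar>" for x
  proof -
    have "x \<le> a \<or> b \<le> x" using that by linarith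
    then show ?thesis by (auto simp: bump_def flat_def)
  qed
  ultimately show ?thesis
    unfolding test_fun_def by blast
qed

lemma bump_bounds: "0 \<le> bump a b n x" "bump a b n x \<le> 1"
  by (auto simp: bump_def flat_def)

lemma bump_outside: "x \<notin> {a<..<b} \<Longrightarrow> bump a b n x = 0"
  by (auto simp: bump_def flat_def)

lemma bump_tendsto_indicator: "(\<lambda>n. bump a b n x) \<longlonglongrightarrow> indicator {a<..<b} x"
proof (cases "x \<in> {a<..<b}")
  case True
  define c where "c = flat 1 (x - a) * flat 1 (b - x)"
  have "c > 0" using True by (auto simp: c_def flat_def)
  then have "norm (exp (- c)) < 1" by simp
  then have "(\<lambda>n. exp (- c) ^ n) \<longlonglongrightarrow> 0"
    by (rule LIMSEQ_power_zero)
  then have "(\<lambda>n. 1 - exp (- c) ^ n) \<longlonglongrightarrow> 1 - 0"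
    by (intro tendsto_diff tendsto_const)
  moreover have "bump a b n x = 1 - exp (- c) ^ n" for n
    by (simp add: bump_def c_def exp_of_nat_mult[symmetric])
  ultimately show ?thesis using True by simp
next
  case False
  then show ?thesis by (simp add: bump_outside)
qed

lemma test_fun_has_deriv:
  "test_fun \<phi> \<Longrightarrow> ((deriv ^^ k) \<phi> has_real_derivative (deriv ^^ Suc k) \<phi> x) (at x)"
  using DERIV_deriv_iff_real_differentiable by (auto simp: test_fun_def)

lemma test_fun_deriv:
  assumes "test_fun \<phi>"
  shows "test_fun (deriv \<phi>)"
proof -
  obtain R where R: "\<And>x. \<bar>x\<bar> > R \<Longrightarrow> \<phi> x = 0"
    using assms by (auto simp: test_fun_def)
  have "deriv \<phi> x = 0" if "\<bar>x\<bar> > R" for x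
  proof -
    have "\<forall>\<^sub>F z in nhds x. z \<in> {z. R < \<bar>z\<bar>}"
      using that by (intro eventually_nhds_in_open open_Collect_less continuous_intros) auto
    then have "\<forall>\<^sub>F z in nhds x. \<phi> z = 0"
      by (auto elim!: eventually_mono simp: R)
    then have "(\<phi> has_real_derivative 0) (at x)"
      by (subst DERIV_cong_ev[OF refl _ refl]) auto
    then show ?thesis by (rule DERIV_imp_deriv)
  qed
  moreover have "(deriv ^^ k) (deriv \<phi>) differentiable at x" for k x
    using assms by (simp add: test_fun_def del: funpow.simps add: funpow_Suc_right[symmetric, THEN fun_cong, simplified])
  ultimately show ?thesis
    unfolding test_fun_def by blast
qed

lemma test_fun_DERIV: "test_fun \<phi> \<Longrightarrow> (\<phi> has_real_derivative deriv \<phi> x) (at x)"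
  using test_fun_has_deriv[of \<phi> 0] by simp

lemma test_fun_continuous: "test_fun \<phi> \<Longrightarrow> continuous_on S \<phi>"
  using test_fun_DERIV by (meson DERIV_continuous_on has_field_derivative_at_within)

lemma test_fun_measurable: "test_fun \<phi> \<Longrightarrow> \<phi> \<in> borel_measurable borel"
  by (intro borel_measurable_continuous_onI test_fun_continuous)

lemma test_fun_support:
  assumes "test_fun \<phi>"
  obtains R where "R > 0" "\<And>x. \<bar>x\<bar> \<ge> R \<Longrightarrow> \<phi> x = 0"
proof -
  obtain R where R: "\<And>x. \<bar>x\<bar> > R \<Longrightarrow> \<phi> x = 0"
    using assms by (auto simp: test_fun_def)
  show ?thesis
    by (rule that[of "\<bar>R\<bar> + 1"]) (use R in auto)
qed

lemma test_fun_bounded: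
  assumes "test_fun \<phi>"
  obtains M where "\<And>x. \<bar>\<phi> x\<bar> \<le> M"
proof -
  obtain R where R: "R > 0" "\<And>x. \<bar>x\<bar> \<ge> R \<Longrightarrow> \<phi> x = 0"
    using test_fun_support[OF assms] by blast
  have "compact (\<phi> ` {-R..R})"
    by (intro compact_continuous_image test_fun_continuous assms) auto
  then obtain M where M: "\<forall>y\<in>\<phi> ` {-R..R}. norm y \<le> M"
    by (meson bounded_iff compact_imp_bounded)
  show ?thesis
  proof (rule that[of "max M 0"])
    show "\<bar>\<phi> x\<bar> \<le> max M 0" for x
    proof (cases "x \<in> {-R..R}")
      case True
      then have "norm (\<phi> x) \<le> M" using M by blast
      then show ?thesis by simp
    qed (use R(2)[of x] in auto)
  qed
qed

lemma test_fun_square_integrable: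
  assumes "test_fun \<phi>"
  shows "integrable lborel (\<lambda>x. (\<phi> x)\<^sup>2)"
proof -
  obtain R where R: "R > 0" "\<And>x. \<bar>x\<bar> \<ge> R \<Longrightarrow> \<phi> x = 0"
    using test_fun_support[OF assms] by blast
  have "integrable lborel (\<lambda>x. indicator {-R..R} x *\<^sub>R (\<phi> x)\<^sup>2)"
    by (intro borel_integrable_compact continuous_intros test_fun_continuous assms) auto
  moreover have "(\<lambda>x. indicator {-R..R} x *\<^sub>R (\<phi> x)\<^sup>2) = (\<lambda>x. (\<phi> x)\<^sup>2)"
  proof
    show "indicator {-R..R} x *\<^sub>R (\<phi> x)\<^sup>2 = (\<phi> x)\<^sup>2" for x
      using R(2)[of x] by (cases "x \<in> {-R..R}") auto
  qed
  ultimately show ?thesis by (simp only:)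
qed

lemma test_fun_integrable:
  assumes "test_fun \<phi>"
  shows "integrable lborel \<phi>"
proof -
  obtain R where R: "R > 0" "\<And>x. \<bar>x\<bar> \<ge> R \<Longrightarrow> \<phi> x = 0"
    using test_fun_support[OF assms] by blast
  have "integrable lborel (\<lambda>x. indicator {-R..R} x *\<^sub>R \<phi> x)"
    by (intro borel_integrable_compact continuous_intros test_fun_continuous assms) auto
  moreover have "(\<lambda>x. indicator {-R..R} x *\<^sub>R \<phi> x) = \<phi>"
  proof
    show "indicator {-R..R} x *\<^sub>R \<phi> x = \<phi> x" for x
      using R(2)[of x] by (cases "x \<in> {-R..R}") auto
  qed
  ultimately show ?thesis by (simp only:)
qed

section \<open>The weak image is unique\<close>

lemma L2_comp_square_integrable:
  assumes "u \<in> L2"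
  shows "(\<lambda>x. u x $ i) \<in> borel_measurable lborel" "integrable lborel (\<lambda>x. (u x $ i)\<^sup>2)"
proof -
  have [measurable]: "u \<in> borel_measurable borel" using assms by (auto simp: L2_def)
  have "(\<lambda>v::real^2. v $ i) \<in> borel_measurable borel"
    by (intro borel_measurable_continuous_onI continuous_intros)
  from measurable_compose[OF \<open>u \<in> borel_measurable borel\<close> this]
  show "(\<lambda>x. u x $ i) \<in> borel_measurable lborel" by simp
  then have m: "(\<lambda>x. (u x $ i)\<^sup>2) \<in> borel_measurable lborel"
    by (rule borel_measurable_power)
  have "(u x $ i)\<^sup>2 \<le> (norm (u x))\<^sup>2" for x
    using power_mono[OF component_le_norm_cart[of "u x" i], of 2] by simp
  then show "integrable lborel (\<lambda>x. (u x $ i)\<^sup>2)"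
    using assms by (intro Bochner_Integration.integrable_bound[OF _ m, of "\<lambda>x. (norm (u x))\<^sup>2"])
       (simp_all add: L2_def)
qed

lemma square_integrable_mult:
  fixes f g :: "real \<Rightarrow> real"
  assumes "f \<in> borel_measurable lborel" "g \<in> borel_measurable lborel"
    "integrable lborel (\<lambda>x. (f x)\<^sup>2)" "integrable lborel (\<lambda>x. (g x)\<^sup>2)"
  shows "integrable lborel (\<lambda>x. f x * g x)"
proof (rule Bochner_Integration.integrable_bound)
  show "integrable lborel (\<lambda>x. (f x)\<^sup>2 + (g x)\<^sup>2)"
    using assms by auto
  show "AE x in lborel. norm (f x * g x) \<le> norm ((f x)\<^sup>2 + (g x)\<^sup>2)"
  proof (rule AE_I2)
    fix x
    have "2 * (\<bar>f x\<bar> * \<bar>g x\<bar>) \<le> (f x)\<^sup>2 + (g x)\<^sup>2"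
      using sum_squares_bound[of "\<bar>f x\<bar>" "\<bar>g x\<bar>"] by simp
    moreover have "0 \<le> \<bar>f x\<bar> * \<bar>g x\<bar>" by simp
    ultimately have "\<bar>f x\<bar> * \<bar>g x\<bar> \<le> (f x)\<^sup>2 + (g x)\<^sup>2" by linarith
    then show "norm (f x * g x) \<le> norm ((f x)\<^sup>2 + (g x)\<^sup>2)"
      by (simp add: abs_mult)
  qed
qed (rule borel_measurable_times[OF assms(1,2)])

lemma L2_times_test_fun:
  assumes "u \<in> L2" "test_fun \<phi>"
  shows "integrable lborel (\<lambda>x. u x $ i * \<phi> x)"
  using test_fun_measurable[OF assms(2)]
  by (intro square_integrable_mult[OF L2_comp_square_integrable(1)[OF assms(1)] _
      L2_comp_square_integrable(2)[OF assms(1)] test_fun_square_integrable[OF assms(2)]]) simp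

lemma sets_borel_eq_sigma_Ioo:
  "sets borel = sigma_sets UNIV (range (\<lambda>(a, b). {a <..< b::real}))"
proof -
  have "borel = sigma UNIV (range (\<lambda>(a, b). {a <..< b::real}))"
    using borel_eq_box[where 'a=real] by (simp only: box_real)
  then show ?thesis by (metis sets_measure_of subset_UNIV Pow_UNIV)
qed

text \<open>The sets on which a function has integral zero form a Dynkin system, and the open intervals are
an intersection-stable generator of the Borel sets. Since \<open>f\<close> is only locally integrable, the
argument is applied to its restrictions to \<open>(-n, n)\<close>.\<close>

lemma integral_intervals_zero_imp_AE_zero:
  fixes f :: "real \<Rightarrow> real"
  assumes int: "\<And>a b. integrable lborel (\<lambda>x. indicator {a<..<b} x * f x)"
    and zero: "\<And>a b. (LINT x|lborel. indicator {a<..<b} x * f x) = 0"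
  shows "AE x in lborel. f x = 0"
proof -
  have "AE x in lborel. indicator {- real n<..<real n} x * f x = 0" for n
  proof (rule sigma_finite_measure.density_zero[OF lborel.sigma_finite_measure_axioms])
    let ?g = "\<lambda>x. indicator {- real n<..<real n} x * f x"
    show g: "integrable lborel ?g" by (rule int)
    have sg: "set_integrable lborel A ?g" if "A \<in> sets borel" for A
      unfolding set_integrable_def using that g by (intro integrable_mult_indicator) auto
    have box: "(LINT x:{a<..<b}|lborel. ?g x) = 0" for a b
    proof -
      have "indicator {a<..<b} x *\<^sub>R ?g x = indicator {max a (- real n)<..<min b (real n)} x * f x" for x
        by (auto simp: indicator_def)
      then show ?thesis
        unfolding set_lebesgue_integral_def
        using zero[of "max a (- real n)" "min b (real n)"] by (simp only:)
    qed
    show "(LINT x:A|lborel. ?g x) = 0" if "A \<in> sets lborel" for A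
    proof -
      have A: "A \<in> sigma_sets UNIV (range (\<lambda>(a, b). {a <..< b::real}))"
        using that by (simp add: sets_borel_eq_sigma_Ioo[symmetric])
      show ?thesis
      proof (rule sigma_sets_induct_disjoint[OF _ _ A])
        show "Int_stable (range (\<lambda>(a, b). {a <..< b::real}))"
          by (auto simp: Int_stable_def Int_greaterThanLessThan)
        show "range (\<lambda>(a, b). {a <..< b::real}) \<subseteq> Pow UNIV" by simp
        show "(LINT x:X|lborel. ?g x) = 0" if "X \<in> range (\<lambda>(a, b). {a <..< b})" for X
          using that box by auto
        show "(LINT x:{}|lborel. ?g x) = 0" by (simp add: set_lebesgue_integral_def)
        show "(LINT x:UNIV - X|lborel. ?g x) = 0"
          if X: "X \<in> sigma_sets UNIV (range (\<lambda>(a, b). {a <..< b}))" "(LINT x:X|lborel. ?g x) = 0" for X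
        proof -
          have Xb: "X \<in> sets borel" using X(1) by (simp add: sets_borel_eq_sigma_Ioo)
          have "(LINT x:X \<union> (UNIV - X)|lborel. ?g x) = (LINT x:X|lborel. ?g x) + (LINT x:UNIV - X|lborel. ?g x)"
            using Xb by (intro set_integral_Un sg) auto
          moreover have "(LINT x:UNIV|lborel. ?g x) = 0"
            using zero by (simp add: set_lebesgue_integral_def)
          ultimately show ?thesis using X(2) by simp
        qed
        show "(LINT x:\<Union>(range X)|lborel. ?g x) = 0"
          if X: "disjoint_family X" "range X \<subseteq> sigma_sets UNIV (range (\<lambda>(a, b). {a <..< b}))"
            "\<And>i. (LINT x:X i|lborel. ?g x) = 0" for X :: "nat \<Rightarrow> real set"
        proof -
          have Xb: "X i \<in> sets borel" for i
            using X(2) by (auto simp: sets_borel_eq_sigma_Ioo)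
          have "(LINT x:\<Union>(range X)|lborel. ?g x) = (\<Sum>i. LINT x:X i|lborel. ?g x)"
            using Xb X(1) by (intro lebesgue_integral_countable_add sg)
              (auto simp: disjoint_family_on_def)
          then show ?thesis using X(3) by simp
        qed
      qed
    qed
  qed
  then have "AE x in lborel. \<forall>n. indicator {- real n<..<real n} x * f x = 0"
    unfolding AE_all_countable by blast
  then show ?thesis
  proof eventually_elim
    case (elim x)
    obtain n where "\<bar>x\<bar> < real n" using reals_Archimedean2 by blast
    then show ?case using elim[rule_format, of n] by (auto simp: indicator_def split: if_splits)
  qed
qed

text \<open>Dominated convergence passes from bump functions to the indicator of an interval; the product of
\<open>\<bar>f\<bar>\<close> and that indicator is the integrable majorant.\<close>

lemma fundamental_lemma_variations:
  fixes f :: "real \<Rightarrow> real"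
  assumes m: "f \<in> borel_measurable lborel" and sq: "integrable lborel (\<lambda>x. (f x)\<^sup>2)"
    and zero: "\<And>\<phi>. test_fun \<phi> \<Longrightarrow> (LINT x|lborel. f x * \<phi> x) = 0"
  shows "AE x in lborel. f x = 0"
proof (rule integral_intervals_zero_imp_AE_zero)
  fix a b :: real
  have [measurable]: "f \<in> borel_measurable borel" using m by simp
  show int: "integrable lborel (\<lambda>x. indicator {a<..<b} x * f x)"
  proof (rule square_integrable_mult[OF _ m _ sq])
    have "(\<lambda>x. (indicator {a<..<b} x :: real)\<^sup>2) = indicator {a<..<b}"
      by (auto simp: indicator_def)
    moreover have "emeasure lborel {a<..<b} < \<infinity>"
      using emeasure_lborel_box_finite[of a b] by (simp add: box_real)
    ultimately show "integrable lborel (\<lambda>x. (indicator {a<..<b} x :: real)\<^sup>2)"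
      by (simp only:) (intro integrable_real_indicator, auto)
  qed simp
  have "(\<lambda>n. LINT x|lborel. bump a b n x * f x) \<longlonglongrightarrow> (LINT x|lborel. indicator {a<..<b} x * f x)"
  proof (rule integral_dominated_convergence[where w = "\<lambda>x. norm (indicator {a<..<b} x * f x)"])
    show "integrable lborel (\<lambda>x. norm (indicator {a<..<b} x * f x))" using int by simp
    show "AE x in lborel. (\<lambda>n. bump a b n x * f x) \<longlonglongrightarrow> indicator {a<..<b} x * f x"
      by (intro AE_I2 tendsto_intros bump_tendsto_indicator)
    show "AE x in lborel. norm (bump a b n x * f x) \<le> norm (indicator {a<..<b} x * f x)" for n
    proof (rule AE_I2)
      fix x
      show "norm (bump a b n x * f x) \<le> norm (indicator {a<..<b} x * f x)"
        using bump_bounds[of a b n x] bump_outside[of x a b n]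
        by (cases "x \<in> {a<..<b}") (auto simp: abs_mult mult_left_le_one_le)
    qed
    show "(\<lambda>x. bump a b n x * f x) \<in> borel_measurable lborel" for n
      using test_fun_measurable[OF test_fun_bump] by measurable
  qed (use int in auto)
  moreover have "(LINT x|lborel. bump a b n x * f x) = 0" for n
    using zero[OF test_fun_bump[of a b n]] by (simp add: mult.commute)
  ultimately show "(LINT x|lborel. indicator {a<..<b} x * f x) = 0"
    by (simp add: LIMSEQ_const_iff)
qed

lemma weak_LL_unique:
  assumes "weak_LL p u w" "weak_LL p u w'" "w \<in> L2" "w' \<in> L2"
  shows "AE x in lborel. w x = w' x"
proof -
  have *: "AE x in lborel. w x $ i - w' x $ i = 0" for i :: 2
  proof (rule fundamental_lemma_variations)
    note c = L2_comp_square_integrable[OF assms(3), of i] L2_comp_square_integrable[OF assms(4), of i]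
    show "(\<lambda>x. w x $ i - w' x $ i) \<in> borel_measurable lborel"
      using c by auto
    have "integrable lborel (\<lambda>x. w x $ i * w' x $ i)"
      by (rule square_integrable_mult[OF c(1,3) c(2,4)])
    then show "integrable lborel (\<lambda>x. (w x $ i - w' x $ i)\<^sup>2)"
      using c by (simp add: power2_diff mult.assoc)
    fix \<phi> assume t: "test_fun \<phi>"
    have "(LINT x|lborel. w x $ i * \<phi> x) = (LINT x|lborel. w' x $ i * \<phi> x)"
      using assms(1,2) t exhaust_2[of i] unfolding weak_LL_def by auto
    then show "(LINT x|lborel. (w x $ i - w' x $ i) * \<phi> x) = 0"
      using L2_times_test_fun[OF assms(3) t, of i] L2_times_test_fun[OF assms(4) t, of i]
      by (simp add: left_diff_distrib)
  qed
  have "AE x in lborel. w x $ 1 = w' x $ 1 \<and> w x $ 2 = w' x $ 2"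
    using *[of 1] *[of 2] by eventually_elim auto
  then show ?thesis
    by eventually_elim (simp add: vec_eq_iff forall_2)
qed

text \<open>This evaluates the operator \<open>LL\<close>, which is defined by a choice: any weak image is the value,
up to a null set.\<close>

lemma LL_eqI:
  assumes "weak_LL p u w" "w \<in> L2"
  shows "AE x in lborel. LL p u x = w x" "LL p u \<in> L2"
proof -
  have "LL p u \<in> L2 \<and> weak_LL p u (LL p u)"
    unfolding LL_def using someI[of "\<lambda>w. w \<in> L2 \<and> weak_LL p u w" w] assms by blast
  then show "AE x in lborel. LL p u x = w x" "LL p u \<in> L2"
    using weak_LL_unique assms by blast+
qed

section \<open>Resolvents of the second derivative\<close>

text \<open>A class that lies inside \<open>L\<^sup>2\<close> and is preserved by convolution with an integrable kernel, for
elementary reasons: Tonelli for the integral, the trivial estimate for the supremum.\<close>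

definition bounded_integrable :: "(real \<Rightarrow> complex) \<Rightarrow> bool" where
  "bounded_integrable f \<longleftrightarrow> integrable lborel f \<and> (\<exists>M. \<forall>x. norm (f x) \<le> M)"

text \<open>The fundamental solution of \<open>k'' - \<mu>\<^sup>2 k = \<delta>\<close> that decays at infinity, for \<open>Re \<mu> > 0\<close>. Complex
\<open>\<mu>\<close> are needed because the factors of the determinant of the symbol may be complex conjugate.\<close>

definition resolvent_kernel :: "complex \<Rightarrow> real \<Rightarrow> complex" where
  "resolvent_kernel \<mu> y = - exp (- (\<mu> * of_real \<bar>y\<bar>)) / (2 * \<mu>)"

definition resolvent :: "complex \<Rightarrow> (real \<Rightarrow> complex) \<Rightarrow> real \<Rightarrow> complex" where
  "resolvent \<mu> f x = (LINT t|lborel. resolvent_kernel \<mu> (x - t) * f t)"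

lemma integrable_exp_minus_abs:
  fixes c :: real
  assumes "c > 0"
  shows "integrable lborel (\<lambda>y. exp (- (c * \<bar>y\<bar>)))"
proof -
  let ?h = "\<lambda>y. indicator {0..} y * exp (- (c * y))"
  have lim: "((\<lambda>y. - exp (- (c * y)) / c) \<longlongrightarrow> 0) at_top"
    using assms by real_asymp
  have "(\<integral>\<^sup>+y. ennreal (exp (- (c * y))) * indicator {0..} y \<partial>lborel) = 0 - (- exp (- (c * 0)) / c)"
    using assms by (intro nn_integral_FTC_atLeast[OF _ _ _ lim])
      (auto intro!: derivative_eq_intros)
  moreover have "ennreal (exp (- (c * y))) * indicator {0..} y = ennreal (norm (?h y))" for y
    by (auto simp: indicator_def)
  ultimately have h: "integrable lborel ?h"
    by (intro integrableI_bounded) auto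
  then have h': "integrable lborel (\<lambda>y. ?h (0 + (- 1) * y))"
    by (rule lborel_integrable_real_affine) simp
  show ?thesis
  proof (rule Bochner_Integration.integrable_bound[OF Bochner_Integration.integrable_add[OF h h']])
    show "AE y in lborel. norm (exp (- (c * \<bar>y\<bar>))) \<le> norm (?h y + ?h (0 + (- 1) * y))"
      by (rule AE_I2) (auto simp: indicator_def abs_if)
  qed simp
qed

lemma measurable_resolvent_kernel [measurable]: "resolvent_kernel \<mu> \<in> borel_measurable borel"
  unfolding resolvent_kernel_def by measurable

lemma integrable_resolvent_kernel:
  assumes "Re \<mu> > 0"
  shows "integrable lborel (resolvent_kernel \<mu>)"
proof (rule Bochner_Integration.integrable_bound)
  show "integrable lborel (\<lambda>y. exp (- (Re \<mu> * \<bar>y\<bar>)) * (1 / (2 * norm \<mu>)))"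
    by (intro integrable_mult_left integrable_exp_minus_abs assms)
  show "AE y in lborel. norm (resolvent_kernel \<mu> y) \<le> norm (exp (- (Re \<mu> * \<bar>y\<bar>)) * (1 / (2 * norm \<mu>)))"
    by (rule AE_I2) (simp add: resolvent_kernel_def norm_divide norm_mult)
qed simp

lemma resolvent_kernel_minus: "resolvent_kernel \<mu> (- y) = resolvent_kernel \<mu> y"
  by (simp add: resolvent_kernel_def)

lemma integrable_shift_reflect:
  fixes k :: "real \<Rightarrow> complex"
  assumes "integrable lborel k"
  shows "integrable lborel (\<lambda>t. k (x - t))" "(LINT t|lborel. k (x - t)) = integral\<^sup>L lborel k"
  using lborel_integrable_real_affine[OF assms, of "- 1" x]
    lborel_integral_real_affine[of "- 1" k x] by simp_all

lemma integrable_shift: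
  fixes k :: "real \<Rightarrow> complex"
  assumes "integrable lborel k"
  shows "integrable lborel (\<lambda>x. k (x - t))" "(LINT x|lborel. k (x - t)) = integral\<^sup>L lborel k"
  using lborel_integrable_real_affine[OF assms, of 1 "- t"]
    lborel_integral_real_affine[of 1 k "- t"] by simp_all

lemma integrable_convolution_kernel:
  fixes k f :: "real \<Rightarrow> complex"
  assumes k: "integrable lborel k" and f: "integrable lborel f"
  shows "integrable (lborel \<Otimes>\<^sub>M lborel) (\<lambda>(x, t). k (x - t) * f t)"
proof -
  have [measurable]: "k \<in> borel_measurable borel" "f \<in> borel_measurable borel"
    using k f by auto
  have "integrable (lborel \<Otimes>\<^sub>M lborel) (\<lambda>(t, x). k (x - t) * f t)"
  proof (rule lborel_pair.Fubini_integrable)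
    have "(LINT x|lborel. norm (k (x - t) * f t)) = (LINT x|lborel. norm (k x)) * norm (f t)" for t
    proof -
      have "integrable lborel (\<lambda>x. complex_of_real (norm (k x)))" using k by simp
      from integrable_shift(2)[OF this, of t] show ?thesis
        by (simp add: norm_mult)
    qed
    then show "integrable lborel (\<lambda>t. LINT x|lborel. norm (case (t, x) of (t, x) \<Rightarrow> k (x - t) * f t))"
      using f by simp
    show "AE t in lborel. integrable lborel (\<lambda>x. case (t, x) of (t, x) \<Rightarrow> k (x - t) * f t)"
      using integrable_shift(1)[OF k] by simp
  qed measurable
  from lborel_pair.integrable_product_swap[OF this] show ?thesis
    by (simp add: case_prod_unfold)
qed

lemma bounded_integrable_measurable: "bounded_integrable f \<Longrightarrow> f \<in> borel_measurable borel"
  by (auto simp: bounded_integrable_def)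

lemma bounded_integrable_resolvent:
  assumes "Re \<mu> > 0" "bounded_integrable f"
  shows "bounded_integrable (resolvent \<mu> f)"
proof -
  note k = integrable_resolvent_kernel[OF assms(1)]
  have f: "integrable lborel f" using assms(2) by (simp add: bounded_integrable_def)
  obtain M where M: "\<And>x. norm (f x) \<le> M" using assms(2) by (auto simp: bounded_integrable_def)
  have "integrable lborel (\<lambda>x. LINT t|lborel. (case (x, t) of (x, t) \<Rightarrow> resolvent_kernel \<mu> (x - t) * f t))"
    by (rule lborel_pair.integrable_fst'[OF integrable_convolution_kernel[OF k f]])
  then have "integrable lborel (resolvent \<mu> f)"
    by (simp add: resolvent_def[abs_def])
  moreover have "norm (resolvent \<mu> f x) \<le> (LINT t|lborel. norm (resolvent_kernel \<mu> t) * M)" for x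
  proof -
    note i = integrable_shift_reflect(1)[OF k, of x]
    have n: "integrable lborel (\<lambda>t. complex_of_real (norm (resolvent_kernel \<mu> t)))" using k by simp
    have le: "norm (resolvent_kernel \<mu> (x - t) * f t) \<le> norm (resolvent_kernel \<mu> (x - t)) * M" for t
      using M by (auto simp: norm_mult intro: mult_left_mono)
    have "norm (resolvent \<mu> f x) \<le> (LINT t|lborel. norm (resolvent_kernel \<mu> (x - t) * f t))"
      unfolding resolvent_def by (rule integral_norm_bound)
    also have "\<dots> \<le> (LINT t|lborel. norm (resolvent_kernel \<mu> (x - t)) * M)"
    proof (rule integral_mono[OF integrable_norm _ le])
      show iM: "integrable lborel (\<lambda>t. norm (resolvent_kernel \<mu> (x - t)) * M)" using i by simp
      show "integrable lborel (\<lambda>t. resolvent_kernel \<mu> (x - t) * f t)"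
        by (rule Bochner_Integration.integrable_bound[OF iM])
           (use f le in \<open>auto intro!: AE_I2 order_trans[OF le abs_ge_self]\<close>)
    qed
    also have "\<dots> = (LINT t|lborel. norm (resolvent_kernel \<mu> t) * M)"
      using integrable_shift_reflect(2)[OF n, of x] by simp
    finally show ?thesis .
  qed
  ultimately show ?thesis unfolding bounded_integrable_def by blast
qed

lemma bounded_integrable_times_test_fun:
  assumes "bounded_integrable f" "test_fun \<phi>"
  shows "integrable lborel (\<lambda>x. f x * of_real (\<phi> x))"
proof -
  obtain M where M: "\<And>x. norm (f x) \<le> M" using assms(1) by (auto simp: bounded_integrable_def)
  have [measurable]: "f \<in> borel_measurable borel" "\<phi> \<in> borel_measurable borel"
    using assms bounded_integrable_measurable test_fun_measurable by auto
  show ?thesis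
  proof (rule Bochner_Integration.integrable_bound)
    show "integrable lborel (\<lambda>x. M * \<phi> x)"
      using test_fun_integrable[OF assms(2)] by simp
    show "AE x in lborel. norm (f x * of_real (\<phi> x)) \<le> norm (M * \<phi> x)"
      using M by (intro AE_I2) (auto simp: norm_mult abs_mult intro!: mult_right_mono order_trans[OF M abs_ge_self])
  qed measurable
qed

text \<open>Fubini; the resolvent is its own transpose because the kernel is even.\<close>

lemma resolvent_adjoint:
  assumes "Re \<mu> > 0" "bounded_integrable f" "\<psi> \<in> borel_measurable borel" "\<And>x. norm (\<psi> x) \<le> C"
  shows "(LINT x|lborel. resolvent \<mu> f x * \<psi> x) = (LINT t|lborel. f t * resolvent \<mu> \<psi> t)"
proof -
  have [measurable]: "f \<in> borel_measurable borel" "\<psi> \<in> borel_measurable borel"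
    using assms bounded_integrable_measurable by auto
  note k = integrable_resolvent_kernel[OF assms(1)]
  have f: "integrable lborel f" using assms(2) by (simp add: bounded_integrable_def)
  have "integrable (lborel \<Otimes>\<^sub>M lborel) (\<lambda>(x, t). resolvent_kernel \<mu> (x - t) * f t * \<psi> x)"
  proof (rule Bochner_Integration.integrable_bound)
    show "integrable (lborel \<Otimes>\<^sub>M lborel) (\<lambda>z. C * norm ((\<lambda>(x, t). resolvent_kernel \<mu> (x - t) * f t) z))"
      by (intro integrable_mult_right integrable_norm integrable_convolution_kernel[OF k f])
    show "AE z in lborel \<Otimes>\<^sub>M lborel. norm (case z of (x, t) \<Rightarrow> resolvent_kernel \<mu> (x - t) * f t * \<psi> x)
      \<le> norm (C * norm ((\<lambda>(x, t). resolvent_kernel \<mu> (x - t) * f t) z))"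
    proof (intro AE_I2)
      fix z :: "real \<times> real"
      obtain x t where z: "z = (x, t)" by force
      have "norm (\<psi> x) \<le> \<bar>C\<bar>" using assms(4)[of x] by linarith
      from mult_left_mono[OF this, of "norm (resolvent_kernel \<mu> (x - t)) * norm (f t)"]
      show "norm (case z of (x, t) \<Rightarrow> resolvent_kernel \<mu> (x - t) * f t * \<psi> x)
        \<le> norm (C * norm ((\<lambda>(x, t). resolvent_kernel \<mu> (x - t) * f t) z))"
        by (simp add: z norm_mult abs_mult mult_ac)
    qed
  qed measurable
  from lborel_pair.Fubini_integral[OF this]
  have "(LINT t|lborel. LINT x|lborel. resolvent_kernel \<mu> (x - t) * f t * \<psi> x)
      = (LINT x|lborel. LINT t|lborel. resolvent_kernel \<mu> (x - t) * f t * \<psi> x)"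
    by simp
  moreover have "(LINT t|lborel. resolvent_kernel \<mu> (x - t) * f t * \<psi> x) = resolvent \<mu> f x * \<psi> x" for x
    by (simp add: resolvent_def)
  moreover have "(LINT x|lborel. resolvent_kernel \<mu> (x - t) * f t * \<psi> x) = f t * resolvent \<mu> \<psi> t" for t
  proof -
    have "(\<lambda>x. resolvent_kernel \<mu> (x - t) * f t * \<psi> x) = (\<lambda>x. f t * (resolvent_kernel \<mu> (t - x) * \<psi> x))"
      using resolvent_kernel_minus[of \<mu> "t - _"] by (simp add: mult_ac)
    then show ?thesis
      unfolding resolvent_def by (simp only: integral_mult_right_zero)
  qed
  ultimately show ?thesis by (simp only:)
qed

text \<open>The integrand has an explicit antiderivative on either side of \<open>x\<close>: differentiating
\<open>exp (-\<mu> (t - x)) (\<phi>'(t) + \<mu> \<phi>(t))\<close> produces \<open>exp (-\<mu> (t - x)) (\<phi>''(t) - \<mu>\<^sup>2 \<phi>(t))\<close>, and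
similarly with \<open>- \<mu>\<close> on the left. Compact support leaves only the boundary terms at \<open>x\<close>, in
which \<open>\<phi>'(x)\<close> cancels.\<close>

lemma resolvent_test_fun:
  assumes mu: "Re \<mu> > 0" and t: "test_fun \<phi>"
  shows "resolvent \<mu> (\<lambda>x. of_real (deriv (deriv \<phi>) x) - \<mu>\<^sup>2 * of_real (\<phi> x)) x = of_real (\<phi> x)"
proof -
  have mu0: "\<mu> \<noteq> 0" using mu by auto
  let ?g = "\<lambda>x. of_real (deriv (deriv \<phi>) x) - \<mu>\<^sup>2 * of_real (\<phi> x)"
  obtain R0 where R0: "R0 > 0" "\<And>x. \<bar>x\<bar> \<ge> R0 \<Longrightarrow> \<phi> x = 0" using test_fun_support[OF t] by blast
  obtain R1 where R1: "R1 > 0" "\<And>x. \<bar>x\<bar> \<ge> R1 \<Longrightarrow> deriv \<phi> x = 0"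
    using test_fun_support[OF test_fun_deriv[OF t]] by blast
  obtain R2 where R2: "R2 > 0" "\<And>x. \<bar>x\<bar> \<ge> R2 \<Longrightarrow> deriv (deriv \<phi>) x = 0"
    using test_fun_support[OF test_fun_deriv[OF test_fun_deriv[OF t]]] by blast
  \<comment> \<open>an interval that contains the point and all supports\<close>
  define R where "R = Max {R0, R1, R2, \<bar>x\<bar>}"
  have R: "R \<ge> R0" "R \<ge> R1" "R \<ge> R2" "R \<ge> \<bar>x\<bar>" by (auto simp: R_def)
  have xR: "- R \<le> x" "x \<le> R" using R(4) by auto
  have z: "\<phi> (- R) = 0" "\<phi> R = 0" "deriv \<phi> (- R) = 0" "deriv \<phi> R = 0"
    using R R0 R1 by auto
  have d0: "((\<lambda>t. complex_of_real (\<phi> t)) has_vector_derivative of_real (deriv \<phi> t)) (at t within S)" for t S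
    using test_fun_DERIV[OF t] by (intro has_vector_derivative_of_real)
      (simp add: has_field_derivative_at_within flip: has_real_derivative_iff_has_vector_derivative)
  have d1: "((\<lambda>t. complex_of_real (deriv \<phi> t)) has_vector_derivative of_real (deriv (deriv \<phi>) t)) (at t within S)" for t S
    using test_fun_DERIV[OF test_fun_deriv[OF t]] by (intro has_vector_derivative_of_real)
      (simp add: has_field_derivative_at_within flip: has_real_derivative_iff_has_vector_derivative)
  have e: "((\<lambda>t. exp (c * of_real (t - x))) has_vector_derivative c * exp (c * of_real (t - x))) (at t within S)" for c :: complex and t S
  proof -
    have "((\<lambda>z. exp (c * (z - of_real x))) has_field_derivative c * exp (c * (of_real t - of_real x))) (at (of_real t))"
      by (auto intro!: derivative_eq_intros)
    from has_vector_derivative_real_field[OF this] show ?thesis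
      by (simp add: has_vector_derivative_at_within)
  qed
  have cont: "continuous_on S ?g" for S
    by (intro continuous_intros test_fun_continuous t test_fun_deriv)
  define Fr where "Fr = (\<lambda>t. exp (- \<mu> * of_real (t - x)) * (of_real (deriv \<phi> t) + \<mu> * of_real (\<phi> t)))"
  define Fl where "Fl = (\<lambda>t. exp (\<mu> * of_real (t - x)) * (of_real (deriv \<phi> t) - \<mu> * of_real (\<phi> t)))"
  have dFr: "(Fr has_vector_derivative exp (- \<mu> * of_real (t - x)) * ?g t) (at t within S)" for t S
    unfolding Fr_def
    by (rule has_vector_derivative_eq_rhs[OF has_vector_derivative_mult[OF e
          has_vector_derivative_add[OF d1 has_vector_derivative_mult_right[OF d0]]]])
       (simp add: algebra_simps power2_eq_square)
  have dFl: "(Fl has_vector_derivative exp (\<mu> * of_real (t - x)) * ?g t) (at t within S)" for t S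
    unfolding Fl_def
    by (rule has_vector_derivative_eq_rhs[OF has_vector_derivative_mult[OF e
          has_vector_derivative_diff[OF d1 has_vector_derivative_mult_right[OF d0]]]])
       (simp add: algebra_simps power2_eq_square)
  have r: "(LINT t|lborel. indicator {x..R} t *\<^sub>R (exp (- \<mu> * of_real (t - x)) * ?g t)) = Fr R - Fr x"
    by (intro integral_FTC_atLeastAtMost[OF xR(2) dFr] continuous_intros cont test_fun_continuous t test_fun_deriv)
  have l: "(LINT t|lborel. indicator {-R..x} t *\<^sub>R (exp (\<mu> * of_real (t - x)) * ?g t)) = Fl x - Fl (-R)"
    by (intro integral_FTC_atLeastAtMost[OF xR(1) dFl] continuous_intros cont test_fun_continuous t test_fun_deriv)
  have "AE t in lborel. t \<noteq> x"
    by (rule AE_lborel_singleton)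
  then have "AE t in lborel. resolvent_kernel \<mu> (x - t) * ?g t =
     (- 1 / (2 * \<mu>)) * (indicator {x..R} t *\<^sub>R (exp (- \<mu> * of_real (t - x)) * ?g t)
       + indicator {-R..x} t *\<^sub>R (exp (\<mu> * of_real (t - x)) * ?g t))"
  proof eventually_elim
    case (elim t)
    show ?case
    proof (cases "\<bar>t\<bar> \<le> R")
      case True
      then show ?thesis
        using elim mu0 by (cases "t < x") (auto simp: resolvent_kernel_def indicator_def field_simps)
    next
      case False
      then have "\<bar>t\<bar> \<ge> R0" "\<bar>t\<bar> \<ge> R2" using R by auto
      then have "?g t = 0" using R0 R2 by simp
      then show ?thesis by simp
    qed
  qed
  then have "resolvent \<mu> ?g x = (LINT t|lborel. (- 1 / (2 * \<mu>)) * (indicator {x..R} t *\<^sub>R (exp (- \<mu> * of_real (t - x)) * ?g t)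
       + indicator {-R..x} t *\<^sub>R (exp (\<mu> * of_real (t - x)) * ?g t)))"
  proof -
    have [measurable]: "?g \<in> borel_measurable borel"
      using cont by (rule borel_measurable_continuous_onI)
    show ?thesis
      unfolding resolvent_def using \<open>AE t in lborel. resolvent_kernel _ _ * _ = _\<close>
      by (intro integral_cong_AE) (measurable)
  qed
  also have "\<dots> = (- 1 / (2 * \<mu>)) * ((Fr R - Fr x) + (Fl x - Fl (- R)))"
  proof -
    have "integrable lborel (\<lambda>t. indicator {x..R} t *\<^sub>R (exp (- \<mu> * of_real (t - x)) * ?g t))"
      "integrable lborel (\<lambda>t. indicator {-R..x} t *\<^sub>R (exp (\<mu> * of_real (t - x)) * ?g t))"
      by (intro borel_integrable_compact continuous_intros cont test_fun_continuous t test_fun_deriv; simp)+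
    then show ?thesis by (simp add: l[symmetric] r[symmetric] del: of_real_diff)
  qed
  also have "\<dots> = of_real (\<phi> x)"
    using mu0 by (simp add: Fr_def Fl_def z field_simps)
  finally show ?thesis .
qed

text \<open>The resolvent solves \<open>v'' - \<mu>\<^sup>2 v = f\<close> in the sense of distributions: move it to the test
function, where it undoes the differential operator.\<close>

lemma resolvent_weak:
  assumes mu: "Re \<mu> > 0" and f: "bounded_integrable f" and t: "test_fun \<phi>"
  shows "(LINT x|lborel. resolvent \<mu> f x * of_real (deriv (deriv \<phi>) x)) =
    (LINT x|lborel. f x * of_real (\<phi> x)) + \<mu>\<^sup>2 * (LINT x|lborel. resolvent \<mu> f x * of_real (\<phi> x))"
proof -
  let ?g = "\<lambda>x. complex_of_real (deriv (deriv \<phi>) x) - \<mu>\<^sup>2 * of_real (\<phi> x)"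
  obtain M where M: "\<And>x. \<bar>\<phi> x\<bar> \<le> M" using test_fun_bounded[OF t] by blast
  obtain M2 where M2: "\<And>x. \<bar>deriv (deriv \<phi>) x\<bar> \<le> M2"
    using test_fun_bounded[OF test_fun_deriv[OF test_fun_deriv[OF t]]] by blast
  have "(LINT x|lborel. resolvent \<mu> f x * ?g x) = (LINT x|lborel. f x * resolvent \<mu> ?g x)"
  proof (rule resolvent_adjoint[OF mu f])
    show "?g \<in> borel_measurable borel"
      by (intro borel_measurable_continuous_onI continuous_intros test_fun_continuous t test_fun_deriv)
    show "norm (?g x) \<le> M2 + norm (\<mu>\<^sup>2) * M" for x
      by (rule order_trans[OF norm_triangle_ineq4])
         (auto simp: norm_mult norm_power intro!: add_mono mult_left_mono M M2)
  qed
  also have "\<dots> = (LINT x|lborel. f x * of_real (\<phi> x))"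
    by (simp only: resolvent_test_fun[OF mu t])
  finally have *: "(LINT x|lborel. resolvent \<mu> f x * ?g x) = (LINT x|lborel. f x * of_real (\<phi> x))" .
  note b = bounded_integrable_resolvent[OF mu f]
  have "(LINT x|lborel. resolvent \<mu> f x * ?g x) =
     (LINT x|lborel. resolvent \<mu> f x * of_real (deriv (deriv \<phi>) x)
         - \<mu>\<^sup>2 * (resolvent \<mu> f x * of_real (\<phi> x)))"
    by (simp add: algebra_simps)
  also have "\<dots> = (LINT x|lborel. resolvent \<mu> f x * of_real (deriv (deriv \<phi>) x))
      - \<mu>\<^sup>2 * (LINT x|lborel. resolvent \<mu> f x * of_real (\<phi> x))"
    using bounded_integrable_times_test_fun[OF b t]
      bounded_integrable_times_test_fun[OF b test_fun_deriv[OF test_fun_deriv[OF t]]]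
    by simp
  finally show ?thesis using * by (simp add: algebra_simps)
qed

lemma resolvent_even:
  assumes "AE t in lborel. f (- t) = f t" "f \<in> borel_measurable borel"
  shows "resolvent \<mu> f (- x) = resolvent \<mu> f x"
proof -
  have [measurable]: "f \<in> borel_measurable borel" by fact
  have "resolvent \<mu> f (- x) = (LINT t|lborel. resolvent_kernel \<mu> (- x - (0 + (- 1) * t)) * f (0 + (- 1) * t))"
    unfolding resolvent_def by (subst lborel_integral_real_affine[of "- 1" _ 0]) auto
  also have "\<dots> = (LINT t|lborel. resolvent_kernel \<mu> (x - t) * f t)"
  proof (rule integral_cong_AE)
    have "resolvent_kernel \<mu> (t - x) = resolvent_kernel \<mu> (x - t)" for t
      using resolvent_kernel_minus[of \<mu> "x - t"] by simp
    then show "AE t in lborel. resolvent_kernel \<mu> (- x - (0 + (- 1) * t)) * f (0 + (- 1) * t) =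
       resolvent_kernel \<mu> (x - t) * f t"
      using assms(1) by (auto simp: add.commute)
  qed measurable
  finally show ?thesis by (simp add: resolvent_def)
qed

section \<open>Inverting the matrix operator\<close>

lemma det_symb:
  "det (symb p \<xi>) = (- nu p * (2 * pi * \<xi>)\<^sup>2 + lam6 p - 1) * (- (2 * pi * \<xi>)\<^sup>2 - nu3 p) - lam7 p * lam5 p"
  by (simp add: symb_def det_2 power_mult_distrib)

text \<open>As a polynomial in \<open>z = - \<bar>2 \<pi> \<xi>\<bar>\<^sup>2\<close> the determinant of the symbol is
\<open>(\<nu> z + \<lambda>\<^sub>6 - 1) (z - \<nu>\<^sub>3) - \<lambda>\<^sub>5 \<lambda>\<^sub>7\<close>. Nonpositive real roots are excluded because the symbol is
invertible, so both roots have square roots in the open right half plane. The last two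
conclusions give the sum of the roots and express that \<open>\<mu>\<^sub>1\<^sup>2\<close> is one of them.\<close>

lemma symbol_roots:
  assumes "nu p > 0" and "\<exists>\<sigma>0 > 0. \<forall>\<xi>. \<bar>det (symb p \<xi>)\<bar> \<ge> \<sigma>0"
  obtains \<mu>1 \<mu>2 :: complex where "Re \<mu>1 > 0" "Re \<mu>2 > 0"
    "of_real (nu p) * (\<mu>1\<^sup>2 + \<mu>2\<^sup>2) = of_real (nu p * nu3 p - (lam6 p - 1))"
    "(of_real (nu p) * \<mu>1\<^sup>2 + of_real (lam6 p - 1)) * (\<mu>1\<^sup>2 - of_real (nu3 p)) = of_real (lam5 p * lam7 p)"
proof -
  define n a c b where "n = complex_of_real (nu p)" and "a = complex_of_real (lam6 p - 1)"
    and "c = complex_of_real (nu3 p)" and "b = complex_of_real (lam5 p * lam7 p)"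
  note defs = n_def a_def c_def b_def
  have n0: "n \<noteq> 0" using assms(1) by (simp add: n_def)
  \<comment> \<open>a square root of the discriminant, so that \<open>z1\<close> and \<open>z2\<close> are the roots\<close>
  define D where "D = csqrt ((a - n * c)\<^sup>2 - 4 * n * (- a * c - b))"
  have D: "D * D = (a - n * c)\<^sup>2 - 4 * n * (- a * c - b)"
    unfolding D_def power2_eq_square[symmetric] by simp
  define z1 z2 where "z1 = (n * c - a + D) / (2 * n)" and "z2 = (n * c - a - D) / (2 * n)"
  have r1: "(n * z1 + a) * (z1 - c) = b"
  proof -
    have "4 * n * ((n * z1 + a) * (z1 - c)) = D * D - (a + n * c)\<^sup>2"
      using n0 by (simp add: z1_def field_simps power2_eq_square)
    also have "\<dots> = 4 * n * b"
      unfolding D by (simp add: power2_eq_square algebra_simps)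
    finally show ?thesis using n0 by simp
  qed
  have r2: "(n * z2 + a) * (z2 - c) = b"
  proof -
    have "4 * n * ((n * z2 + a) * (z2 - c)) = D * D - (a + n * c)\<^sup>2"
      using n0 by (simp add: z2_def field_simps power2_eq_square)
    also have "\<dots> = 4 * n * b"
      unfolding D by (simp add: power2_eq_square algebra_simps)
    finally show ?thesis using n0 by simp
  qed
  have sum: "n * (z1 + z2) = n * c - a"
    using n0 by (simp add: z1_def z2_def field_simps)
  have pos: "Re (csqrt z) > 0" if z: "(n * z + a) * (z - c) = b" for z
  proof (rule ccontr)
    assume "\<not> Re (csqrt z) > 0"
    moreover have "0 \<le> Re (csqrt z)" using csqrt_principal[of z] by linarith
    ultimately have "Re (csqrt z) = 0" by linarith
    then have "csqrt z = \<i> * of_real (Im (csqrt z))" by (simp add: complex_eq_iff)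
    then have "z = (\<i> * of_real (Im (csqrt z)))\<^sup>2" by (metis power2_csqrt)
    then have zs: "z = of_real (- (Im (csqrt z))\<^sup>2)" by (simp add: power_mult_distrib)
    define s where "s = Im (csqrt z)"
    have "complex_of_real ((nu p * (- s\<^sup>2) + (lam6 p - 1)) * (- s\<^sup>2 - nu3 p)) = complex_of_real (lam5 p * lam7 p)"
      using z zs unfolding s_def[symmetric] defs by simp
    then have "(nu p * (- s\<^sup>2) + (lam6 p - 1)) * (- s\<^sup>2 - nu3 p) = lam5 p * lam7 p"
      by (simp only: of_real_eq_iff)
    then have "det (symb p (s / (2 * pi))) = 0"
      unfolding det_symb by (simp add: algebra_simps)
    then show False using assms(2) by (metis abs_zero not_less)
  qed
  show thesis
    using that[of "csqrt z1" "csqrt z2"] pos[OF r1] pos[OF r2] r1 sum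
    by (simp add: defs)
qed

lemma bounded_integrable_add:
  assumes "bounded_integrable f" "bounded_integrable g"
  shows "bounded_integrable (\<lambda>x. f x + g x)"
proof -
  obtain M N where "\<And>x. norm (f x) \<le> M" "\<And>x. norm (g x) \<le> N"
    using assms by (auto simp: bounded_integrable_def)
  then have "norm (f x + g x) \<le> M + N" for x
    by (meson add_mono norm_triangle_le)
  then show ?thesis using assms by (auto simp: bounded_integrable_def)
qed

lemma bounded_integrable_cmult:
  assumes "bounded_integrable f"
  shows "bounded_integrable (\<lambda>x. c * f x)"
proof -
  obtain M where "\<And>x. norm (f x) \<le> M"
    using assms by (auto simp: bounded_integrable_def)
  then have "norm (c * f x) \<le> norm c * M" for x
    by (simp add: norm_mult mult_left_mono)
  then show ?thesis using assms by (auto simp: bounded_integrable_def)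
qed

lemma measurable_vector2:
  fixes f g :: "real \<Rightarrow> real"
  assumes "f \<in> borel_measurable borel" "g \<in> borel_measurable borel"
  shows "(\<lambda>x. vector [f x, g x] :: real^2) \<in> borel_measurable borel"
proof -
  have "(\<lambda>x. vector [f x, g x] :: real^2) = (\<lambda>x. f x *\<^sub>R axis 1 1 + g x *\<^sub>R axis 2 1)"
    by (auto simp: fun_eq_iff vec_eq_iff forall_2 axis_def)
  then show ?thesis using assms by simp
qed

lemma norm_vector2: "(norm (v :: real^2))\<^sup>2 = (v $ 1)\<^sup>2 + (v $ 2)\<^sup>2"
  by (simp add: norm_vec_def L2_set_def sum_2)

lemma L2I_bounded_integrable:
  assumes "bounded_integrable (\<lambda>x. of_real (u x $ 1))" "bounded_integrable (\<lambda>x. of_real (u x $ 2))"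
  shows "u \<in> L2"
proof -
  have i: "integrable lborel (\<lambda>x. u x $ 1)" "integrable lborel (\<lambda>x. u x $ 2)"
    using assms unfolding bounded_integrable_def
    by (auto dest!: Bochner_Integration.integrable_Re)
  have "u = (\<lambda>x. vector [u x $ 1, u x $ 2])"
    by (auto simp: fun_eq_iff vec_eq_iff forall_2)
  then have u: "u \<in> borel_measurable borel"
    using measurable_vector2[of "\<lambda>x. u x $ 1" "\<lambda>x. u x $ 2"] i by auto
  obtain M N where MN: "\<And>x. \<bar>u x $ 1\<bar> \<le> M" "\<And>x. \<bar>u x $ 2\<bar> \<le> N"
    using assms by (auto simp: bounded_integrable_def)
  have "integrable lborel (\<lambda>x. (norm (u x))\<^sup>2)"
  proof (rule Bochner_Integration.integrable_bound)
    show "integrable lborel (\<lambda>x. M * \<bar>u x $ 1\<bar> + N * \<bar>u x $ 2\<bar>)"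
      using i by (intro Bochner_Integration.integrable_add integrable_mult_right integrable_abs)
    show "AE x in lborel. norm ((norm (u x))\<^sup>2) \<le> norm (M * \<bar>u x $ 1\<bar> + N * \<bar>u x $ 2\<bar>)"
    proof (rule AE_I2)
      fix x
      have "(u x $ 1)\<^sup>2 \<le> M * \<bar>u x $ 1\<bar>" "(u x $ 2)\<^sup>2 \<le> N * \<bar>u x $ 2\<bar>"
        using mult_right_mono[OF MN(1)[of x], of "\<bar>u x $ 1\<bar>"] mult_right_mono[OF MN(2)[of x], of "\<bar>u x $ 2\<bar>"]
        by (auto simp: power2_eq_square)
      then show "norm ((norm (u x))\<^sup>2) \<le> norm (M * \<bar>u x $ 1\<bar> + N * \<bar>u x $ 2\<bar>)"
        by (simp add: norm_vector2)
    qed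
  qed (use u in auto)
  then show ?thesis using u by (simp add: L2_def)
qed

text \<open>Cramer's rule. With \<open>P\<^sub>i\<close> and \<open>Q\<^sub>i\<close> the images of the data under one and under both
resolvents, \<open>\<Delta> Q\<^sub>i = P\<^sub>i + \<mu>\<^sub>1\<^sup>2 Q\<^sub>i\<close>, so the adjugate matrix applied to \<open>Q\<^sub>i\<close> involves no derivatives.
The solution of the real equation is the real part of the complex one.\<close>

lemma LL_solvable:
  assumes nu: "nu p > 0" and det: "\<exists>\<sigma>0 > 0. \<forall>\<xi>. \<bar>det (symb p \<xi>)\<bar> \<ge> \<sigma>0"
    and w: "bounded_integrable (\<lambda>x. of_real (w x $ 1))" "bounded_integrable (\<lambda>x. of_real (w x $ 2))"
    and even: "ae_even w"
  shows "\<exists>u \<in> L2. ae_even u \<and> weak_LL p u w"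
proof -
  obtain \<mu>1 \<mu>2 where mu: "Re \<mu>1 > 0" "Re \<mu>2 > 0"
    "of_real (nu p) * (\<mu>1\<^sup>2 + \<mu>2\<^sup>2) = complex_of_real (nu p * nu3 p - (lam6 p - 1))"
    "(of_real (nu p) * \<mu>1\<^sup>2 + of_real (lam6 p - 1)) * (\<mu>1\<^sup>2 - of_real (nu3 p)) = complex_of_real (lam5 p * lam7 p)"
    using symbol_roots[OF nu det] by blast
  define n a where "n = complex_of_real (nu p)" and "a = complex_of_real (lam6 p - 1)"
  define c l5 l7 where "c = complex_of_real (nu3 p)"
    and "l5 = complex_of_real (lam5 p)" and "l7 = complex_of_real (lam7 p)"
  note defs = n_def a_def c_def l5_def l7_def
  have n0: "n \<noteq> 0" using nu by (simp add: n_def)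
  define z1 z2 where "z1 = \<mu>1\<^sup>2" and "z2 = \<mu>2\<^sup>2"
  have z2: "z2 = c - a / n - z1"
    using mu(3) n0 by (simp add: z1_def z2_def defs field_simps)
  have z1: "(n * z1 + a) * (z1 - c) = l5 * l7"
    using mu(4) by (simp add: z1_def defs)
  define f1 f2 where "f1 = (\<lambda>x. complex_of_real (w x $ 1))" and "f2 = (\<lambda>x. complex_of_real (w x $ 2))"
  define P1 P2 Q1 Q2 where "P1 = resolvent \<mu>2 f1" and "P2 = resolvent \<mu>2 f2"
    and "Q1 = resolvent \<mu>1 P1" and "Q2 = resolvent \<mu>1 P2"
  have bf: "bounded_integrable f1" "bounded_integrable f2" using w by (simp_all add: f1_def f2_def)
  have bP: "bounded_integrable P1" "bounded_integrable P2"
    using bf mu by (simp_all add: P1_def P2_def bounded_integrable_resolvent)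
  have bQ: "bounded_integrable Q1" "bounded_integrable Q2"
    using bP mu by (simp_all add: Q1_def Q2_def bounded_integrable_resolvent)
  \<comment> \<open>the adjugate applied to \<open>(Q1, Q2)\<close>, divided by the leading coefficient of the determinant\<close>
  define U1 where "U1 = (\<lambda>x. 1 / n * P1 x + ((z1 - c) / n * Q1 x + - l7 / n * Q2 x))"
  define U2 where "U2 = (\<lambda>x. - l5 / n * Q1 x + (1 * P2 x + (n * z1 + a) / n * Q2 x))"
  have bU: "bounded_integrable U1" "bounded_integrable U2"
    unfolding U1_def U2_def by (intro bounded_integrable_add bounded_integrable_cmult bP bQ)+
  define u where "u = (\<lambda>x. vector [Re (U1 x), Re (U2 x)] :: real^2)"
  have bRe: "bounded_integrable (\<lambda>x. of_real (Re (F x)))" if b: "bounded_integrable F" for F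
  proof -
    obtain M where M: "\<And>x. norm (F x) \<le> M" using b by (auto simp: bounded_integrable_def)
    then have "norm (complex_of_real (Re (F x))) \<le> M" for x
      using order_trans[OF abs_Re_le_cmod M] by simp
    then show ?thesis using b by (auto simp: bounded_integrable_def)
  qed
  have uL2: "u \<in> L2"
    using bRe[OF bU(1)] bRe[OF bU(2)] by (intro L2I_bounded_integrable) (simp_all add: u_def)
  have ev: "AE x in lborel. w (- x) = w x" using even by (simp add: ae_even_def)
  have evf: "AE x in lborel. f1 (- x) = f1 x" "AE x in lborel. f2 (- x) = f2 x"
    using ev by (auto simp: f1_def f2_def)
  have evP: "P1 (- x) = P1 x" "P2 (- x) = P2 x" for x
    using bf evf unfolding P1_def P2_def
    by (auto intro!: resolvent_even bounded_integrable_measurable)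
  have evQ: "Q1 (- x) = Q1 x" "Q2 (- x) = Q2 x" for x
    using bP evP unfolding Q1_def Q2_def
    by (auto intro!: resolvent_even bounded_integrable_measurable)
  have "ae_even u"
    by (simp add: ae_even_def u_def U1_def U2_def evP evQ)
  moreover have "weak_LL p u w"
    unfolding weak_LL_def
  proof (intro allI impI)
    fix \<phi> assume t: "test_fun \<phi>"
    define I where "I = (\<lambda>(F :: real \<Rightarrow> complex) \<psi>. LINT x|lborel. F x * complex_of_real (\<psi> x))"
    define \<phi>'' where "\<phi>'' = deriv (deriv \<phi>)"
    have t'': "test_fun \<phi>''" unfolding \<phi>''_def by (intro test_fun_deriv t)
    have I3: "I (\<lambda>x. \<alpha> * F x + (\<beta> * G x + \<gamma> * H x)) \<psi> = \<alpha> * I F \<psi> + (\<beta> * I G \<psi> + \<gamma> * I H \<psi>)"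
      if "bounded_integrable F" "bounded_integrable G" "bounded_integrable H" "test_fun \<psi>"
      for \<alpha> \<beta> \<gamma> F G H \<psi>
      using bounded_integrable_times_test_fun[OF that(1,4)] bounded_integrable_times_test_fun[OF that(2,4)]
        bounded_integrable_times_test_fun[OF that(3,4)]
      by (simp add: I_def distrib_right mult.assoc)
    have ReI: "Re (I F \<psi>) = (LINT x|lborel. Re (F x) * \<psi> x)" if "bounded_integrable F" "test_fun \<psi>" for F \<psi>
      using bounded_integrable_times_test_fun[OF that] by (simp add: I_def flip: integral_Re)
    have iRe: "integrable lborel (\<lambda>x. Re (F x) * \<psi> x)" if "bounded_integrable F" "test_fun \<psi>" for F \<psi>
      using Bochner_Integration.integrable_Re[OF bounded_integrable_times_test_fun[OF that]] by simp
    have kP: "I P1 \<phi>'' = I f1 \<phi> + z2 * I P1 \<phi>" "I P2 \<phi>'' = I f2 \<phi> + z2 * I P2 \<phi>"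
      unfolding I_def \<phi>''_def P1_def P2_def z2_def
      by (intro resolvent_weak mu bf t)+
    have kQ: "I Q1 \<phi>'' = I P1 \<phi> + z1 * I Q1 \<phi>" "I Q2 \<phi>'' = I P2 \<phi> + z1 * I Q2 \<phi>"
      unfolding I_def \<phi>''_def Q1_def Q2_def z1_def
      by (intro resolvent_weak mu bP t)+
    have iU1: "I U1 \<psi> = 1 / n * I P1 \<psi> + ((z1 - c) / n * I Q1 \<psi> + - l7 / n * I Q2 \<psi>)"
     and iU2: "I U2 \<psi> = - l5 / n * I Q1 \<psi> + (1 * I P2 \<psi> + (n * z1 + a) / n * I Q2 \<psi>)"
      if "test_fun \<psi>" for \<psi>
      unfolding U1_def U2_def by (intro I3 bP bQ that)+
    have l57: "l5 * l7 = (n * z1 + a) * (z1 - c)" using z1 by simp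
    \<comment> \<open>the coefficient of \<open>P\<close> vanishes by the sum of the roots, that of \<open>Q\<close> because \<open>z1\<close> is a root\<close>
    have e1: "n * I U1 \<phi>'' + a * I U1 \<phi> + l7 * I U2 \<phi> = I f1 \<phi>"
    proof -
      have "n * (n * I U1 \<phi>'' + a * I U1 \<phi> + l7 * I U2 \<phi>) =
        n * I f1 \<phi> + (n * z2 + n * z1 - n * c + a) * I P1 \<phi>
          + ((n * z1 + a) * (z1 - c) - l5 * l7) * I Q1 \<phi>"
        unfolding iU1[OF t] iU2[OF t] iU1[OF t''] kP kQ using n0
        by (simp add: field_simps)
      also have "\<dots> = n * I f1 \<phi>"
        unfolding z2 z1 using n0 by (simp add: field_simps)
      finally show ?thesis using n0 by simp
    qed
    have e2: "I U2 \<phi>'' + (l5 * I U1 \<phi> - c * I U2 \<phi>) = I f2 \<phi>"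
    proof -
      have "n * (I U2 \<phi>'' + (l5 * I U1 \<phi> - c * I U2 \<phi>)) =
        n * I f2 \<phi> + (n * z2 + n * z1 - n * c + a) * I P2 \<phi>
          + ((n * z1 + a) * (z1 - c) - l5 * l7) * I Q2 \<phi>"
        unfolding iU1[OF t] iU2[OF t] iU2[OF t''] kP kQ using n0
        by (simp add: field_simps)
      also have "\<dots> = n * I f2 \<phi>"
        unfolding z2 z1 using n0 by (simp add: field_simps)
      finally show ?thesis using n0 by simp
    qed
    have "(LINT x|lborel. w x $ 1 * \<phi> x) = Re (I f1 \<phi>)"
      using ReI[OF bf(1) t] by (simp add: f1_def)
    also have "\<dots> = nu p * Re (I U1 \<phi>'') + (lam6 p - 1) * Re (I U1 \<phi>) + lam7 p * Re (I U2 \<phi>)"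
      unfolding e1[symmetric] by (simp add: defs)
    also have "\<dots> = (LINT x|lborel. nu p * (Re (U1 x) * \<phi>'' x) + (lam6 p - 1) * (Re (U1 x) * \<phi> x) + lam7 p * (Re (U2 x) * \<phi> x))"
      using iRe[OF bU(1) t] iRe[OF bU(2) t] iRe[OF bU(1) t''] ReI[OF bU(1) t] ReI[OF bU(2) t] ReI[OF bU(1) t'']
      by simp
    finally have r1: "(LINT x|lborel. w x $ 1 * \<phi> x) =
        (LINT x|lborel. nu p * (Re (U1 x) * \<phi>'' x) + (lam6 p - 1) * (Re (U1 x) * \<phi> x) + lam7 p * (Re (U2 x) * \<phi> x))" .
    have "(LINT x|lborel. w x $ 2 * \<phi> x) = Re (I f2 \<phi>)"
      using ReI[OF bf(2) t] by (simp add: f2_def)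
    also have "\<dots> = Re (I U2 \<phi>'') + (lam5 p * Re (I U1 \<phi>) - nu3 p * Re (I U2 \<phi>))"
      unfolding e2[symmetric] by (simp add: defs)
    also have "\<dots> = (LINT x|lborel. Re (U2 x) * \<phi>'' x + (lam5 p * (Re (U1 x) * \<phi> x) - nu3 p * (Re (U2 x) * \<phi> x)))"
      using iRe[OF bU(1) t] iRe[OF bU(2) t] iRe[OF bU(2) t''] ReI[OF bU(1) t] ReI[OF bU(2) t] ReI[OF bU(2) t'']
      by simp
    finally have r2: "(LINT x|lborel. w x $ 2 * \<phi> x) =
       (LINT x|lborel. Re (U2 x) * \<phi>'' x + (lam5 p * (Re (U1 x) * \<phi> x) - nu3 p * (Re (U2 x) * \<phi> x)))" .
    show "(LINT x|lborel. w x $ 1 * \<phi> x) =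
       (LINT x|lborel. nu p * u x $ 1 * deriv (deriv \<phi>) x
                       + ((lam6 p - 1) * u x $ 1 + lam7 p * u x $ 2) * \<phi> x) \<and>
     (LINT x|lborel. w x $ 2 * \<phi> x) =
       (LINT x|lborel. u x $ 2 * deriv (deriv \<phi>) x
                       + (lam5 p * u x $ 1 - nu3 p * u x $ 2) * \<phi> x)"
      unfolding r1 r2 by (simp add: u_def \<phi>''_def algebra_simps)
  qed
  ultimately show ?thesis using uL2 by blast
qed

lemma LL_inv_solves:
  assumes nu: "nu p > 0" and det: "\<exists>\<sigma>0 > 0. \<forall>\<xi>. \<bar>det (symb p \<xi>)\<bar> \<ge> \<sigma>0"
    and w: "bounded_integrable (\<lambda>x. of_real (w x $ 1))" "bounded_integrable (\<lambda>x. of_real (w x $ 2))"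
    and even: "ae_even w" and w': "AE x in lborel. w' x = w x"
  shows "LL_inv p w' \<in> H_e p" "norm_H p (LL_inv p w') = norm_L2 w"
proof -
  obtain u where u: "u \<in> L2" "ae_even u" "weak_LL p u w"
    using LL_solvable[OF nu det w even] by blast
  have wL2: "w \<in> L2" by (rule L2I_bounded_integrable[OF w])
  have uH: "u \<in> H_e p" using u wL2 by (auto simp: H_e_def H_def)
  have "AE x in lborel. LL p u x = w' x" using LL_eqI(1)[OF u(3) wL2] w' by auto
  then have "LL_inv p w' \<in> H_e p \<and> (AE x in lborel. LL p (LL_inv p w') x = w' x)"
    unfolding LL_inv_def
    using someI[of "\<lambda>u. u \<in> H_e p \<and> (AE x in lborel. LL p u x = w' x)" u] uH by blast
  then have i: "LL_inv p w' \<in> H_e p" and l: "AE x in lborel. LL p (LL_inv p w') x = w' x"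
    by auto
  show "LL_inv p w' \<in> H_e p" by (rule i)
  obtain w0 where "w0 \<in> L2" "weak_LL p (LL_inv p w') w0"
    using i by (auto simp: H_e_def H_def)
  then have L: "LL p (LL_inv p w') \<in> L2" using LL_eqI by blast
  have "AE x in lborel. LL p (LL_inv p w') x = w x" using l w' by auto
  then have "(LINT x|lborel. (norm (LL p (LL_inv p w') x))\<^sup>2) = (LINT x|lborel. (norm (w x))\<^sup>2)"
    using L wL2 by (intro integral_cong_AE) (auto simp: L2_def)
  then show "norm_H p (LL_inv p w') = norm_L2 w"
    by (simp add: norm_H_def norm_L2_def)
qed

section \<open>Cosine series of absolutely summable sequences\<close>

(* Two predicates share this infix name; below it always means that the norms have an unordered sum. *)
no_notation Infinite_Set_Sum.abs_summable_on (infix \<open>abs'_summable'_on\<close> 50)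

definition ell1 :: "(nat \<Rightarrow> real) \<Rightarrow> bool" where
  "ell1 V \<longleftrightarrow> summable (\<lambda>n. \<bar>V n\<bar>)"

definition cosine_series :: "(nat \<Rightarrow> real) \<Rightarrow> real \<Rightarrow> real" where
  "cosine_series V \<theta> = (\<Sum>n. alpha n * V n * cos (real n * \<theta>))"

lemma alpha_pos: "alpha n > 0"
  by (simp add: alpha_def)

lemma gamma_dag_eq: "gamma_dag d V x = indicator {-d<..<d} x * cosine_series V (pi * x / d)"
  by (simp add: gamma_dag_def cosine_series_def freq_def mult_ac)

lemma norm_summable_sums: "summable (\<lambda>n. norm (f n)) \<Longrightarrow> f sums suminf f" for f :: "nat \<Rightarrow> 'a::banach"
  by (rule summable_sums[OF summable_norm_cancel])

lemma norm_summable_has_sum: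
  "summable (\<lambda>n. norm (f n)) \<Longrightarrow> (f has_sum suminf f) UNIV" for f :: "nat \<Rightarrow> 'a::banach"
  by (rule norm_summable_imp_has_sum[OF _ norm_summable_sums])

text \<open>Sums over the integers are used for convolutions and sums over the natural numbers with the
weights \<open>\<alpha>\<^sub>n\<close> for cosine series; this lemma translates between both.\<close>

lemma has_sum_int_split:
  fixes g :: "int \<Rightarrow> 'a::banach"
  assumes p: "summable (\<lambda>n. norm (g (int n)))" and m: "summable (\<lambda>n. norm (g (- int n)))"
  shows "g abs_summable_on UNIV"
    and "(\<lambda>n. if n = 0 then g 0 else g (int n) + g (- int n)) sums infsum g UNIV"
proof -
  let ?m = "\<lambda>n. - int (Suc n)"
  have UN: "UNIV = range int \<union> range ?m"
  proof -
    have "k \<in> range int \<union> range ?m" for k :: int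
    proof (cases "k \<ge> 0")
      case True
      then have "k = int (nat k)" by simp
      then show ?thesis by blast
    next
      case False
      then have "k = ?m (nat (- k) - 1)" by auto
      then show ?thesis by blast
    qed
    then show ?thesis by auto
  qed
  have disj: "range int \<inter> range ?m = {}" by auto
  have m': "summable (\<lambda>n. norm (g (?m n)))"
    using m summable_Suc_iff[of "\<lambda>n. norm (g (- int n))"] by simp
  have inj: "inj int" "inj ?m" by (auto simp: inj_on_def)
  have "(\<lambda>k. norm (g k)) summable_on range int"
    using p inj by (simp add: summable_on_reindex o_def summable_on_UNIV_nonneg_real_iff)
  moreover have "(\<lambda>k. norm (g k)) summable_on range ?m"
    unfolding summable_on_reindex[OF inj(2)] o_def
    using m' by (subst summable_on_UNIV_nonneg_real_iff) simp_all
  ultimately show abs: "g abs_summable_on UNIV"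
    unfolding UN using disj by (rule summable_on_Un_disjoint)
  have A: "(g has_sum (\<Sum>n. g (int n))) (range int)"
    unfolding has_sum_reindex[OF inj(1)] o_def
    using p by (rule norm_summable_has_sum)
  have B: "(g has_sum (\<Sum>n. g (?m n))) (range ?m)"
    unfolding has_sum_reindex[OF inj(2)] o_def
    using m' by (rule norm_summable_has_sum)
  have "infsum g UNIV = (\<Sum>n. g (int n)) + (\<Sum>n. g (?m n))"
    using has_sum_Un_disjoint[OF A B disj] unfolding UN[symmetric] by (rule infsumI)
  moreover have "(\<lambda>n. if n = 0 then 0 else g (- int n)) sums (\<Sum>n. g (?m n))"
    using norm_summable_sums[OF m'] sums_Suc_iff[of "\<lambda>n. if n = 0 then 0 else g (- int n)" "\<Sum>n. g (?m n)"] by simp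
  moreover have "(\<lambda>n. g (int n)) sums (\<Sum>n. g (int n))"
    using p by (rule norm_summable_sums)
  ultimately have "(\<lambda>n. g (int n) + (if n = 0 then 0 else g (- int n))) sums infsum g UNIV"
    by (simp add: sums_add)
  moreover have "(\<lambda>n. g (int n) + (if n = 0 then 0 else g (- int n))) =
      (\<lambda>n. if n = 0 then g 0 else g (int n) + g (- int n))"
    by auto
  ultimately show "(\<lambda>n. if n = 0 then g 0 else g (int n) + g (- int n)) sums infsum g UNIV"
    by simp
qed

lemma ell1_abs_summable_int:
  assumes "ell1 V"
  shows "(\<lambda>k::int. complex_of_real (V (nat \<bar>k\<bar>)) * cis (of_int k * \<theta>)) abs_summable_on UNIV"
  using assms by (intro has_sum_int_split) (simp_all add: norm_mult ell1_def)

lemma ell1_summable_alpha: "ell1 V \<Longrightarrow> summable (\<lambda>n. alpha n * \<bar>V n\<bar>)"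
  unfolding ell1_def
  by (rule summable_comparison_test'[where g = "\<lambda>n. 2 * \<bar>V n\<bar>"])
     (auto simp: alpha_def intro: summable_mult)

lemma ell1_summable_cos: "ell1 V \<Longrightarrow> summable (\<lambda>n. norm (alpha n * V n * cos (real n * \<theta>)))"
  using ell1_summable_alpha[of V]
  by (rule summable_comparison_test') (auto simp: abs_mult alpha_def mult_left_le abs_cos_le_one)

text \<open>In the two-sided exponential form a product of two series is rearranged by shifting the index,
whereas products of cosines would have to be split into two terms.\<close>

lemma infsum_cis_eq_cosine_series:
  assumes "ell1 V"
  shows "(\<Sum>\<^sub>\<infinity>k::int. complex_of_real (V (nat \<bar>k\<bar>)) * cis (of_int k * \<theta>)) = of_real (cosine_series V \<theta>)"
proof -
  let ?g = "\<lambda>k::int. complex_of_real (V (nat \<bar>k\<bar>)) * cis (of_int k * \<theta>)"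
  have "(\<lambda>n. if n = 0 then ?g 0 else ?g (int n) + ?g (- int n)) sums infsum ?g UNIV"
    using assms by (intro has_sum_int_split) (simp_all add: norm_mult ell1_def)
  moreover have "(\<lambda>n. if n = 0 then ?g 0 else ?g (int n) + ?g (- int n))
      = (\<lambda>n. complex_of_real (alpha n * V n * cos (real n * \<theta>)))"
    by (rule ext) (auto simp: alpha_def complex_eq_iff)
  moreover have "(\<lambda>n. complex_of_real (alpha n * V n * cos (real n * \<theta>))) sums of_real (cosine_series V \<theta>)"
    unfolding cosine_series_def sums_of_real_iff
    using ell1_summable_cos[OF assms, of \<theta>] by (rule norm_summable_sums)
  ultimately show ?thesis using sums_unique2 by (simp only:)
qed

lemma cosine_series_bound:
  assumes "ell1 V"
  shows "\<bar>cosine_series V \<theta>\<bar> \<le> (\<Sum>n. alpha n * \<bar>V n\<bar>)"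
proof -
  have "\<bar>cosine_series V \<theta>\<bar> \<le> (\<Sum>n. norm (alpha n * V n * cos (real n * \<theta>)))"
    unfolding cosine_series_def real_norm_def[symmetric]
    by (rule summable_norm[OF ell1_summable_cos[OF assms]])
  also have "\<dots> \<le> (\<Sum>n. alpha n * \<bar>V n\<bar>)"
    using ell1_summable_cos[OF assms] ell1_summable_alpha[OF assms]
    by (intro suminf_le) (auto simp: abs_mult alpha_def mult_left_le abs_cos_le_one)
  finally show ?thesis .
qed

lemma cosine_series_measurable [measurable]: "cosine_series V \<in> borel_measurable borel"
  unfolding cosine_series_def by measurable

lemma conv_int:
  "(U \<star> V) (nat \<bar>n\<bar>) = (\<Sum>\<^sub>\<infinity>k::int. U (nat \<bar>n - k\<bar>) * V (nat \<bar>k\<bar>))"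
proof (cases "n \<ge> 0")
  case True
  then show ?thesis by (simp add: conv_def)
next
  case False
  then have "(U \<star> V) (nat \<bar>n\<bar>) = (\<Sum>\<^sub>\<infinity>k::int. U (nat \<bar>- n - k\<bar>) * V (nat \<bar>k\<bar>))"
    by (simp add: conv_def)
  also have "\<dots> = (\<Sum>\<^sub>\<infinity>k::int. U (nat \<bar>n - k\<bar>) * V (nat \<bar>k\<bar>))"
    by (rule infsum_reindex_bij_witness[of _ uminus uminus])
       (auto intro!: arg_cong2[where f = "(*)"] arg_cong[where f = U] arg_cong[where f = V])
  finally show ?thesis .
qed

text \<open>The absolutely summable family of products of terms of the two series, reindexed by
\<open>(m, k) \<mapsto> (m + k, k)\<close>. Summability of a convolution and its cosine series are read off from it.\<close>

lemma conv_products_abs_summable: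
  fixes U V :: "nat \<Rightarrow> real"
  assumes "ell1 U" "ell1 V"
  shows "(\<lambda>(n, k). complex_of_real (U (nat \<bar>n - k\<bar>) * V (nat \<bar>k\<bar>)) * cis (of_int n * \<theta>))
            abs_summable_on (UNIV :: (int \<times> int) set)"
    and "(\<Sum>\<^sub>\<infinity>(n, k)\<in>UNIV. complex_of_real (U (nat \<bar>n - k\<bar>) * V (nat \<bar>k\<bar>)) * cis (of_int n * \<theta>))
      = of_real (cosine_series U \<theta> * cosine_series V \<theta>)"
proof -
  let ?f = "\<lambda>k::int. complex_of_real (U (nat \<bar>k\<bar>)) * cis (of_int k * \<theta>)"
  let ?g = "\<lambda>k::int. complex_of_real (V (nat \<bar>k\<bar>)) * cis (of_int k * \<theta>)"
  let ?F = "\<lambda>(m, k). ?f m * ?g k"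
  let ?G = "\<lambda>(n, k). complex_of_real (U (nat \<bar>n - k\<bar>) * V (nat \<bar>k\<bar>)) * cis (of_int n * \<theta>)"
  have bij: "bij_betw (\<lambda>(n::int, k::int). (n - k, k)) UNIV UNIV"
    by (rule bij_betwI[where g = "\<lambda>(m, k). (m + k, k)"]) auto
  have G: "?G = (\<lambda>z. ?F ((\<lambda>(n, k). (n - k, k)) z))"
    by (auto simp: fun_eq_iff cis_mult algebra_simps)
  have F: "?F abs_summable_on UNIV \<times> UNIV"
    unfolding Infinite_Sum.abs_summable_on_Sigma_iff
  proof (intro conjI ballI)
    show "(\<lambda>k. ?F (m, k)) abs_summable_on UNIV" for m
      using summable_on_cmult_right[OF ell1_abs_summable_int[OF assms(2)], of "norm (?f m)" \<theta>]
      by (simp add: norm_mult)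
    show "(\<lambda>m. \<Sum>\<^sub>\<infinity>k. norm (?F (m, k))) abs_summable_on UNIV"
      using summable_on_cmult_left[OF ell1_abs_summable_int[OF assms(1), of \<theta>], of "\<Sum>\<^sub>\<infinity>k. norm (?g k)"]
      by (simp add: norm_mult infsum_cmult_right' infsum_nonneg)
  qed
  show "?G abs_summable_on UNIV"
    unfolding G using F summable_on_reindex_bij_betw[OF bij, of "\<lambda>z. norm (?F z)"] by simp
  have "infsum ?G UNIV = infsum ?F UNIV"
    unfolding G by (rule infsum_reindex_bij_betw[OF bij])
  also have "\<dots> = infsum ?F (UNIV \<times> UNIV)" by simp
  also have "\<dots> = (\<Sum>\<^sub>\<infinity>m. \<Sum>\<^sub>\<infinity>k. ?f m * ?g k)"
    using Infinite_Sum.abs_summable_summable[OF F] by (subst infsum_Sigma_banach[symmetric]) simp_all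
  also have "\<dots> = infsum ?f UNIV * infsum ?g UNIV"
    by (simp only: infsum_cmult_right' infsum_cmult_left')
  also have "\<dots> = of_real (cosine_series U \<theta> * cosine_series V \<theta>)"
    using assms by (simp add: infsum_cis_eq_cosine_series)
  finally show "infsum ?G UNIV = of_real (cosine_series U \<theta> * cosine_series V \<theta>)" .
qed

lemma conv_summable:
  assumes "ell1 U" "ell1 V"
  shows "(\<lambda>k::int. U (nat \<bar>n - k\<bar>) * V (nat \<bar>k\<bar>)) abs_summable_on UNIV"
proof -
  have "(\<lambda>(n, k). complex_of_real (U (nat \<bar>n - k\<bar>) * V (nat \<bar>k\<bar>)) * cis (of_int n * 0))
     abs_summable_on (UNIV :: int set) \<times> (UNIV :: int set)"
    using conv_products_abs_summable(1)[OF assms, of 0] by simp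
  from this[unfolded Infinite_Sum.abs_summable_on_Sigma_iff, THEN conjunct1, rule_format, of n]
  show ?thesis by (simp add: norm_mult abs_mult)
qed

lemma ell1_conv:
  assumes "ell1 U" "ell1 V"
  shows "ell1 (U \<star> V)"
proof -
  have s: "(\<lambda>(n, k). complex_of_real (U (nat \<bar>n - k\<bar>) * V (nat \<bar>k\<bar>)) * cis (of_int n * 0))
     abs_summable_on (UNIV :: int set) \<times> (UNIV :: int set)"
    using conv_products_abs_summable(1)[OF assms, of 0] by simp
  have "(\<lambda>n::int. \<Sum>\<^sub>\<infinity>k. \<bar>U (nat \<bar>n - k\<bar>) * V (nat \<bar>k\<bar>)\<bar>) abs_summable_on UNIV"
    using s[unfolded Infinite_Sum.abs_summable_on_Sigma_iff, THEN conjunct2] by (simp add: norm_mult abs_mult)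
  then have "(\<lambda>n::int. (U \<star> V) (nat \<bar>n\<bar>)) abs_summable_on UNIV"
  proof (rule Infinite_Sum.abs_summable_on_comparison_test)
    fix n :: int
    have "norm ((U \<star> V) (nat \<bar>n\<bar>)) \<le> (\<Sum>\<^sub>\<infinity>k. norm (U (nat \<bar>n - k\<bar>) * V (nat \<bar>k\<bar>)))"
      unfolding conv_int using conv_summable[OF assms] by (rule norm_infsum_bound)
    then show "norm ((U \<star> V) (nat \<bar>n\<bar>)) \<le> norm (\<Sum>\<^sub>\<infinity>k. \<bar>U (nat \<bar>n - k\<bar>) * V (nat \<bar>k\<bar>)\<bar>)"
      by simp
  qed
  then have "(\<lambda>n::int. norm ((U \<star> V) (nat \<bar>n\<bar>))) summable_on range int"
    by (rule summable_on_subset_banach) simp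
  then have "(\<lambda>n. norm ((U \<star> V) n)) summable_on UNIV"
    by (subst (asm) summable_on_reindex) (auto simp: o_def)
  then show ?thesis
    unfolding ell1_def by (auto dest: summable_on_imp_summable)
qed

lemma cosine_series_conv:
  assumes "ell1 U" "ell1 V"
  shows "cosine_series (U \<star> V) \<theta> = cosine_series U \<theta> * cosine_series V \<theta>"
proof -
  let ?G = "\<lambda>(n::int, k::int). complex_of_real (U (nat \<bar>n - k\<bar>) * V (nat \<bar>k\<bar>)) * cis (of_int n * \<theta>)"
  have s: "?G abs_summable_on UNIV \<times> UNIV"
    using conv_products_abs_summable(1)[OF assms] by simp
  have "complex_of_real (cosine_series (U \<star> V) \<theta>)
      = (\<Sum>\<^sub>\<infinity>n::int. complex_of_real ((U \<star> V) (nat \<bar>n\<bar>)) * cis (of_int n * \<theta>))"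
    using infsum_cis_eq_cosine_series[OF ell1_conv[OF assms]] by simp
  also have "\<dots> = (\<Sum>\<^sub>\<infinity>n. \<Sum>\<^sub>\<infinity>k. ?G (n, k))"
  proof (rule infsum_cong)
    fix n :: int
    have "((\<lambda>k. complex_of_real (U (nat \<bar>n - k\<bar>) * V (nat \<bar>k\<bar>))) has_sum complex_of_real ((U \<star> V) (nat \<bar>n\<bar>))) UNIV"
      unfolding conv_int
      using Infinite_Sum.abs_summable_summable[OF conv_summable[OF assms]] by (intro has_sum_of_real has_sum_infsum)
    from infsumI[OF this]
    show "complex_of_real ((U \<star> V) (nat \<bar>n\<bar>)) * cis (of_int n * \<theta>) = (\<Sum>\<^sub>\<infinity>k. ?G (n, k))"
      by (simp only: case_prod_conv infsum_cmult_left')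
  qed
  also have "\<dots> = infsum ?G (UNIV \<times> UNIV)"
    using Infinite_Sum.abs_summable_summable[OF s] by (rule infsum_Sigma_banach)
  also have "\<dots> = of_real (cosine_series U \<theta> * cosine_series V \<theta>)"
    using conv_products_abs_summable(2)[OF assms] by simp
  finally show ?thesis by (simp only: of_real_eq_iff)
qed

definition l1_norm :: "(nat \<Rightarrow> real) \<Rightarrow> real" where
  "l1_norm V = (\<Sum>n. alpha n * \<bar>V n\<bar>)"

lemma seq_norm_1: "seq_norm 1 V = l1_norm V" if "ell1 V"
proof -
  have "0 \<le> l1_norm V"
    unfolding l1_norm_def using alpha_pos less_imp_le
    by (intro suminf_nonneg ell1_summable_alpha that) (simp add: less_imp_le)
  then show ?thesis by (simp add: seq_norm_def l1_norm_def)
qed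

lemma l1_norm_eq_cosine_series: "l1_norm V = cosine_series (\<lambda>n. \<bar>V n\<bar>) 0"
  by (simp add: l1_norm_def cosine_series_def)

lemma ell1_abs: "ell1 V \<Longrightarrow> ell1 (\<lambda>n. \<bar>V n\<bar>)"
  by (simp add: ell1_def)

text \<open>The norm in \<open>\<ell>\<^sup>1\<close> is the value at \<open>0\<close> of the cosine series of the absolute values, so
submultiplicativity is an instance of \<open>cosine_series_conv\<close>.\<close>

lemma l1_norm_conv_le:
  assumes "ell1 U" "ell1 V"
  shows "l1_norm (U \<star> V) \<le> l1_norm U * l1_norm V"
proof -
  let ?U = "\<lambda>n. \<bar>U n\<bar>" and ?V = "\<lambda>n. \<bar>V n\<bar>"
  note a = ell1_abs[OF assms(1)] ell1_abs[OF assms(2)]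
  have le: "\<bar>(U \<star> V) n\<bar> \<le> (?U \<star> ?V) n" for n
    using norm_infsum_bound[OF conv_summable[OF assms, of "int n"]]
    by (simp add: conv_def abs_mult)
  have "l1_norm (U \<star> V) \<le> l1_norm (?U \<star> ?V)"
    unfolding l1_norm_def
  proof (intro suminf_le ell1_summable_alpha ell1_conv assms a mult_left_mono)
    show "\<bar>(U \<star> V) n\<bar> \<le> \<bar>(?U \<star> ?V) n\<bar>" for n using le[of n] by simp
  qed (simp add: less_imp_le alpha_pos)
  also have "\<dots> = cosine_series (?U \<star> ?V) 0"
  proof -
    have "\<bar>(?U \<star> ?V) n\<bar> = (?U \<star> ?V) n" for n using le[of n] by simp
    then show ?thesis by (simp add: l1_norm_eq_cosine_series)
  qed
  also have "\<dots> = l1_norm U * l1_norm V"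
    by (simp add: cosine_series_conv[OF a] l1_norm_eq_cosine_series)
  finally show ?thesis .
qed

lemma ell1_finite: "finite {n. V n \<noteq> 0} \<Longrightarrow> ell1 V"
  unfolding ell1_def by (rule summable_finite) auto

lemma cosine_series_finite:
  assumes "\<And>n. n > M \<Longrightarrow> V n = 0"
  shows "cosine_series V \<theta> = (\<Sum>n\<le>M. alpha n * V n * cos (real n * \<theta>))"
  unfolding cosine_series_def by (rule suminf_finite) (auto simp: assms not_le)

lemma ell1_support:
  assumes "\<And>n. n > M \<Longrightarrow> V n = 0"
  shows "ell1 V"
proof (rule ell1_finite)
  have "{n. V n \<noteq> 0} \<subseteq> {..M}" using assms not_le by blast
  then show "finite {n. V n \<noteq> 0}" by (rule finite_subset) simp
qed

lemma cosine_series_e0: "cosine_series e0 \<theta> = 1" and ell1_e0: "ell1 e0"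
proof -
  show "ell1 e0" by (rule ell1_support[of 0]) (simp add: e0_def)
  show "cosine_series e0 \<theta> = 1"
    by (subst cosine_series_finite[of 0]) (simp_all add: e0_def alpha_def)
qed

lemma ell1_cosine_series_sums: "ell1 V \<Longrightarrow> (\<lambda>n. alpha n * V n * cos (real n * \<theta>)) sums cosine_series V \<theta>"
  unfolding cosine_series_def
  using ell1_summable_cos by (rule norm_summable_sums)

text \<open>The powers \<open>R k\<close> of \<open>r\<close> have norms at most \<open>\<parallel>r\<parallel>\<^sub>1\<^sup>k\<close>, so the double series of their terms
is absolutely summable. Summing it first over \<open>n\<close> gives the geometric series of \<open>C(r)\<close>, summing it
first over \<open>k\<close> gives the cosine series of \<open>S\<close>.\<close>

lemma neumann_series:
  assumes r: "ell1 r" and small: "l1_norm r < 1"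
  obtains S where "ell1 S" "\<And>\<theta>. cosine_series S \<theta> = 1 / (1 - cosine_series r \<theta>)"
proof -
  define R where "R = (\<lambda>k. ((\<star>) r ^^ k) e0)"
  have R0: "R 0 = e0" and RS: "R (Suc k) = r \<star> R k" for k by (simp_all add: R_def)
  have eR: "ell1 (R k)" for k
    by (induction k) (simp_all add: R0 RS ell1_e0 ell1_conv r)
  have cR: "cosine_series (R k) \<theta> = cosine_series r \<theta> ^ k" for k \<theta>
    by (induction k) (simp_all add: R0 RS cosine_series_e0 cosine_series_conv r eR)
  have r0: "l1_norm r \<ge> 0"
    unfolding l1_norm_def by (intro suminf_nonneg ell1_summable_alpha r) (simp add: less_imp_le alpha_pos)
  have nR: "l1_norm (R k) \<le> l1_norm r ^ k" for k
  proof (induction k)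
    case 0
    have "(\<lambda>n. \<bar>e0 n\<bar>) = e0" by (auto simp: e0_def)
    then show ?case by (simp add: R0 l1_norm_eq_cosine_series cosine_series_e0)
  next
    case (Suc k)
    have "l1_norm (R (Suc k)) \<le> l1_norm r * l1_norm (R k)"
      unfolding RS by (rule l1_norm_conv_le[OF r eR])
    also have "\<dots> \<le> l1_norm r * l1_norm r ^ k"
      by (rule mult_left_mono[OF Suc r0])
    finally show ?case by simp
  qed
  define S where "S = (\<lambda>n. \<Sum>\<^sub>\<infinity>k. R k n)"
  let ?G = "\<lambda>\<theta> (k, n). alpha n * R k n * cos (real n * \<theta>)"
  have inner: "(\<lambda>n. norm (?G \<theta> (k, n))) summable_on UNIV" for k \<theta>
    using ell1_summable_cos[OF eR] by (subst summable_on_UNIV_nonneg_real_iff) auto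
  have G: "?G \<theta> abs_summable_on UNIV \<times> UNIV" for \<theta>
    unfolding Infinite_Sum.abs_summable_on_Sigma_iff
  proof (intro conjI ballI)
    show "(\<lambda>n. ?G \<theta> (k, n)) abs_summable_on UNIV" for k by (rule inner)
    show "(\<lambda>k. \<Sum>\<^sub>\<infinity>n. norm (?G \<theta> (k, n))) abs_summable_on UNIV"
    proof (rule Infinite_Sum.abs_summable_on_comparison_test[of "\<lambda>k. l1_norm r ^ k"])
      show "(\<lambda>k. l1_norm r ^ k) abs_summable_on UNIV"
        using r0 small by (subst summable_on_UNIV_nonneg_real_iff) (auto intro: summable_geometric)
      fix k
      have hs: "((\<lambda>n. alpha n * \<bar>R k n\<bar>) has_sum l1_norm (R k)) UNIV"
        unfolding l1_norm_def using ell1_summable_alpha[OF eR[of k]]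
        by (intro norm_summable_imp_has_sum) (simp_all add: abs_mult alpha_pos less_imp_le summable_sums)
      have "(\<Sum>\<^sub>\<infinity>n. norm (?G \<theta> (k, n))) \<le> l1_norm (R k)"
        by (rule has_sum_mono[OF has_sum_infsum[OF inner] hs])
           (simp add: abs_mult alpha_pos less_imp_le mult_left_le)
      also have "\<dots> \<le> l1_norm r ^ k" by (rule nR)
      finally show "norm (\<Sum>\<^sub>\<infinity>n. norm (?G \<theta> (k, n))) \<le> norm (l1_norm r ^ k)"
        using r0 by (simp add: infsum_nonneg)
    qed
  qed
  have swap: "bij_betw prod.swap (UNIV :: (nat \<times> nat) set) UNIV"
    by (rule bij_betwI[where g = prod.swap]) auto
  have G': "(\<lambda>(n, k). ?G \<theta> (k, n)) abs_summable_on UNIV \<times> UNIV" for \<theta>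
    using G[of \<theta>] summable_on_reindex_bij_betw[OF swap, of "\<lambda>z. norm (?G \<theta> z)"]
    by (simp add: case_prod_unfold)
  have bd: "\<bar>cosine_series r \<theta>\<bar> < 1" for \<theta>
    using cosine_series_bound[OF r, of \<theta>] small by (simp add: l1_norm_def)
  have eS: "ell1 S"
  proof -
    have s: "(\<lambda>k. ?G 0 (k, n)) abs_summable_on UNIV" for n
      using G'[of 0, unfolded Infinite_Sum.abs_summable_on_Sigma_iff, THEN conjunct1, rule_format, of n] by simp
    have "(\<lambda>n. \<Sum>\<^sub>\<infinity>k. norm (?G 0 (k, n))) abs_summable_on UNIV"
      using G'[of 0, unfolded Infinite_Sum.abs_summable_on_Sigma_iff, THEN conjunct2] by simp
    then have "(\<lambda>n. S n) abs_summable_on UNIV"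
    proof (rule Infinite_Sum.abs_summable_on_comparison_test)
      fix n
      have "norm (alpha n * S n) \<le> (\<Sum>\<^sub>\<infinity>k. norm (?G 0 (k, n)))"
        using norm_infsum_bound[OF s[of n]] by (simp add: S_def infsum_cmult_right')
      moreover have "norm (S n) \<le> norm (alpha n * S n)"
        by (simp add: alpha_def abs_mult)
      ultimately show "norm (S n) \<le> norm (\<Sum>\<^sub>\<infinity>k. norm (?G 0 (k, n)))" by simp
    qed
    then show ?thesis by (auto simp: ell1_def dest: summable_on_imp_summable)
  qed
  have "cosine_series S \<theta> = 1 / (1 - cosine_series r \<theta>)" for \<theta>
  proof -
    have "cosine_series S \<theta> = (\<Sum>\<^sub>\<infinity>n. alpha n * S n * cos (real n * \<theta>))"
      by (rule infsumI[symmetric, OF norm_summable_imp_has_sum[OF ell1_summable_cos[OF eS] ell1_cosine_series_sums[OF eS]]])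
    also have "\<dots> = (\<Sum>\<^sub>\<infinity>n. \<Sum>\<^sub>\<infinity>k. ?G \<theta> (k, n))"
      by (simp add: S_def infsum_cmult_right' infsum_cmult_left')
    also have "\<dots> = (\<Sum>\<^sub>\<infinity>k. \<Sum>\<^sub>\<infinity>n. ?G \<theta> (k, n))"
      using infsum_swap_banach[of "\<lambda>n k. ?G \<theta> (k, n)" UNIV UNIV] Infinite_Sum.abs_summable_summable[OF G'[of \<theta>]] by simp
    also have "\<dots> = (\<Sum>\<^sub>\<infinity>k. cosine_series r \<theta> ^ k)"
    proof (rule infsum_cong)
      show "(\<Sum>\<^sub>\<infinity>n. ?G \<theta> (k, n)) = cosine_series r \<theta> ^ k" for k
        using infsumI[OF norm_summable_imp_has_sum[OF ell1_summable_cos[OF eR] ell1_cosine_series_sums[OF eR]], of k \<theta>]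
        by (simp add: cR)
    qed
    also have "\<dots> = 1 / (1 - cosine_series r \<theta>)"
      using bd[of \<theta>] geometric_sums[of "cosine_series r \<theta>"]
      by (intro infsumI norm_summable_imp_has_sum) (auto simp: norm_power power_abs intro: summable_geometric)
    finally show ?thesis .
  qed
  with eS show thesis by (rule that)
qed

section \<open>Parseval identity and Fourier coefficients\<close>

lemma integrable_indicator_bounded:
  fixes f :: "real \<Rightarrow> 'a::{banach, second_countable_topology}"
  assumes [measurable]: "f \<in> borel_measurable borel" and "\<And>x. norm (f x) \<le> M"
  shows "integrable lborel (\<lambda>x. indicator {a<..<b} x *\<^sub>R f x)"
proof (rule Bochner_Integration.integrable_bound)
  have "emeasure lborel {a<..<b} < \<infinity>"
    using emeasure_lborel_box_finite[of a b] by (simp add: box_real)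
  then show "integrable lborel (\<lambda>x. indicator {a<..<b} x * M)"
    by (intro integrable_mult_left integrable_real_indicator) auto
  show "AE x in lborel. norm (indicator {a<..<b} x *\<^sub>R f x) \<le> norm (indicator {a<..<b} x * M)"
    using assms(2) by (intro AE_I2) (auto simp: indicator_def intro: order_trans[OF assms(2)])
qed measurable

lemma integral_Ioo_eq_Icc:
  fixes f :: "real \<Rightarrow> real"
  assumes [measurable]: "f \<in> borel_measurable borel"
  shows "(LINT x|lborel. indicator {a<..<b} x *\<^sub>R f x) = (LINT x|lborel. indicator {a..b} x *\<^sub>R f x)"
proof (rule integral_cong_AE)
  show "AE x in lborel. indicator {a<..<b} x *\<^sub>R f x = indicator {a..b} x *\<^sub>R f x"
    using AE_lborel_singleton[of a] AE_lborel_singleton[of b]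
    by eventually_elim (auto simp: indicator_def)
qed measurable

lemma integral_cos_period:
  assumes d: "d > 0"
  shows "(LINT x|lborel. indicator {-d<..<d} x *\<^sub>R cos (real n * (pi * x / d))) = (if n = 0 then 2 * d else 0)"
proof (cases "n = 0")
  case True
  have "(LINT x|lborel. indicator {-d..d} x *\<^sub>R (1::real)) = d - (- d)"
    using d by (intro integral_FTC_atLeastAtMost) (auto intro!: derivative_eq_intros)
  then show ?thesis using True by (subst integral_Ioo_eq_Icc) auto
next
  case False
  define F where "F = (\<lambda>x. d / (real n * pi) * sin (real n * (pi * x / d)))"
  have F: "(F has_real_derivative cos (real n * (pi * x / d))) (at x within S)" for x S
    unfolding F_def using False d
    by (auto intro!: derivative_eq_intros simp: field_simps)
  have "(LINT x|lborel. indicator {-d..d} x *\<^sub>R cos (real n * (pi * x / d))) = F d - F (- d)"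
    using d F by (intro integral_FTC_atLeastAtMost continuous_intros)
      (auto simp: has_real_derivative_iff_has_vector_derivative[symmetric])
  also have "\<dots> = 0" using d by (simp add: F_def)
  finally show ?thesis using False by (subst integral_Ioo_eq_Icc) auto
qed

text \<open>Termwise integration leaves only the constant term. Applied to convolutions this single formula
yields both the Parseval identity and the Fourier coefficients.\<close>

lemma integral_cosine_series:
  assumes d: "d > 0" and V: "ell1 V"
  shows "(LINT x|lborel. indicator {-d<..<d} x *\<^sub>R cosine_series V (pi * x / d)) = 2 * d * V 0"
proof -
  let ?f = "\<lambda>n x. indicator {-d<..<d} x * (alpha n * V n * cos (real n * (pi * x / d)))"
  have int: "integrable lborel (?f n)" for n
  proof -
    have "integrable lborel (\<lambda>x. indicator {-d<..<d} x *\<^sub>R (alpha n * V n * cos (real n * (pi * x / d))))"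
      by (rule integrable_indicator_bounded[where M = "\<bar>alpha n * V n\<bar>"])
         (auto simp: abs_mult mult_left_le)
    then show ?thesis by simp
  qed
  have inorm: "(LINT x|lborel. norm (?f n x)) \<le> 2 * d * (alpha n * \<bar>V n\<bar>)" for n
  proof -
    have "(LINT x|lborel. norm (?f n x)) \<le> (LINT x|lborel. indicator {-d<..<d} x *\<^sub>R (alpha n * \<bar>V n\<bar>))"
    proof (rule integral_mono)
      show "integrable lborel (\<lambda>x. indicator {-d<..<d} x *\<^sub>R (alpha n * \<bar>V n\<bar>))"
        by (rule integrable_indicator_bounded) auto
      show "norm (?f n x) \<le> indicator {-d<..<d} x *\<^sub>R (alpha n * \<bar>V n\<bar>)" for x
        by (auto simp: indicator_def abs_mult mult_left_le alpha_pos less_imp_le)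
    qed (use int in auto)
    also have "\<dots> = 2 * d * (alpha n * \<bar>V n\<bar>)"
      using integral_cos_period[OF d, of 0] by simp
    finally show ?thesis .
  qed
  have "(LINT x|lborel. (\<Sum>n. ?f n x)) = (\<Sum>n. LINT x|lborel. ?f n x)"
  proof (rule integral_suminf)
    show "AE x in lborel. summable (\<lambda>n. norm (?f n x))"
    proof (rule AE_I2)
      show "summable (\<lambda>n. norm (?f n x))" for x
        using ell1_summable_cos[OF V, of "pi * x / d"] by (cases "x \<in> {-d<..<d}") simp_all
    qed
    show "summable (\<lambda>n. LINT x|lborel. norm (?f n x))"
    proof (rule summable_comparison_test')
      show "summable (\<lambda>n. 2 * d * (alpha n * \<bar>V n\<bar>))"
        by (intro summable_mult ell1_summable_alpha V)
      show "norm (LINT x|lborel. norm (?f n x)) \<le> 2 * d * (alpha n * \<bar>V n\<bar>)" for n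
        using inorm[of n] by simp
    qed
  qed (rule int)
  moreover have "(\<lambda>n. LINT x|lborel. ?f n x) = (\<lambda>n. if n = 0 then 2 * d * V 0 else 0)"
  proof
    fix n
    have "(LINT x|lborel. ?f n x) = (LINT x|lborel. (alpha n * V n) * (indicator {-d<..<d} x *\<^sub>R cos (real n * (pi * x / d))))"
      by (simp add: mult_ac)
    also have "\<dots> = (alpha n * V n) * (if n = 0 then 2 * d else 0)"
      by (simp only: integral_mult_right_zero integral_cos_period[OF d])
    finally show "(LINT x|lborel. ?f n x) = (if n = 0 then 2 * d * V 0 else 0)" by (simp add: alpha_def)
  qed
  moreover have "(\<Sum>n. if n = 0 then 2 * d * V 0 else 0) = 2 * d * V 0"
    using suminf_finite[of "{0}" "\<lambda>n. if n = 0 then 2 * d * V 0 else 0"] by simp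
  moreover have "(\<lambda>x. \<Sum>n. ?f n x) = (\<lambda>x. indicator {-d<..<d} x *\<^sub>R cosine_series V (pi * x / d))"
    by (auto simp: cosine_series_def indicator_def)
  ultimately show ?thesis by (simp only:)
qed

lemma conv_0:
  assumes "ell1 U" "ell1 V"
  shows "(\<lambda>n. alpha n * (U n * V n)) sums (U \<star> V) 0"
proof -
  let ?g = "\<lambda>k::int. U (nat \<bar>k\<bar>) * V (nat \<bar>k\<bar>)"
  have "(\<lambda>k. norm (?g k)) summable_on UNIV"
    using conv_summable[OF assms, of 0] by simp
  then have "(\<lambda>k. norm (?g k)) summable_on range int"
    by (rule summable_on_subset_banach) simp
  then have "(\<lambda>n. norm (?g (int n))) summable_on UNIV"
    by (subst (asm) summable_on_reindex) (auto simp: o_def)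
  then have s: "summable (\<lambda>n. norm (?g (int n)))" by (rule summable_on_imp_summable)
  have "(\<lambda>n. if n = 0 then ?g 0 else ?g (int n) + ?g (- int n)) sums infsum ?g UNIV"
    using s by (intro has_sum_int_split) simp_all
  moreover have "(\<lambda>n. if n = 0 then ?g 0 else ?g (int n) + ?g (- int n)) = (\<lambda>n. alpha n * (U n * V n))"
    by (auto simp: alpha_def)
  moreover have "infsum ?g UNIV = (U \<star> V) 0"
    by (simp add: conv_def)
  ultimately show ?thesis by simp
qed

text \<open>The square of the series is the series of \<open>V \<star> V\<close>, whose constant term is the squared norm.\<close>

lemma parseval:
  assumes d: "d > 0" and V: "ell1 V"
  shows "(LINT x|lborel. indicator {-d<..<d} x * (cosine_series V (pi * x / d))\<^sup>2) = 2 * d * (seq_norm 2 V)\<^sup>2"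
    and "V \<in> ell 2"
proof -
  have "(\<lambda>n. alpha n * (V n * V n)) sums (V \<star> V) 0" by (rule conv_0[OF V V])
  then have s: "(\<lambda>n. alpha n * \<bar>V n\<bar> powr 2) sums (V \<star> V) 0"
    by (simp add: power2_eq_square)
  then show "V \<in> ell 2" by (auto simp: ell_def sums_iff)
  have "0 \<le> (V \<star> V) 0"
    by (rule sums_le[OF _ sums_zero s]) (simp add: less_imp_le alpha_pos)
  then have "(seq_norm 2 V)\<^sup>2 = (V \<star> V) 0"
    using sums_unique[OF s] by (simp add: seq_norm_def powr_half_sqrt)
  moreover have "(LINT x|lborel. indicator {-d<..<d} x * (cosine_series V (pi * x / d))\<^sup>2)
      = (LINT x|lborel. indicator {-d<..<d} x *\<^sub>R cosine_series (V \<star> V) (pi * x / d))"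
    by (simp add: cosine_series_conv[OF V V] power2_eq_square)
  ultimately show "(LINT x|lborel. indicator {-d<..<d} x * (cosine_series V (pi * x / d))\<^sup>2) = 2 * d * (seq_norm 2 V)\<^sup>2"
    using integral_cosine_series[OF d ell1_conv[OF V V]] by simp
qed

text \<open>The cosine is the series of the sequence \<open>c\<close> with the single entry \<open>1 / \<alpha>\<^sub>n\<close>, and the constant term of
\<open>V \<star> c\<close> is \<open>V\<^sub>n\<close>.\<close>

lemma integral_cosine_series_cos:
  assumes d: "d > 0" and V: "ell1 V"
  shows "(LINT x|lborel. indicator {-d<..<d} x *\<^sub>R (cosine_series V (pi * x / d) * cos (real n * (pi * x / d)))) = 2 * d * V n"
proof -
  define c where "c = (\<lambda>k. if k = n then 1 / alpha n else 0)"
  have c: "ell1 c" by (rule ell1_support[of n]) (simp add: c_def)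
  have a: "alpha n \<noteq> 0" using alpha_pos[of n] by simp
  have cc: "cosine_series c \<theta> = cos (real n * \<theta>)" for \<theta>
  proof -
    have "(\<lambda>k. alpha k * c k * cos (real k * \<theta>)) = (\<lambda>k. if k = n then cos (real n * \<theta>) else 0)"
      using a by (auto simp: c_def)
    then show ?thesis unfolding cosine_series_def
      using suminf_finite[of "{n}" "\<lambda>k. if k = n then cos (real n * \<theta>) else 0"] by simp
  qed
  have "(\<lambda>k. alpha k * (V k * c k)) = (\<lambda>k. if k = n then V n else 0)"
    using a by (auto simp: c_def)
  then have "(\<lambda>k. if k = n then V n else 0) sums (V \<star> c) 0"
    using conv_0[OF V c] by simp
  moreover have "(\<lambda>k. if k = n then V n else 0) sums V n"
    using sums_single[of n "\<lambda>_. V n"] by simp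
  ultimately have v: "(V \<star> c) 0 = V n" by (rule sums_unique2)
  show ?thesis
    using integral_cosine_series[OF d ell1_conv[OF V c]]
    by (simp add: cosine_series_conv[OF V c] cc v)
qed

lemma gamma_eqI:
  assumes d: "d > 0" and V: "ell1 V" and [measurable]: "f \<in> borel_measurable borel"
    and f: "AE x in lborel. x \<in> {-d<..<d} \<longrightarrow> f x = cosine_series V (pi * x / d)"
  shows "gamma d f = V"
proof
  fix n
  define h where "h = (\<lambda>x. complex_of_real (cosine_series V (pi * x / d)) * cis (- (real n * (pi * x / d))))"
  have e: "exp (- (2 * complex_of_real pi * \<i> * complex_of_real (freq d n * x))) = cis (- (real n * (pi * x / d)))" for x
    by (simp add: cis_conv_exp freq_def field_simps)
  have cm [measurable]: "(\<lambda>x. cis (- (real n * (pi * x / d)))) \<in> borel_measurable borel"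
    by (intro borel_measurable_continuous_onI continuous_intros) (use d in auto)
  have hm [measurable]: "h \<in> borel_measurable borel"
    unfolding h_def by measurable
  have hi: "integrable lborel (\<lambda>x. indicator {-d<..<d} x *\<^sub>R h x)"
    by (rule integrable_indicator_bounded[OF hm, of "\<Sum>n. alpha n * \<bar>V n\<bar>"])
       (simp add: h_def norm_mult cosine_series_bound[OF V])
  have "(LINT x:{-d<..<d}|lborel. complex_of_real (f x) * exp (- (2 * complex_of_real pi * \<i> * complex_of_real (freq d n * x))))
     = (LINT x|lborel. indicator {-d<..<d} x *\<^sub>R h x)"
    unfolding e set_lebesgue_integral_def h_def
  proof (rule integral_cong_AE)
    show "AE x in lborel. indicator {-d<..<d} x *\<^sub>R (complex_of_real (f x) * cis (- (real n * (pi * x / d))))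
      = indicator {-d<..<d} x *\<^sub>R (complex_of_real (cosine_series V (pi * x / d)) * cis (- (real n * (pi * x / d))))"
      using f by eventually_elim (auto simp: indicator_def)
  qed measurable
  then have "gamma d f n = Re (LINT x|lborel. indicator {-d<..<d} x *\<^sub>R h x) / (2 * d)"
    by (simp add: gamma_def)
  also have "Re (LINT x|lborel. indicator {-d<..<d} x *\<^sub>R h x) = (LINT x|lborel. Re (indicator {-d<..<d} x *\<^sub>R h x))"
    by (rule integral_Re[OF hi, symmetric])
  also have "\<dots> = 2 * d * V n"
    using integral_cosine_series_cos[OF d V, of n] by (simp add: h_def)
  finally show "gamma d f n = V n" using d by simp
qed

section \<open>Trigonometric polynomials in the domain of the operator\<close>

lemma ell1_add: "ell1 U \<Longrightarrow> ell1 V \<Longrightarrow> ell1 (\<lambda>n. U n + V n)"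
  unfolding ell1_def
  by (rule summable_comparison_test'[where g = "\<lambda>n. \<bar>U n\<bar> + \<bar>V n\<bar>"]) (auto intro: summable_add)

lemma ell1_cmult: "ell1 V \<Longrightarrow> ell1 (\<lambda>n. c * V n)"
  unfolding ell1_def abs_mult by (rule summable_mult)

lemma ell1_minus: "ell1 V \<Longrightarrow> ell1 (\<lambda>n. - V n)"
  by (simp add: ell1_def)

lemma ell1_diff: "ell1 U \<Longrightarrow> ell1 V \<Longrightarrow> ell1 (\<lambda>n. U n - V n)"
  using ell1_add[OF _ ell1_minus] by simp

lemma cosine_series_add:
  "ell1 U \<Longrightarrow> ell1 V \<Longrightarrow> cosine_series (\<lambda>n. U n + V n) \<theta> = cosine_series U \<theta> + cosine_series V \<theta>"
  using sums_unique[OF sums_add[OF ell1_cosine_series_sums[of U \<theta>] ell1_cosine_series_sums[of V \<theta>]]]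
  by (simp add: cosine_series_def algebra_simps)

lemma cosine_series_cmult:
  "ell1 V \<Longrightarrow> cosine_series (\<lambda>n. c * V n) \<theta> = c * cosine_series V \<theta>"
  using sums_unique[OF sums_mult[OF ell1_cosine_series_sums[of V \<theta>], of c]]
  by (simp add: cosine_series_def algebra_simps)

lemma cosine_series_diff:
  "ell1 U \<Longrightarrow> ell1 V \<Longrightarrow> cosine_series (\<lambda>n. U n - V n) \<theta> = cosine_series U \<theta> - cosine_series V \<theta>"
  using cosine_series_add[OF _ ell1_cmult[of V "- 1"], of U \<theta>] cosine_series_cmult[of V "- 1" \<theta>] by simp

lemmas ell1_intros = ell1_add ell1_cmult ell1_diff ell1_conv ell1_e0
lemmas cosine_series_simps = cosine_series_add cosine_series_cmult cosine_series_diff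
  cosine_series_conv cosine_series_e0 ell1_intros

lemma gamma_dag_even: "gamma_dag d V (- x) = gamma_dag d V x"
  by (auto simp: gamma_dag_eq cosine_series_def indicator_def)

lemma gamma_dag_measurable [measurable]: "gamma_dag d V \<in> borel_measurable borel"
  unfolding gamma_dag_eq[abs_def] by measurable

lemma bounded_integrable_gamma_dag:
  assumes "ell1 V"
  shows "bounded_integrable (\<lambda>x. of_real (gamma_dag d V x))"
proof -
  have "integrable lborel (\<lambda>x. indicator {-d<..<d} x *\<^sub>R cosine_series V (pi * x / d))"
    using cosine_series_bound[OF assms] by (intro integrable_indicator_bounded) auto
  moreover have "norm (complex_of_real (gamma_dag d V x)) \<le> (\<Sum>n. alpha n * \<bar>V n\<bar>)" for x
    using cosine_series_bound[OF assms, of "pi * x / d"]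
    by (auto simp: gamma_dag_eq indicator_def abs_mult)
  moreover have "(\<lambda>x. indicator {-d<..<d} x *\<^sub>R cosine_series V (pi * x / d)) = gamma_dag d V"
    by (simp add: gamma_dag_eq[abs_def])
  ultimately show ?thesis
    unfolding bounded_integrable_def by auto
qed

lemma Gamma2_dag_nth:
  "Gamma2_dag d W x $ 1 = gamma_dag d (comp 1 W) x" "Gamma2_dag d W x $ 2 = gamma_dag d (comp 2 W) x"
  by (simp_all add: Gamma2_dag_def)

lemma Gamma2_dag_even: "ae_even (Gamma2_dag d W)"
  by (simp add: ae_even_def Gamma2_dag_def gamma_dag_even)

lemma Gamma2_dag_L2: "ell1 (comp 1 W) \<Longrightarrow> ell1 (comp 2 W) \<Longrightarrow> Gamma2_dag d W \<in> L2"
  by (rule L2I_bounded_integrable) (simp_all add: Gamma2_dag_nth bounded_integrable_gamma_dag)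

lemma norm_L2_Gamma2_dag:
  assumes d: "d > 0" and W: "ell1 (comp 1 W)" "ell1 (comp 2 W)"
  shows "norm_L2 (Gamma2_dag d W) = sqrt (2 * d) * pair_norm2 W"
proof -
  have sq: "(gamma_dag d V x)\<^sup>2 = indicator {-d<..<d} x * (cosine_series V (pi * x / d))\<^sup>2" for V x
    by (auto simp: gamma_dag_eq indicator_def)
  have int: "integrable lborel (\<lambda>x. (gamma_dag d V x)\<^sup>2)" if "ell1 V" for V
  proof -
    have "integrable lborel (\<lambda>x. indicator {-d<..<d} x *\<^sub>R cosine_series (V \<star> V) (pi * x / d))"
      using cosine_series_bound[OF ell1_conv[OF that that]]
      by (intro integrable_indicator_bounded) auto
    then show ?thesis unfolding sq by (simp add: cosine_series_conv[OF that that] power2_eq_square)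
  qed
  have p: "(LINT x|lborel. (gamma_dag d V x)\<^sup>2) = 2 * d * (seq_norm 2 V)\<^sup>2" if "ell1 V" for V
    unfolding sq by (rule parseval(1)[OF d that])
  have "(LINT x|lborel. (norm (Gamma2_dag d W x))\<^sup>2)
      = (LINT x|lborel. (gamma_dag d (comp 1 W) x)\<^sup>2 + (gamma_dag d (comp 2 W) x)\<^sup>2)"
    by (simp add: norm_vector2 Gamma2_dag_nth)
  also have "\<dots> = 2 * d * ((seq_norm 2 (comp 1 W))\<^sup>2 + (seq_norm 2 (comp 2 W))\<^sup>2)"
    using W by (simp add: int p algebra_simps)
  finally show ?thesis
    by (simp add: norm_L2_def pair_norm2_def real_sqrt_mult)
qed

lemma gamma_dag_boundary:
  assumes d: "d > 0" and V: "\<And>n. n > M \<Longrightarrow> V n = 0"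
    and lim: "(gamma_dag d V \<longlongrightarrow> 0) (at_left d)"
  shows "cosine_series V pi = 0"
proof -
  have "continuous (at_left d) (\<lambda>x. cosine_series V (pi * x / d))"
    unfolding cosine_series_finite[of M V, OF V, simplified]
    using d by (intro continuous_intros) auto
  then have "((\<lambda>x. cosine_series V (pi * x / d)) \<longlongrightarrow> cosine_series V pi) (at_left d)"
    using d by (simp add: continuous_within)
  moreover have "\<forall>\<^sub>F x in at_left d. cosine_series V (pi * x / d) = gamma_dag d V x"
  proof -
    have "\<forall>\<^sub>F x in at_left d. x \<in> {-d<..<d}"
      using d by (intro eventually_at_leftI[of "- d"]) auto
    then show ?thesis by eventually_elim (simp add: gamma_dag_eq)
  qed
  ultimately have "(gamma_dag d V \<longlongrightarrow> cosine_series V pi) (at_left d)"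
    by (rule Lim_transform_eventually)
  then show ?thesis
    using lim by (intro tendsto_unique[OF _ _ lim]) (simp_all add: trivial_limit_at_left_real)
qed

text \<open>Cutting the polynomial off outside \<open>(-d, d)\<close> creates no singular part in its second derivative:
its values at the end points vanish by assumption, and its slopes vanish because
\<open>sin (n \<pi>) = 0\<close>.\<close>

lemma gamma_dag_weak_laplacian:
  assumes d: "d > 0" and V: "\<And>n. n > M \<Longrightarrow> V n = 0" and b: "cosine_series V pi = 0"
    and t: "test_fun \<phi>"
  shows "(LINT x|lborel. gamma_dag d V x * deriv (deriv \<phi>) x)
       = (LINT x|lborel. gamma_dag d (\<lambda>n. - (2 * pi * freq d n)\<^sup>2 * V n) x * \<phi> x)"
proof -
  define V2 where "V2 = (\<lambda>n. - (2 * pi * freq d n)\<^sup>2 * V n)"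
  have V2: "\<And>n. n > M \<Longrightarrow> V2 n = 0" by (simp add: V2_def V)
  have eV: "ell1 V" and eV2: "ell1 V2" using V V2 by (auto intro: ell1_support)
  define f where "f = (\<lambda>x. cosine_series V (pi * x / d))"
  define f1 where "f1 = (\<lambda>x. \<Sum>n\<le>M. alpha n * V n * (- sin (real n * (pi * x / d)) * (real n * pi / d)))"
  define f2 where "f2 = (\<lambda>x. cosine_series V2 (pi * x / d))"
  have f: "f = (\<lambda>x. \<Sum>n\<le>M. alpha n * V n * cos (real n * (pi * x / d)))"
    unfolding f_def by (subst cosine_series_finite[OF V]) auto
  have f2: "f2 = (\<lambda>x. \<Sum>n\<le>M. alpha n * V2 n * cos (real n * (pi * x / d)))"
    unfolding f2_def by (subst cosine_series_finite[OF V2]) auto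
  have df: "(f has_real_derivative f1 x) (at x)" for x
    unfolding f f1_def using d by (auto intro!: derivative_eq_intros sum.cong)
  have df1: "(f1 has_real_derivative f2 x) (at x)" for x
    unfolding f1_def f2 using d
    by (auto intro!: derivative_eq_intros sum.cong simp: V2_def freq_def power2_eq_square)
  have cf: "continuous_on S f" and cf1: "continuous_on S f1" and cf2: "continuous_on S f2" for S
    unfolding f f1_def f2 using d by (auto intro!: continuous_intros)
  have bd: "f d = 0" "f (- d) = 0"
  proof -
    show "f d = 0" using b d by (simp add: f_def)
    have "f (- d) = cosine_series V (- pi)" using d by (simp add: f_def)
    then show "f (- d) = 0" using b by (simp add: cosine_series_def)
  qed
  have bd1: "f1 d = 0" "f1 (- d) = 0"
    using d by (auto simp: f1_def intro!: sum.neutral)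
  \<comment> \<open>an antiderivative of \<open>f \<phi>'' - f'' \<phi>\<close>\<close>
  define F where "F = (\<lambda>x. f x * deriv \<phi> x - f1 x * \<phi> x)"
  have dF: "(F has_real_derivative f x * deriv (deriv \<phi>) x - f2 x * \<phi> x) (at x)" for x
    unfolding F_def using df[of x] df1[of x] test_fun_DERIV[OF t, of x] test_fun_DERIV[OF test_fun_deriv[OF t], of x]
    by (auto intro!: derivative_eq_intros simp: algebra_simps)
  have cont: "continuous_on S (\<lambda>x. f x * deriv (deriv \<phi>) x - f2 x * \<phi> x)" for S
    by (intro continuous_on_diff continuous_on_mult cf cf2 test_fun_continuous[OF t]
        test_fun_continuous[OF test_fun_deriv[OF test_fun_deriv[OF t]]])
  have "(LINT x|lborel. indicator {-d..d} x *\<^sub>R (f x * deriv (deriv \<phi>) x - f2 x * \<phi> x)) = F d - F (- d)"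
  proof (rule integral_FTC_atLeastAtMost[OF _ _ cont])
    show "- d \<le> d" using d by simp
    show "(F has_vector_derivative f x * deriv (deriv \<phi>) x - f2 x * \<phi> x) (at x within {- d..d})" for x
      using dF[of x] by (simp add: has_real_derivative_iff_has_vector_derivative has_vector_derivative_at_within)
  qed
  also have "\<dots> = 0" by (simp add: F_def bd bd1)
  also have "(LINT x|lborel. indicator {-d..d} x *\<^sub>R (f x * deriv (deriv \<phi>) x - f2 x * \<phi> x))
    = (LINT x|lborel. indicator {-d<..<d} x *\<^sub>R (f x * deriv (deriv \<phi>) x - f2 x * \<phi> x))"
    by (rule integral_Ioo_eq_Icc[symmetric])
       (rule borel_measurable_continuous_onI[OF cont])
  also have "\<dots> = (LINT x|lborel. gamma_dag d V x * deriv (deriv \<phi>) x - gamma_dag d V2 x * \<phi> x)"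
    by (rule Bochner_Integration.integral_cong) (auto simp: gamma_dag_eq f_def f2_def indicator_def)
  also have "\<dots> = (LINT x|lborel. gamma_dag d V x * deriv (deriv \<phi>) x) - (LINT x|lborel. gamma_dag d V2 x * \<phi> x)"
  proof (rule Bochner_Integration.integral_diff)
    show "integrable lborel (\<lambda>x. gamma_dag d V x * deriv (deriv \<phi>) x)"
      using Bochner_Integration.integrable_Re[OF bounded_integrable_times_test_fun[OF bounded_integrable_gamma_dag[OF eV] test_fun_deriv[OF test_fun_deriv[OF t]]]]
      by simp
    show "integrable lborel (\<lambda>x. gamma_dag d V2 x * \<phi> x)"
      using Bochner_Integration.integrable_Re[OF bounded_integrable_times_test_fun[OF bounded_integrable_gamma_dag[OF eV2] t]]
      by simp
  qed
  finally show ?thesis by (simp add: V2_def)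
qed

lemma gamma_dag_linear:
  assumes "ell1 U" "ell1 V" "ell1 W"
  shows "gamma_dag d (\<lambda>n. a * U n + (b * V n + c * W n)) x
    = a * gamma_dag d U x + (b * gamma_dag d V x + c * gamma_dag d W x)"
  unfolding gamma_dag_eq using assms by (simp add: cosine_series_simps algebra_simps)

lemma Lseq_nth:
  "comp 1 (Lseq p d U) = (\<lambda>n. nu p * (- (2 * pi * freq d n)\<^sup>2 * comp 1 U n)
      + ((lam6 p - 1) * comp 1 U n + lam7 p * comp 2 U n))"
  "comp 2 (Lseq p d U) = (\<lambda>n. 1 * (- (2 * pi * freq d n)\<^sup>2 * comp 2 U n)
      + (lam5 p * comp 1 U n + (- nu3 p) * comp 2 U n))"
  by (simp_all add: comp_def Lseq_def symb_def fun_eq_iff matrix_vector_mult_def sum_2 algebra_simps power_mult_distrib)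

lemma gamma_dag_weak_LL:
  assumes d: "d > 0" and U: "\<And>n. n > M \<Longrightarrow> U n = 0"
    and b: "cosine_series (comp 1 U) pi = 0" "cosine_series (comp 2 U) pi = 0"
  shows "weak_LL p (Gamma2_dag d U) (Gamma2_dag d (Lseq p d U))"
  unfolding weak_LL_def
proof (intro allI impI)
  fix \<phi> assume t: "test_fun \<phi>"
  have s: "\<And>n. n > M \<Longrightarrow> comp i U n = 0" for i using U by (simp add: comp_def)
  define D where "D = (\<lambda>i n. - (2 * pi * freq d n)\<^sup>2 * comp i U n)"
  have e: "ell1 (comp i U)" "ell1 (D i)" for i
    using s by (auto intro!: ell1_support[of M] simp: D_def)
  let ?I = "\<lambda>V \<phi>. LINT x|lborel. gamma_dag d V x * \<phi> x"
  have i: "integrable lborel (\<lambda>x. gamma_dag d V x * \<psi> x)" if "ell1 V" "test_fun \<psi>" for V \<psi>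
    using Bochner_Integration.integrable_Re[OF bounded_integrable_times_test_fun[OF bounded_integrable_gamma_dag[OF that(1)] that(2)]]
    by simp
  note i0 = i[OF e(1) t] i[OF e(2) t] i[OF e(1) test_fun_deriv[OF test_fun_deriv[OF t]]]
  have lap: "?I (D 1) \<phi> = ?I (comp 1 U) (deriv (deriv \<phi>))" "?I (D 2) \<phi> = ?I (comp 2 U) (deriv (deriv \<phi>))"
    using gamma_dag_weak_laplacian[OF d s b(1) t] gamma_dag_weak_laplacian[OF d s b(2) t] by (simp_all only: D_def)
  have g1: "gamma_dag d (comp 1 (Lseq p d U)) x = nu p * gamma_dag d (D 1) x
      + ((lam6 p - 1) * gamma_dag d (comp 1 U) x + lam7 p * gamma_dag d (comp 2 U) x)" for x
    using gamma_dag_linear[OF e(2) e(1) e(1)] by (simp only: Lseq_nth D_def)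
  have g2: "gamma_dag d (comp 2 (Lseq p d U)) x = gamma_dag d (D 2) x
      + (lam5 p * gamma_dag d (comp 1 U) x - nu3 p * gamma_dag d (comp 2 U) x)" for x
    using gamma_dag_linear[OF e(2) e(1) e(1), of d 1 2 "lam5 p" 1 "- nu3 p" 2 x] by (simp only: Lseq_nth D_def)
  have "(LINT x|lborel. Gamma2_dag d (Lseq p d U) x $ 1 * \<phi> x)
     = (LINT x|lborel. nu p * (gamma_dag d (D 1) x * \<phi> x)
         + ((lam6 p - 1) * (gamma_dag d (comp 1 U) x * \<phi> x) + lam7 p * (gamma_dag d (comp 2 U) x * \<phi> x)))"
    unfolding Gamma2_dag_nth g1 by (rule Bochner_Integration.integral_cong) (simp_all only: algebra_simps)
  also have "\<dots> = nu p * ?I (D 1) \<phi> + ((lam6 p - 1) * ?I (comp 1 U) \<phi> + lam7 p * ?I (comp 2 U) \<phi>)"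
    using i0 by simp
  also have "\<dots> = (LINT x|lborel. nu p * (gamma_dag d (comp 1 U) x * deriv (deriv \<phi>) x)
         + ((lam6 p - 1) * (gamma_dag d (comp 1 U) x * \<phi> x) + lam7 p * (gamma_dag d (comp 2 U) x * \<phi> x)))"
    unfolding lap using i0 by simp
  finally have 1: "(LINT x|lborel. Gamma2_dag d (Lseq p d U) x $ 1 * \<phi> x) =
    (LINT x|lborel. nu p * (gamma_dag d (comp 1 U) x * deriv (deriv \<phi>) x)
         + ((lam6 p - 1) * (gamma_dag d (comp 1 U) x * \<phi> x) + lam7 p * (gamma_dag d (comp 2 U) x * \<phi> x)))" .
  have "(LINT x|lborel. Gamma2_dag d (Lseq p d U) x $ 2 * \<phi> x)
     = (LINT x|lborel. gamma_dag d (D 2) x * \<phi> x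
         + (lam5 p * (gamma_dag d (comp 1 U) x * \<phi> x) - nu3 p * (gamma_dag d (comp 2 U) x * \<phi> x)))"
    unfolding Gamma2_dag_nth g2 by (rule Bochner_Integration.integral_cong) (simp_all only: algebra_simps)
  also have "\<dots> = ?I (D 2) \<phi> + (lam5 p * ?I (comp 1 U) \<phi> - nu3 p * ?I (comp 2 U) \<phi>)"
    using i0 by simp
  also have "\<dots> = (LINT x|lborel. gamma_dag d (comp 2 U) x * deriv (deriv \<phi>) x
         + (lam5 p * (gamma_dag d (comp 1 U) x * \<phi> x) - nu3 p * (gamma_dag d (comp 2 U) x * \<phi> x)))"
    unfolding lap using i0 by simp
  finally have 2: "(LINT x|lborel. Gamma2_dag d (Lseq p d U) x $ 2 * \<phi> x) =
    (LINT x|lborel. gamma_dag d (comp 2 U) x * deriv (deriv \<phi>) x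
         + (lam5 p * (gamma_dag d (comp 1 U) x * \<phi> x) - nu3 p * (gamma_dag d (comp 2 U) x * \<phi> x)))" .
  show "(LINT x|lborel. Gamma2_dag d (Lseq p d U) x $ 1 * \<phi> x) =
      (LINT x|lborel. nu p * Gamma2_dag d U x $ 1 * deriv (deriv \<phi>) x
          + ((lam6 p - 1) * Gamma2_dag d U x $ 1 + lam7 p * Gamma2_dag d U x $ 2) * \<phi> x) \<and>
    (LINT x|lborel. Gamma2_dag d (Lseq p d U) x $ 2 * \<phi> x) =
      (LINT x|lborel. Gamma2_dag d U x $ 2 * deriv (deriv \<phi>) x
          + (lam5 p * Gamma2_dag d U x $ 1 - nu3 p * Gamma2_dag d U x $ 2) * \<phi> x)"
    unfolding 1 2 unfolding Gamma2_dag_nth by (simp add: algebra_simps)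
qed

section \<open>The rational nonlinearity as a cosine series\<close>

lemma conv_support:
  assumes "\<And>n. n > a \<Longrightarrow> U n = 0" "\<And>n. n > b \<Longrightarrow> V n = 0" "n > a + b"
  shows "(U \<star> V) n = 0"
proof -
  have "U (nat \<bar>int n - k\<bar>) * V (nat \<bar>k\<bar>) = 0" for k :: int
  proof (cases "nat \<bar>k\<bar> > b")
    case False
    then have "nat \<bar>int n - k\<bar> > a" using assms(3) by linarith
    then show ?thesis using assms(1) by simp
  qed (simp add: assms(2))
  then show ?thesis unfolding conv_def by (intro infsum_0)
qed

lemma Psi_support:
  assumes "\<And>n. n > M \<Longrightarrow> U n = 0" "n > 2 * M"
  shows "Psi p U n = 0"
proof -
  have c: "\<And>n. n > M \<Longrightarrow> comp i U n = 0" for i using assms(1) by (simp add: comp_def)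
  have "(comp i U \<star> comp j U) n = 0" for i j
    using conv_support[of M "comp i U" M "comp j U" n] c assms(2) by simp
  then show ?thesis using assms by (simp add: Psi_def)
qed

lemma cosine_series_Psi:
  assumes "ell1 (comp 1 U)" "ell1 (comp 2 U)"
  shows "ell1 (Psi p U)"
    and "cosine_series (Psi p U) \<theta> = lam3 p * (cosine_series (comp 1 U) \<theta>)\<^sup>2 + lam4 p * cosine_series (comp 1 U) \<theta>
      - nu1 p * cosine_series (comp 1 U) \<theta> * cosine_series (comp 2 U) \<theta> - nu1 p * lam1 p * cosine_series (comp 2 U) \<theta>"
proof -
  have P: "Psi p U = (\<lambda>n. lam3 p * (comp 1 U \<star> comp 1 U) n + lam4 p * comp 1 U n
     - nu1 p * (comp 1 U \<star> comp 2 U) n - (nu1 p * lam1 p) * comp 2 U n)"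
    by (simp add: Psi_def comp_def)
  show "ell1 (Psi p U)" unfolding P by (intro ell1_intros assms)
  show "cosine_series (Psi p U) \<theta> = lam3 p * (cosine_series (comp 1 U) \<theta>)\<^sup>2 + lam4 p * cosine_series (comp 1 U) \<theta>
      - nu1 p * cosine_series (comp 1 U) \<theta> * cosine_series (comp 2 U) \<theta> - nu1 p * lam1 p * cosine_series (comp 2 U) \<theta>"
    unfolding P by (simp add: cosine_series_simps assms power2_eq_square)
qed

lemma cosine_series_Phi:
  assumes "ell1 (comp 1 U)"
  shows "ell1 (Phi p U)"
    and "cosine_series (Phi p U) \<theta> = 1 + cosine_series (comp 1 U) \<theta> + lam1 p
      + nu2 p * (cosine_series (comp 1 U) \<theta> + lam1 p)\<^sup>2"
proof -
  have P: "Phi p U = (\<lambda>n. (1 + lam1 p) * e0 n + comp 1 U n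
     + nu2 p * ((\<lambda>k. comp 1 U k + lam1 p * e0 k) \<star> (\<lambda>k. comp 1 U k + lam1 p * e0 k)) n)"
    by (simp add: Phi_def comp_def)
  show "ell1 (Phi p U)" unfolding P by (intro ell1_intros assms)
  show "cosine_series (Phi p U) \<theta> = 1 + cosine_series (comp 1 U) \<theta> + lam1 p
      + nu2 p * (cosine_series (comp 1 U) \<theta> + lam1 p)\<^sup>2"
    unfolding P by (simp add: cosine_series_simps assms power2_eq_square)
qed

lemma residual_cosine_series:
  assumes "ell1 (comp 1 U)" "ell1 q"
  shows "ell1 (residual p q U)"
    and "cosine_series (residual p q U) \<theta> = 1 - cosine_series (Phi p U) \<theta> * cosine_series q \<theta>"
  unfolding residual_def using cosine_series_Phi(1)[OF assms(1)] assms
  by (auto simp: cosine_series_simps)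

text \<open>The identity \<open>1 - C(r) = C(\<Phi>) C(q)\<close> shows that \<open>C(\<Phi>)\<close> has no zeros and that the Neumann sum
\<open>S\<close> of \<open>r\<close> makes \<open>\<Psi> \<star> q \<star> S\<close> represent the quotient. It also gives the pointwise
error of \<open>\<Psi> \<star> q\<close>, in which \<open>C(q) C(r) = C(q \<star> r)\<close> and \<open>C(r)\<close> are bounded by \<open>\<ell>\<^sup>1\<close> norms.\<close>

lemma quotient_cosine_series:
  assumes U: "ell1 (comp 1 U)" "ell1 (comp 2 U)" and q: "ell1 q"
    and r: "l1_norm (residual p q U) < 1"
  obtains Q where "ell1 Q"
    "\<And>\<theta>. cosine_series Q \<theta> = cosine_series (Psi p U) \<theta> / cosine_series (Phi p U) \<theta>"
    "\<And>\<theta>. \<bar>cosine_series (Psi p U \<star> q) \<theta> - cosine_series Q \<theta>\<bar>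
       \<le> l1_norm (q \<star> residual p q U) / (1 - l1_norm (residual p q U)) * \<bar>cosine_series (Psi p U) \<theta>\<bar>"
proof -
  note psi = cosine_series_Psi[OF U, of p] and res = residual_cosine_series[OF U(1) q, of p]
  obtain S where S: "ell1 S" "\<And>\<theta>. cosine_series S \<theta> = 1 / (1 - cosine_series (residual p q U) \<theta>)"
    using neumann_series[OF res(1) r] by blast
  define Q where "Q = Psi p U \<star> q \<star> S"
  show thesis
  proof (rule that[of Q])
    show "ell1 Q" unfolding Q_def by (intro ell1_conv psi q S)
    fix \<theta>
    define R a where "R = cosine_series (residual p q U) \<theta>" and "a = cosine_series q \<theta>"
    have R: "\<bar>R\<bar> \<le> l1_norm (residual p q U)"
      unfolding R_def l1_norm_def by (rule cosine_series_bound[OF res(1)])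
    have R1: "1 - R > 0" using R r by linarith
    have Rq: "1 - R = cosine_series (Phi p U) \<theta> * a" by (simp add: R_def a_def res(2))
    have a0: "a \<noteq> 0" and "cosine_series (Phi p U) \<theta> \<noteq> 0" using R1 Rq by auto
    have Q: "cosine_series Q \<theta> = cosine_series (Psi p U) \<theta> * a / (1 - R)"
      by (simp add: Q_def cosine_series_conv ell1_conv psi(1) q S R_def a_def)
    then show "cosine_series Q \<theta> = cosine_series (Psi p U) \<theta> / cosine_series (Phi p U) \<theta>"
      unfolding Rq using a0 by simp
    have diff: "cosine_series (Psi p U \<star> q) \<theta> - cosine_series Q \<theta>
        = - (cosine_series (Psi p U) \<theta> * ((a * R) / (1 - R)))"
      unfolding Q using R1 by (simp add: cosine_series_conv psi(1) q a_def[symmetric] field_simps)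
    have "\<bar>(a * R) / (1 - R)\<bar> \<le> l1_norm (q \<star> residual p q U) / (1 - l1_norm (residual p q U))"
    proof -
      have "\<bar>a * R\<bar> \<le> l1_norm (q \<star> residual p q U)"
        using cosine_series_bound[OF ell1_conv[OF q res(1)], of \<theta>]
        by (simp add: cosine_series_conv q res(1) a_def R_def l1_norm_def)
      then have "\<bar>a * R\<bar> / (1 - R) \<le> l1_norm (q \<star> residual p q U) / (1 - l1_norm (residual p q U))"
        using R r by (intro frac_le) auto
      then show ?thesis using R1 by (simp add: abs_divide)
    qed
    from mult_right_mono[OF this, of "\<bar>cosine_series (Psi p U) \<theta>\<bar>"]
    show "\<bar>cosine_series (Psi p U \<star> q) \<theta> - cosine_series Q \<theta>\<bar>
       \<le> l1_norm (q \<star> residual p q U) / (1 - l1_norm (residual p q U)) * \<bar>cosine_series (Psi p U) \<theta>\<bar>"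
      unfolding diff abs_minus_cancel abs_mult by (simp only: mult.commute abs_ge_zero)
  qed
qed

text \<open>By Parseval on \<open>(-1, 1)\<close>, pointwise domination of the functions implies domination of the
norms in \<open>\<ell>\<^sup>2\<close>.\<close>

lemma seq_norm_2_le_of_cosine_series:
  assumes A: "ell1 A" and B: "ell1 B" and k: "k \<ge> 0"
    and le: "\<And>\<theta>. \<bar>cosine_series A \<theta>\<bar> \<le> k * \<bar>cosine_series B \<theta>\<bar>"
  shows "seq_norm 2 A \<le> k * seq_norm 2 B"
proof -
  have int: "integrable lborel (\<lambda>x. indicator {-1<..<1} x * (cosine_series V (pi * x / 1))\<^sup>2)" if "ell1 V" for V
  proof -
    have "integrable lborel (\<lambda>x. indicator {-1<..<1} x *\<^sub>R cosine_series (V \<star> V) (pi * x / 1))"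
      using cosine_series_bound[OF ell1_conv[OF that that]]
      by (intro integrable_indicator_bounded) auto
    then show ?thesis by (simp add: cosine_series_conv[OF that that] power2_eq_square)
  qed
  have "(LINT x|lborel. indicator {-1<..<1} x * (cosine_series A (pi * x / 1))\<^sup>2)
     \<le> (LINT x|lborel. k\<^sup>2 * (indicator {-1<..<1} x * (cosine_series B (pi * x / 1))\<^sup>2))"
  proof (rule integral_mono)
    fix x :: real
    have "(cosine_series A (pi * x / 1))\<^sup>2 \<le> (k * \<bar>cosine_series B (pi * x / 1)\<bar>)\<^sup>2"
      using le[of "pi * x / 1"] by (metis abs_ge_zero power2_abs power_mono)
    then show "indicator {-1<..<1} x * (cosine_series A (pi * x / 1))\<^sup>2
       \<le> k\<^sup>2 * (indicator {-1<..<1} x * (cosine_series B (pi * x / 1))\<^sup>2)"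
      by (auto simp: indicator_def power_mult_distrib)
  qed (intro int A B integrable_mult_right)+
  then have *: "(seq_norm 2 A)\<^sup>2 \<le> (k * seq_norm 2 B)\<^sup>2"
    using parseval(1)[of 1 A] parseval(1)[of 1 B] A B by (simp add: power_mult_distrib)
  have "seq_norm 2 B \<ge> 0" by (simp add: seq_norm_def)
  with k have "0 \<le> k * seq_norm 2 B" by (rule mult_nonneg_nonneg)
  with * show ?thesis by (rule power2_le_imp_le)
qed

section \<open>The weighted norm of pairs\<close>

lemma ell2_e_I: "ell1 (comp 1 W) \<Longrightarrow> ell1 (comp 2 W) \<Longrightarrow> W \<in> ell2_e"
  using parseval(2)[of 1] by (auto simp: ell2_e_def)

lemma pair_norm2_sums:
  assumes "W \<in> ell2_e"
  shows "(\<lambda>n. alpha n * (norm (W n))\<^sup>2) sums (pair_norm2 W)\<^sup>2"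
proof -
  have s: "(\<lambda>n. alpha n * (comp i W n)\<^sup>2) sums (seq_norm 2 (comp i W))\<^sup>2" if "comp i W \<in> ell 2" for i
  proof -
    have s: "summable (\<lambda>n. alpha n * (comp i W n)\<^sup>2)"
      using that by (simp add: ell_def)
    then have "0 \<le> (\<Sum>n. alpha n * (comp i W n)\<^sup>2)"
      by (rule suminf_nonneg) (simp add: less_imp_le alpha_pos)
    then show ?thesis using s
      by (simp add: seq_norm_def powr_half_sqrt summable_sums)
  qed
  have "(\<lambda>n. alpha n * (comp 1 W n)\<^sup>2 + alpha n * (comp 2 W n)\<^sup>2) sums
     ((seq_norm 2 (comp 1 W))\<^sup>2 + (seq_norm 2 (comp 2 W))\<^sup>2)"
    using assms by (intro sums_add s) (auto simp: ell2_e_def)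
  then show ?thesis
    by (simp add: pair_norm2_def norm_vector2 comp_def algebra_simps)
qed

lemma pair_norm2_nonneg: "pair_norm2 W \<ge> 0"
  by (simp add: pair_norm2_def)

lemma pair_norm2_cong_norm:
  assumes "V \<in> ell2_e" "W \<in> ell2_e" "\<And>n. norm (V n) = norm (W n)"
  shows "pair_norm2 V = pair_norm2 W"
proof -
  have "(pair_norm2 V)\<^sup>2 = (pair_norm2 W)\<^sup>2"
    using sums_unique2[OF pair_norm2_sums[OF assms(1)]] pair_norm2_sums[OF assms(2)] assms(3) by simp
  then show ?thesis using pair_norm2_nonneg by (metis power2_eq_iff_nonneg)
qed

text \<open>The triangle inequality for finite sums, in the limit. It is stated with a majorization of
norms, which is the form in which it is applied to a sum of sequences.\<close>

lemma pair_norm2_triangle: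
  assumes V: "V \<in> ell2_e" and W: "W \<in> ell2_e" and X: "X \<in> ell2_e" and le: "\<And>n. norm (X n) \<le> norm (V n) + norm (W n)"
  shows "pair_norm2 X \<le> pair_norm2 V + pair_norm2 W"
proof -
  define f where "f = (\<lambda>Z::nat\<Rightarrow>real^2. \<lambda>n. sqrt (alpha n) * norm (Z n))"
  have f2: "(f Z n)\<^sup>2 = alpha n * (norm (Z n))\<^sup>2" for Z n
    by (simp add: f_def power_mult_distrib less_imp_le alpha_pos)
  have lim: "(\<lambda>m. L2_set (f Z) {..<m}) \<longlonglongrightarrow> pair_norm2 Z" if "Z \<in> ell2_e" for Z
  proof -
    have "(\<lambda>m. sqrt (\<Sum>n<m. alpha n * (norm (Z n))\<^sup>2)) \<longlonglongrightarrow> sqrt ((pair_norm2 Z)\<^sup>2)"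
      using pair_norm2_sums[OF that] unfolding sums_def by (rule tendsto_real_sqrt)
    then show ?thesis using pair_norm2_nonneg[of Z] by (simp add: L2_set_def f2)
  qed
  show ?thesis
  proof (rule tendsto_le[OF _ tendsto_add[OF lim[OF V] lim[OF W]] lim[OF X]])
    have "L2_set (f X) {..<m} \<le> L2_set (f V) {..<m} + L2_set (f W) {..<m}" for m
    proof -
      have "L2_set (f X) {..<m} \<le> L2_set (\<lambda>n. f V n + f W n) {..<m}"
      proof (rule L2_set_mono)
        show "f X n \<le> f V n + f W n" for n
          using mult_left_mono[OF le[of n], of "sqrt (alpha n)"]
          by (simp add: f_def distrib_left less_imp_le alpha_pos)
      qed (simp add: f_def less_imp_le alpha_pos)
      also have "\<dots> \<le> L2_set (f V) {..<m} + L2_set (f W) {..<m}"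
        by (rule L2_set_triangle_ineq)
      finally show ?thesis .
    qed
    then show "\<forall>\<^sub>F m in sequentially. L2_set (f X) {..<m} \<le> L2_set (f V) {..<m} + L2_set (f W) {..<m}"
      by simp
  qed simp
qed

lemma pair_norm2_split:
  assumes "V \<in> ell2_e" "W \<in> ell2_e" "X \<in> ell2_e"
    and "\<And>n. (norm (X n))\<^sup>2 = (norm (V n))\<^sup>2 + (norm (W n))\<^sup>2"
  shows "(pair_norm2 X)\<^sup>2 = (pair_norm2 V)\<^sup>2 + (pair_norm2 W)\<^sup>2"
proof (rule sums_unique2[OF pair_norm2_sums[OF assms(3)]])
  show "(\<lambda>n. alpha n * (norm (X n))\<^sup>2) sums ((pair_norm2 V)\<^sup>2 + (pair_norm2 W)\<^sup>2)"
    using sums_add[OF pair_norm2_sums[OF assms(1)] pair_norm2_sums[OF assms(2)]]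
    by (simp add: assms(4) distrib_left)
qed

lemma ell2_e_finite: "(\<And>n. n > M \<Longrightarrow> W n = 0) \<Longrightarrow> W \<in> ell2_e"
  by (intro ell2_e_I ell1_support[of M]) (simp_all add: comp_def)

lemma ell2_e_mono:
  assumes "W \<in> ell2_e" "\<And>n i. \<bar>V n $ i\<bar> \<le> \<bar>W n $ i\<bar>"
  shows "V \<in> ell2_e"
proof -
  have "comp i V \<in> ell 2" if "comp i W \<in> ell 2" for i
  proof -
    have s: "summable (\<lambda>n. alpha n * \<bar>comp i W n\<bar> powr 2)" using that by (simp add: ell_def)
    have "summable (\<lambda>n. alpha n * \<bar>comp i V n\<bar> powr 2)"
    proof (rule summable_comparison_test'[OF s])
      show "norm (alpha n * \<bar>comp i V n\<bar> powr 2) \<le> alpha n * \<bar>comp i W n\<bar> powr 2" for n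
        using assms(2)[of n i] alpha_pos[of n]
        by (simp add: comp_def abs_mult mult_left_mono abs_le_square_iff)
    qed
    then show ?thesis by (simp add: ell_def)
  qed
  then show ?thesis using assms(1) by (simp add: ell2_e_def)
qed

section \<open>The approximate inverse on sequences\<close>

lemma BN_nth:
  "BN N b11 b12 W n $ 1 = (if n \<le> N then (\<Sum>k\<le>N. b11 n k * W k $ 1) + (\<Sum>k\<le>N. b12 n k * W k $ 2) else 0)"
  "BN N b11 b12 W n $ 2 = (if n \<le> N then W n $ 2 else 0)"
  by (simp_all add: BN_def pair_def fin_mat_def Pi_le_def comp_def)

lemma BN_gt: "n > N \<Longrightarrow> BN N b11 b12 W n = 0"
  by (simp add: vec_eq_iff forall_2 BN_nth)

lemma BN_ell2_e: "BN N b11 b12 W \<in> ell2_e"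
  by (rule ell2_e_finite[OF BN_gt])

lemma BN_Pi_le: "BN N b11 b12 (Pi_le N W) = BN N b11 b12 W"
  by (simp add: fun_eq_iff vec_eq_iff forall_2 BN_nth Pi_le_def)

lemma BN_scale: "BN N b11 b12 (\<lambda>n. c *\<^sub>R W n) = (\<lambda>n. c *\<^sub>R BN N b11 b12 W n)"
  by (simp add: fun_eq_iff vec_eq_iff forall_2 BN_nth sum_distrib_left algebra_simps)

lemma BN_add: "BN N b11 b12 (\<lambda>n. V n + W n) = (\<lambda>n. BN N b11 b12 V n + BN N b11 b12 W n)"
  by (simp add: fun_eq_iff vec_eq_iff forall_2 BN_nth sum.distrib algebra_simps)

lemma pair_norm2_scale:
  assumes "W \<in> ell2_e"
  shows "(\<lambda>n. c *\<^sub>R W n) \<in> ell2_e" "pair_norm2 (\<lambda>n. c *\<^sub>R W n) = \<bar>c\<bar> * pair_norm2 W"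
proof -
  have m: "(\<lambda>n. alpha n * \<bar>c * x n\<bar> powr 2) = (\<lambda>n. c\<^sup>2 * (alpha n * \<bar>x n\<bar> powr 2))" for x :: "nat \<Rightarrow> real"
    by (simp add: power_mult_distrib mult_ac)
  show e: "(\<lambda>n. c *\<^sub>R W n) \<in> ell2_e"
    using assms unfolding ell2_e_def ell_def comp_def
    by (auto simp del: powr_numeral simp: m intro!: summable_mult)
  have "(pair_norm2 (\<lambda>n. c *\<^sub>R W n))\<^sup>2 = c\<^sup>2 * (pair_norm2 W)\<^sup>2"
    using sums_unique2[OF pair_norm2_sums[OF e]] sums_mult[OF pair_norm2_sums[OF assms], of "c\<^sup>2"]
    by (simp add: power_mult_distrib mult_ac)
  then have "(pair_norm2 (\<lambda>n. c *\<^sub>R W n))\<^sup>2 = (\<bar>c\<bar> * pair_norm2 W)\<^sup>2"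
    by (simp add: power_mult_distrib)
  then show "pair_norm2 (\<lambda>n. c *\<^sub>R W n) = \<bar>c\<bar> * pair_norm2 W"
    using pair_norm2_nonneg by (subst (asm) power2_eq_iff_nonneg) auto
qed

lemma norm_le_pair_norm2:
  assumes "W \<in> ell2_e"
  shows "norm (W n) \<le> pair_norm2 W"
proof -
  have "(norm (W n))\<^sup>2 \<le> alpha n * (norm (W n))\<^sup>2"
    by (simp add: alpha_def)
  also have "\<dots> \<le> (pair_norm2 W)\<^sup>2"
    using sum_le_suminf[OF sums_summable[OF pair_norm2_sums[OF assms]], of "{n}"] sums_unique[OF pair_norm2_sums[OF assms]]
    by (simp add: less_imp_le alpha_pos)
  finally show ?thesis by (rule power2_le_imp_le[OF _ pair_norm2_nonneg])
qed

text \<open>The operator norm is a supremum of reals, so it bounds the values only once these are known to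
be bounded; finitely many matrix entries provide the bound \<open>K\<close>.\<close>

lemma BN_bounded:
  assumes W: "W \<in> ell2_e"
  shows "pair_norm2 (BN N b11 b12 W) \<le> op_norm2 (BN N b11 b12) * pair_norm2 W"
proof -
  let ?B = "BN N b11 b12" and ?U = "{U \<in> ell2_e. pair_norm2 U \<le> 1}"
  have bdd: "bdd_above ((\<lambda>U. pair_norm2 (?B U)) ` ?U)"
  proof (rule bdd_aboveI2)
    fix U assume U: "U \<in> ?U"
    have c: "\<bar>U k $ i\<bar> \<le> 1" for k i
      using component_le_norm_cart[of "U k" i] norm_le_pair_norm2[of U k] U by auto
    define K where "K = (\<lambda>n. (\<Sum>k\<le>N. \<bar>b11 n k\<bar>) + (\<Sum>k\<le>N. \<bar>b12 n k\<bar>) + 1)"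
    have n: "norm (?B U n) \<le> K n" for n
    proof -
      have "\<bar>\<Sum>k\<le>N. b n k * U k $ i\<bar> \<le> (\<Sum>k\<le>N. \<bar>b n k\<bar>)" for b :: "nat \<Rightarrow> nat \<Rightarrow> real" and i
        by (rule order_trans[OF sum_abs sum_mono]) (simp add: abs_mult mult_left_le c)
      from this[of b11 1] this[of b12 2] have "\<bar>?B U n $ 1\<bar> + \<bar>?B U n $ 2\<bar> \<le> K n"
        using c[of n 2] by (auto simp: BN_nth K_def intro!: add_nonneg_nonneg sum_nonneg)
      then show ?thesis
        using norm_le_l1_cart[of "?B U n"] by (simp add: sum_2)
    qed
    have "(pair_norm2 (?B U))\<^sup>2 = (\<Sum>n. alpha n * (norm (?B U n))\<^sup>2)"
      by (rule sums_unique[OF pair_norm2_sums[OF BN_ell2_e]])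
    also have "\<dots> = (\<Sum>n\<le>N. alpha n * (norm (?B U n))\<^sup>2)"
      by (rule suminf_finite) (auto simp: BN_gt not_le)
    also have "\<dots> \<le> (\<Sum>n\<le>N. alpha n * (K n)\<^sup>2)"
      by (intro sum_mono mult_left_mono power_mono n) (simp_all add: less_imp_le alpha_pos)
    finally show "pair_norm2 (?B U) \<le> sqrt (\<Sum>n\<le>N. alpha n * (K n)\<^sup>2)"
      by (rule real_le_rsqrt)
  qed
  show ?thesis
  proof (cases "pair_norm2 W = 0")
    case True
    then have "W n = 0" for n using norm_le_pair_norm2[OF W, of n] by simp
    then have "?B W n = 0" for n by (simp add: vec_eq_iff forall_2 BN_nth)
    then have "pair_norm2 (?B W) = 0"
      using sums_unique2[OF pair_norm2_sums[OF BN_ell2_e, of N b11 b12 W], of 0] by simp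
    then show ?thesis using True by simp
  next
    case False
    define c where "c = 1 / pair_norm2 W"
    have c: "c > 0" using False pair_norm2_nonneg[of W] by (simp add: c_def)
    have "(\<lambda>n. c *\<^sub>R W n) \<in> ?U"
      using pair_norm2_scale[OF W, of c] c False by (simp add: c_def)
    then have "pair_norm2 (?B (\<lambda>n. c *\<^sub>R W n)) \<le> op_norm2 ?B"
      unfolding op_norm2_def using bdd by (rule cSUP_upper)
    then have "c * pair_norm2 (?B W) \<le> op_norm2 ?B"
      using c by (simp add: BN_scale pair_norm2_scale[OF BN_ell2_e])
    then show ?thesis using c False pair_norm2_nonneg[of W] by (simp add: c_def field_simps)
  qed
qed

lemma Pi_ell2_e:
  assumes "W \<in> ell2_e"
  shows "Pi_le N W \<in> ell2_e" "Pi_gt N W \<in> ell2_e"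
  by (rule ell2_e_mono[OF assms]; simp add: Pi_le_def Pi_gt_def)+

lemma Bseq_eq: "Bseq N b11 b12 W n = (if n \<le> N then BN N b11 b12 W n else W n)"
  by (simp add: Bseq_def Pi_gt_def Pi_le_def BN_gt)

lemma Bseq_ell2_e:
  assumes "W \<in> ell2_e"
  shows "Bseq N b11 b12 W \<in> ell2_e"
    and "(pair_norm2 (Bseq N b11 b12 W))\<^sup>2 = (pair_norm2 (BN N b11 b12 W))\<^sup>2 + (pair_norm2 (Pi_gt N W))\<^sup>2"
proof -
  have s: "(norm (Bseq N b11 b12 W n))\<^sup>2 = (norm (BN N b11 b12 W n))\<^sup>2 + (norm (Pi_gt N W n))\<^sup>2" for n
    by (simp add: Bseq_eq Pi_gt_def Pi_le_def BN_gt)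
  have sm: "summable (\<lambda>n. alpha n * \<bar>comp i (Bseq N b11 b12 W) n\<bar> powr 2)"
    if "summable (\<lambda>n. alpha n * \<bar>comp i (BN N b11 b12 W) n\<bar> powr 2)"
      "summable (\<lambda>n. alpha n * \<bar>comp i (Pi_gt N W) n\<bar> powr 2)" for i
  proof -
    have "alpha n * \<bar>comp i (Bseq N b11 b12 W) n\<bar> powr 2 = alpha n * \<bar>comp i (BN N b11 b12 W) n\<bar> powr 2
        + alpha n * \<bar>comp i (Pi_gt N W) n\<bar> powr 2" for n
      by (simp add: Bseq_eq Pi_gt_def Pi_le_def BN_gt comp_def)
    then show ?thesis using summable_add[OF that] by (simp only:)
  qed
  show e: "Bseq N b11 b12 W \<in> ell2_e"
    using BN_ell2_e[of N b11 b12 W] Pi_ell2_e(2)[OF assms, of N] sm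
    unfolding ell2_e_def ell_def by blast
  show "(pair_norm2 (Bseq N b11 b12 W))\<^sup>2 = (pair_norm2 (BN N b11 b12 W))\<^sup>2 + (pair_norm2 (Pi_gt N W))\<^sup>2"
    by (rule pair_norm2_split[OF BN_ell2_e Pi_ell2_e(2)[OF assms] e s])
qed

text \<open>The finite block sees only the indices up to \<open>N\<close>, the identity only the others; both parts are
orthogonal before and after applying the operator.\<close>

lemma Bseq_bounded:
  assumes W: "W \<in> ell2_e"
  shows "pair_norm2 (Bseq N b11 b12 W) \<le> max 1 (op_norm2 (BN N b11 b12)) * pair_norm2 W"
proof -
  let ?m = "max 1 (op_norm2 (BN N b11 b12))"
  have "pair_norm2 (BN N b11 b12 W) \<le> op_norm2 (BN N b11 b12) * pair_norm2 (Pi_le N W)"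
    using BN_bounded[OF Pi_ell2_e(1)[OF W], of N b11 b12 N] by (simp add: BN_Pi_le)
  also have "\<dots> \<le> ?m * pair_norm2 (Pi_le N W)"
    by (rule mult_right_mono[OF _ pair_norm2_nonneg]) simp
  finally have 1: "(pair_norm2 (BN N b11 b12 W))\<^sup>2 \<le> (?m * pair_norm2 (Pi_le N W))\<^sup>2"
    by (rule power_mono[OF _ pair_norm2_nonneg])
  have 2: "(pair_norm2 (Pi_gt N W))\<^sup>2 \<le> (?m * pair_norm2 (Pi_gt N W))\<^sup>2"
    using mult_right_mono[OF max.cobounded1[of 1 "op_norm2 (BN N b11 b12)"] pair_norm2_nonneg[of "Pi_gt N W"]]
    by (intro power_mono pair_norm2_nonneg) simp
  have "(pair_norm2 W)\<^sup>2 = (pair_norm2 (Pi_le N W))\<^sup>2 + (pair_norm2 (Pi_gt N W))\<^sup>2"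
    by (rule pair_norm2_split[OF Pi_ell2_e[OF W] W]) (simp add: Pi_le_def Pi_gt_def)
  then have "(pair_norm2 (Bseq N b11 b12 W))\<^sup>2 \<le> (?m * pair_norm2 W)\<^sup>2"
    using 1 2 Bseq_ell2_e(2)[OF W, of N b11 b12] by (simp add: power_mult_distrib distrib_left)
  then show ?thesis
    by (rule power2_le_imp_le) (simp add: pair_norm2_nonneg)
qed

lemma Bseq_add: "Bseq N b11 b12 (\<lambda>n. V n + W n) = (\<lambda>n. Bseq N b11 b12 V n + Bseq N b11 b12 W n)"
  by (auto simp: Bseq_eq BN_add)

lemma ell1_Bseq:
  assumes "\<And>i. ell1 (comp i W)"
  shows "ell1 (comp i (Bseq N b11 b12 W))"
proof -
  have "ell1 (\<lambda>n. comp i (BN N b11 b12 W) n + (comp i W n - Pi_le N (comp i W) n))"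
    by (intro ell1_add ell1_diff assms ell1_support[of N])
       (simp_all add: BN_gt comp_def Pi_le_def)
  moreover have "(\<lambda>n. comp i (BN N b11 b12 W) n + (comp i W n - Pi_le N (comp i W) n)) = comp i (Bseq N b11 b12 W)"
    by (auto simp: fun_eq_iff comp_def Bseq_eq Pi_le_def BN_gt)
  ultimately show ?thesis by simp
qed

section \<open>The residual and its norm\<close>

lemma finite_support_ell1: "U = Pi_le M U \<Longrightarrow> ell1 (comp i U)"
  by (rule ell1_support[of M]) (metis Pi_le_def comp_def not_less zero_index)

lemma trig_poly_in_H_e:
  assumes d: "d > 0" and U: "U = Pi_le N0 U" and lim: "(Gamma2_dag d U \<longlongrightarrow> 0) (at_left d)"
  shows "Gamma2_dag d U \<in> H_e p"
    and "AE x in lborel. LL p (Gamma2_dag d U) x = Gamma2_dag d (Lseq p d U) x"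
    and "LL p (Gamma2_dag d U) \<in> L2"
proof -
  have s: "U n = 0" if "n > N0" for n using that U by (metis Pi_le_def not_less)
  have e: "ell1 (comp i U)" for i by (rule finite_support_ell1[OF U])
  have eL: "ell1 (comp i (Lseq p d U))" for i
    by (rule ell1_support[of N0]) (simp add: comp_def Lseq_def s)
  have c: "cosine_series (comp i U) pi = 0" for i
  proof (rule gamma_dag_boundary[OF d])
    show "comp i U n = 0" if "n > N0" for n using s[OF that] by (simp add: comp_def)
    have "((\<lambda>x. Gamma2_dag d U x $ i) \<longlongrightarrow> 0 $ i) (at_left d)"
      by (rule tendsto_vec_nth[OF lim])
    moreover have "(\<lambda>x. Gamma2_dag d U x $ i) = gamma_dag d (comp i U)"
      using exhaust_2[of i] by (auto simp: Gamma2_dag_nth)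
    ultimately show "(gamma_dag d (comp i U) \<longlongrightarrow> 0) (at_left d)" by simp
  qed
  have w: "weak_LL p (Gamma2_dag d U) (Gamma2_dag d (Lseq p d U))"
    by (rule gamma_dag_weak_LL[OF d s c c])
  have L: "Gamma2_dag d (Lseq p d U) \<in> L2" by (rule Gamma2_dag_L2[OF eL eL])
  show "Gamma2_dag d U \<in> H_e p"
    using w L Gamma2_dag_L2[OF e e] Gamma2_dag_even by (auto simp: H_e_def H_def)
  show "AE x in lborel. LL p (Gamma2_dag d U) x = Gamma2_dag d (Lseq p d U) x"
    and "LL p (Gamma2_dag d U) \<in> L2"
    using LL_eqI[OF w L] by auto
qed

lemma comp_simps: "comp 1 (\<lambda>n. V n + pair x y n) = (\<lambda>n. comp 1 V n + x n)"
  "comp 2 (\<lambda>n. V n + pair x y n) = (\<lambda>n. comp 2 V n + y n)"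
  by (simp_all add: comp_def pair_def)

text \<open>Outside \<open>(-d, d)\<close> both sides vanish almost everywhere, since the nonlinearity is zero at the origin. Inside, the linear part is
the cosine series of \<open>Lseq p d U\<close> and the quotient in the nonlinearity is that of \<open>Q\<close>.\<close>

lemma FF_cosine_series:
  fixes p :: params and d :: real and U :: "nat \<Rightarrow> real^2" and Q :: "nat \<Rightarrow> real"
  assumes d: "d > 0" and U: "U = Pi_le N0 U" and lim: "(Gamma2_dag d U \<longlongrightarrow> 0) (at_left d)"
    and Q: "ell1 Q" "\<And>\<theta>. cosine_series Q \<theta> = cosine_series (Psi p U) \<theta> / cosine_series (Phi p U) \<theta>"
  defines "F \<equiv> (\<lambda>n. Lseq p d U n + pair (\<lambda>n. - Q n - lam6 p * comp 1 U n - lam7 p * comp 2 U n) (\<lambda>_. 0) n)"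
  shows "\<And>i. ell1 (comp i F)"
    and "AE x in lborel. FF p (Gamma2_dag d U) x = Gamma2_dag d F x"
    and "Gamma2 d (FF p (Gamma2_dag d U)) = F"
proof -
  let ?u = "Gamma2_dag d U"
  define G where "G = (\<lambda>n. - Q n - lam6 p * comp 1 U n - lam7 p * comp 2 U n)"
  have s: "U n = 0" if "n > N0" for n using that U by (metis Pi_le_def not_less)
  have e: "ell1 (comp i U)" for i by (rule finite_support_ell1[OF U])
  have eL: "ell1 (comp i (Lseq p d U))" for i
    by (rule ell1_support[of N0]) (simp add: comp_def Lseq_def s)
  have eG: "ell1 G" unfolding G_def by (intro ell1_diff ell1_cmult ell1_minus Q e)
  have F1: "comp 1 F = (\<lambda>n. comp 1 (Lseq p d U) n + G n)" and F2: "comp 2 F = comp 2 (Lseq p d U)"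
    unfolding F_def comp_simps G_def by simp_all
  show eF: "ell1 (comp i F)" for i
    using exhaust_2[of i] ell1_add[OF eL eG] F1 F2 eL by auto
  have "GG p ?u x $ 1 = gamma_dag d G x" for x
  proof (cases "x \<in> {-d<..<d}")
    case True
    let ?a = "cosine_series (comp 1 U) (pi * x / d)" and ?b = "cosine_series (comp 2 U) (pi * x / d)"
    have "cosine_series G (pi * x / d) = - cosine_series Q (pi * x / d) - lam6 p * ?a - lam7 p * ?b"
      using cosine_series_cmult[OF Q(1), of "- 1"] Q(1) e ell1_minus[OF Q(1)]
      unfolding G_def by (simp add: cosine_series_simps)
    also have "\<dots> = g_fun p ?a ?b"
      unfolding Q(2) g_fun_def by (simp add: cosine_series_Psi e cosine_series_Phi)
    finally show ?thesis
      using True by (simp add: GG_def Gamma2_dag_nth gamma_dag_eq)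
  next
    case False
    then show ?thesis by (simp add: GG_def Gamma2_dag_nth gamma_dag_eq g_fun_def)
  qed
  moreover have "gamma_dag d (comp 1 F) x = gamma_dag d (comp 1 (Lseq p d U)) x + gamma_dag d G x" for x
    unfolding gamma_dag_eq F1 using eL eG by (simp add: cosine_series_add algebra_simps)
  ultimately have GF: "Gamma2_dag d (Lseq p d U) x + GG p ?u x = Gamma2_dag d F x" for x
    by (simp add: vec_eq_iff forall_2 Gamma2_dag_nth F2 GG_def)
  show ae: "AE x in lborel. FF p ?u x = Gamma2_dag d F x"
    using trig_poly_in_H_e(2)[OF d U lim, of p] by eventually_elim (simp add: FF_def GF)
  have g: "gamma d (\<lambda>x. FF p ?u x $ i) = comp i F" for i
  proof (rule gamma_eqI[OF d eF])
    have GGi: "(\<lambda>x. GG p ?u x $ i) = (\<lambda>x. Gamma2_dag d F x $ i - Gamma2_dag d (Lseq p d U) x $ i)"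
      by (simp add: GF[symmetric])
    have gm: "(\<lambda>x. Gamma2_dag d W x $ i) \<in> borel_measurable borel" for W
      using exhaust_2[of i] by (auto simp: Gamma2_dag_nth)
    have "(\<lambda>x. GG p ?u x $ i) \<in> borel_measurable borel"
      unfolding GGi by (intro borel_measurable_diff gm)
    moreover have "(\<lambda>x. LL p ?u x $ i) \<in> borel_measurable borel"
      using L2_comp_square_integrable(1)[OF trig_poly_in_H_e(3)[OF d U lim]] by simp
    ultimately show "(\<lambda>x. FF p ?u x $ i) \<in> borel_measurable borel"
      unfolding FF_def vector_add_component by (intro borel_measurable_add)
    show "AE x in lborel. x \<in> {-d<..<d} \<longrightarrow> FF p ?u x $ i = cosine_series (comp i F) (pi * x / d)"
      using ae by eventually_elim (use exhaust_2[of i] in \<open>auto simp: Gamma2_dag_nth gamma_dag_eq\<close>)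
  qed
  show "Gamma2 d (FF p ?u) = F"
    unfolding Gamma2_def g by (simp add: fun_eq_iff pair_def comp_def vec_eq_iff forall_2)
qed

text \<open>The residual vanishes outside \<open>(-d, d)\<close>, so the exterior part of \<open>BB\<close> contributes nothing. The
norm on the domain is the \<open>L\<^sup>2\<close> norm of the image under the operator, which
cancels the inverse contained in \<open>AA\<close>.\<close>

lemma norm_AA_eq:
  assumes nu: "nu p > 0" and det: "\<exists>\<sigma>0 > 0. \<forall>\<xi>. \<bar>det (symb p \<xi>)\<bar> \<ge> \<sigma>0" and d: "d > 0"
    and F: "\<And>i. ell1 (comp i F)" "AE x in lborel. v x = Gamma2_dag d F x" "Gamma2 d v = F"
  shows "AA p d N b11 b12 v \<in> H_e p"
    and "norm_H p (AA p d N b11 b12 v) = sqrt (2 * d) * pair_norm2 (Bseq N b11 b12 F)"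
proof -
  let ?W = "Bseq N b11 b12 F"
  have eW: "ell1 (comp i ?W)" for i by (rule ell1_Bseq[OF F(1)])
  have "AE x in lborel. BB d N b11 b12 v x = Gamma2_dag d ?W x"
    using F(2)
  proof eventually_elim
    case (elim x)
    have "x \<notin> {-d<..<d} \<Longrightarrow> Gamma2_dag d F x = 0"
      by (simp add: vec_eq_iff forall_2 Gamma2_dag_nth gamma_dag_eq)
    then show ?case by (auto simp: BB_def F(3) elim indicator_def)
  qed
  note L = LL_inv_solves[OF nu det _ _ Gamma2_dag_even this]
  have b: "bounded_integrable (\<lambda>x. of_real (Gamma2_dag d ?W x $ 1))"
    "bounded_integrable (\<lambda>x. of_real (Gamma2_dag d ?W x $ 2))"
    unfolding Gamma2_dag_nth by (intro bounded_integrable_gamma_dag eW)+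
  show "AA p d N b11 b12 v \<in> H_e p"
    unfolding AA_def using L(1)[OF b] .
  show "norm_H p (AA p d N b11 b12 v) = sqrt (2 * d) * pair_norm2 ?W"
    unfolding AA_def using L(2)[OF b] norm_L2_Gamma2_dag[OF d eW eW] by simp
qed

text \<open>All sequences are finite, so projecting to the indices up to \<open>N0\<close> or \<open>4 * N0\<close> changes nothing and
the second term is the part of \<open>F0\<close> beyond \<open>N\<close>. For \<open>N0 \<le> N\<close> the entries of \<open>U\<close> beyond \<open>N\<close>
vanish, and the two variants of that part differ only by a sign.\<close>

lemma Y01_tail_g_eq:
  fixes p :: params and d :: real and U :: "nat \<Rightarrow> real^2" and q :: "nat \<Rightarrow> real"
  assumes U: "\<And>n. n > N0 \<Longrightarrow> U n = 0" and q: "\<And>n. n > 2 * N0 \<Longrightarrow> q n = 0"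
  defines "F0 \<equiv> (\<lambda>n. Lseq p d U n + pair (gseq p q U) (\<lambda>_. 0) n)"
  shows "F0 \<in> ell2_e"
    and "Y01_tail_g p d N N0 b11 b12 q U = pair_norm2 (Bseq N b11 b12 F0)"
    and "N0 \<le> N \<Longrightarrow> Y01 p d N N0 b11 b12 q U = pair_norm2 (Bseq N b11 b12 F0)"
proof -
  let ?V = "Psi p U \<star> q"
  have P: "?V n = 0" if "n > 4 * N0" for n
    using conv_support[of "2 * N0" "Psi p U" "2 * N0" q n] Psi_support[OF U] q that by simp
  have g: "gseq p q U n = 0" if "n > 4 * N0" for n
    using P[OF that] U[of n] that by (simp add: gseq_def)
  have L: "Lseq p d U n = 0" if "n > N0" for n using U[OF that] by (simp add: Lseq_def)
  have pi: "Pi_le N0 (Lseq p d U) = Lseq p d U" "Pi_le (4 * N0) (gseq p q U) = gseq p q U"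
    "Pi_le (4 * N0) ?V = ?V"
    using L g P by (auto simp: Pi_le_def fun_eq_iff)
  show F0: "F0 \<in> ell2_e"
    by (rule ell2_e_finite[of "4 * N0"]) (simp add: F0_def L g pair_def vec_eq_iff forall_2)
  have Y: "Y01_with p d N N0 b11 b12 q U V = pair_norm2 (Bseq N b11 b12 F0)"
    if "pair_norm2 (\<lambda>n. Pi_le N0 (Lseq p d U) n - Pi_le N (Lseq p d U) n
              + pair (\<lambda>m. Pi_le (4 * N0) V m - Pi_le N V m) (\<lambda>_. 0) n) = pair_norm2 (Pi_gt N F0)" for V
    unfolding Y01_with_def that F0_def[symmetric] using Bseq_ell2_e(2)[OF F0, of N b11 b12] pair_norm2_nonneg
    by (metis abs_of_nonneg real_sqrt_abs)
  show "Y01_tail_g p d N N0 b11 b12 q U = pair_norm2 (Bseq N b11 b12 F0)"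
    unfolding Y01_tail_g_def
    by (rule Y, rule arg_cong[of _ _ pair_norm2], unfold pi)
       (simp add: F0_def Pi_gt_def Pi_le_def pair_def fun_eq_iff vec_eq_iff forall_2)
  show "Y01 p d N N0 b11 b12 q U = pair_norm2 (Bseq N b11 b12 F0)" if N: "N0 \<le> N"
    unfolding Y01_def
  proof (rule Y, rule pair_norm2_cong_norm[OF _ Pi_ell2_e(2)[OF F0]])
    let ?T = "\<lambda>n. Pi_le N0 (Lseq p d U) n - Pi_le N (Lseq p d U) n
              + pair (\<lambda>m. Pi_le (4 * N0) ?V m - Pi_le N ?V m) (\<lambda>_. 0) n"
    show "?T \<in> ell2_e"
      by (rule ell2_e_finite[of "4 * N0"]) (simp add: pi L P Pi_le_def pair_def vec_eq_iff forall_2)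
    show "norm (?T n) = norm (Pi_gt N F0 n)" for n
    proof (cases "n \<le> N")
      case True
      then show ?thesis
        unfolding pi by (simp add: Pi_gt_def Pi_le_def pair_def norm_vec_def L2_set_def sum_2)
    next
      case False
      then have "Lseq p d U n = 0" "U n = 0" using L U N by auto
      then have "?T n = vector [?V n, 0]" "Pi_gt N F0 n = - vector [?V n, 0]"
        using False unfolding pi
        by (simp_all add: Pi_gt_def Pi_le_def pair_def F0_def gseq_def vec_eq_iff forall_2)
      then show ?thesis by (simp only: norm_minus_cancel)
    qed
  qed
qed

theorem lemma2p7:
  fixes p :: params and d :: real and N N0 :: nat
    and b11 b12 :: "nat \<Rightarrow> nat \<Rightarrow> real"
    and Phi_inv :: "nat \<Rightarrow> real" and U :: "nat \<Rightarrow> real^2"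
  assumes "nu p > 0" "nu1 p > 0" "nu2 p > 0" "nu3 p > 0" "nu4 p > 0" "nu5 p > 0"
    and "nu2 p > 1 / 4"
    and "lam1_root p"
    and "\<exists>\<sigma>0 > 0. \<forall>\<xi>. \<bar>det (symb p \<xi>)\<bar> \<ge> \<sigma>0"
    and "d \<ge> 1"
    and "Phi_inv = Pi_le (2 * N0) Phi_inv"
    and "U = Pi_le N0 U"
    and "(Gamma2_dag d U \<longlongrightarrow> 0) (at_left d)"
    and "(Gamma2_dag d U \<longlongrightarrow> 0) (at_right (- d))"
    and "seq_norm 1 (residual p Phi_inv U) < 1"
  shows "Gamma2_dag d U \<in> H_e p
    \<and> AA p d N b11 b12 (FF p (Gamma2_dag d U)) \<in> H_e p
    \<and> (N0 \<le> N \<longrightarrow>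
         norm_H p (AA p d N b11 b12 (FF p (Gamma2_dag d U)))
           \<le> sqrt (2 * d) * (Y01 p d N N0 b11 b12 Phi_inv U + Y02 p N b11 b12 Phi_inv U))
    \<and> norm_H p (AA p d N b11 b12 (FF p (Gamma2_dag d U)))
        \<le> sqrt (2 * d) * (Y01_tail_g p d N N0 b11 b12 Phi_inv U + Y02 p N b11 b12 Phi_inv U)"
proof -
  let ?u = "Gamma2_dag d U" and ?r = "residual p Phi_inv U"
  have d: "d > 0" using \<open>d \<ge> 1\<close> by simp
  note U = \<open>U = Pi_le N0 U\<close> and lim = \<open>(Gamma2_dag d U \<longlongrightarrow> 0) (at_left d)\<close>
  have s: "U n = 0" if "n > N0" for n using that U by (metis Pi_le_def not_less)
  have q0: "Phi_inv n = 0" if "n > 2 * N0" for n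
    using that \<open>Phi_inv = _\<close> by (metis Pi_le_def not_less)
  have e: "ell1 (comp i U)" for i by (rule finite_support_ell1[OF U])
  have q: "ell1 Phi_inv" using q0 by (rule ell1_support)
  note res = residual_cosine_series(1)[OF e q, of p]
  have r1: "l1_norm ?r < 1"
    using \<open>seq_norm 1 _ < 1\<close> by (simp add: seq_norm_1[OF res])
  define \<kappa> where "\<kappa> = l1_norm (Phi_inv \<star> ?r) / (1 - l1_norm ?r)"
  obtain Q where Q: "ell1 Q"
    "\<And>\<theta>. cosine_series Q \<theta> = cosine_series (Psi p U) \<theta> / cosine_series (Phi p U) \<theta>"
    "\<And>\<theta>. \<bar>cosine_series (Psi p U \<star> Phi_inv) \<theta> - cosine_series Q \<theta>\<bar> \<le> \<kappa> * \<bar>cosine_series (Psi p U) \<theta>\<bar>"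
    unfolding \<kappa>_def using quotient_cosine_series[OF e e q r1] by blast
  define F where "F = (\<lambda>n. Lseq p d U n + pair (\<lambda>n. - Q n - lam6 p * comp 1 U n - lam7 p * comp 2 U n) (\<lambda>_. 0) n)"
  note F = FF_cosine_series[OF d U lim Q(1,2), folded F_def]
  note A = norm_AA_eq[OF \<open>nu p > 0\<close> \<open>\<exists>\<sigma>0 > 0. \<forall>\<xi>. _\<close> d F, of N b11 b12]
  define F0 where "F0 = (\<lambda>n. Lseq p d U n + pair (gseq p Phi_inv U) (\<lambda>_. 0) n)"
  note Y = Y01_tail_g_eq[of N0 U Phi_inv, OF s q0, where p = p and d = d, folded F0_def]
  \<comment> \<open>the error made by replacing the exact inverse of the denominator by the approximate one\<close>
  define D where "D = (\<lambda>n. (Psi p U \<star> Phi_inv) n - Q n)"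
  define E where "E = pair D (\<lambda>_. 0)"
  note psi = cosine_series_Psi(1)[OF e e, of p]
  have eD: "ell1 D" unfolding D_def by (intro ell1_diff ell1_conv psi q Q)
  have E_ell2: "E \<in> ell2_e"
    using eD by (intro ell2_e_I) (simp_all add: E_def pair_def comp_def ell1_def)
  have FE: "F = (\<lambda>n. F0 n + E n)"
    by (simp add: F_def F0_def E_def D_def gseq_def pair_def comp_def fun_eq_iff vec_eq_iff forall_2)
  have k: "\<kappa> \<ge> 0"
    unfolding \<kappa>_def l1_norm_eq_cosine_series[of "Phi_inv \<star> ?r"]
    using r1 l1_norm_eq_cosine_series[of "Phi_inv \<star> ?r"] cosine_series_bound[OF ell1_conv[OF q res], of 0]
    by (intro divide_nonneg_nonneg) (simp_all add: l1_norm_def)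
  have "pair_norm2 E = seq_norm 2 D"
  proof -
    have "seq_norm 2 D \<ge> 0" "seq_norm 2 (\<lambda>_. 0) = 0" by (simp_all add: seq_norm_def)
    then show ?thesis by (simp add: pair_norm2_def E_def pair_def comp_def)
  qed
  also have "\<dots> \<le> \<kappa> * seq_norm 2 (Psi p U)"
    using Q(3) by (intro seq_norm_2_le_of_cosine_series eD psi k)
      (simp add: D_def cosine_series_diff ell1_conv psi q Q(1))
  finally have nE: "pair_norm2 E \<le> \<kappa> * seq_norm 2 (Psi p U)" .
  have "pair_norm2 (Bseq N b11 b12 F) \<le> pair_norm2 (Bseq N b11 b12 F0) + pair_norm2 (Bseq N b11 b12 E)"
  proof (rule pair_norm2_triangle)
    show "Bseq N b11 b12 F0 \<in> ell2_e" "Bseq N b11 b12 E \<in> ell2_e" "Bseq N b11 b12 F \<in> ell2_e"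
      using Y(1) E_ell2 ell2_e_I[OF F(1) F(1)] by (auto intro: Bseq_ell2_e)
    show "norm (Bseq N b11 b12 F n) \<le> norm (Bseq N b11 b12 F0 n) + norm (Bseq N b11 b12 E n)" for n
      unfolding FE Bseq_add by (rule norm_triangle_ineq)
  qed
  also have "pair_norm2 (Bseq N b11 b12 E) \<le> max 1 (op_norm2 (BN N b11 b12)) * (\<kappa> * seq_norm 2 (Psi p U))"
    by (rule order_trans[OF Bseq_bounded[OF E_ell2] mult_left_mono[OF nE]]) simp
  also have "\<dots> = Y02 p N b11 b12 Phi_inv U"
    by (simp add: Y02_def \<kappa>_def seq_norm_1 res ell1_conv q)
  finally have bound: "norm_H p (AA p d N b11 b12 (FF p ?u))
      \<le> sqrt (2 * d) * (pair_norm2 (Bseq N b11 b12 F0) + Y02 p N b11 b12 Phi_inv U)"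
    unfolding A(2) using d by (intro mult_left_mono) simp_all
  show ?thesis
    using trig_poly_in_H_e(1)[OF d U lim] A(1) bound by (simp add: Y(2,3))
qed

end
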